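(* Let $N>2$, $\theta\in\mathbb{R}$ and let $k\geq1$ be a fixed integer. Let $K'>0$, $K>\max(2,2K')$, $1\leq y'\leq(\log N)^{K'}$ and suppose $(\log N)^K\leq y\leq N^\eta$ for some small constant $\eta=\eta(k)\in(0,1)$. Let $\delta=\delta(N)>0$ be a function of $N$ satisfying $\log_5N\ll\delta(N)^{-1}<\log_2N$ for all sufficiently large $N$. Suppose $0<\varepsilon\leq\delta/2$ and $\varepsilon<\delta(N)^{-O(1)}(\log N)^{-C_1}$ for some fixed constant $C_1\geq1$. Then, provided $K$ and $C_1$ are sufficiently large depending on $k$: if $\|n^k\theta\|\leq\varepsilon$ holds for at least $\delta\Psi(N,[y',y])$ elements $n\in S(N,[y',y])$, then there is a positive integer $q\ll\delta^{-O(1)}$ with $$\|q\theta\|\ll\varepsilon\,\delta^{-O_{C_1}(1)}/N^k.$$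
   Context: $\log_k$ is the $k$-fold iterated logarithm; $\|\cdot\|$ is the distance to the nearest integer. $S([y',y])$ is the set of positive integers all of whose prime factors lie in $[y',y]$, $S(N,[y',y])=S([y',y])\cap[1,N]$, $\Psi(N,[y',y])=|S(N,[y',y])|$. *)

theory Defs
  imports Complex_Main "HOL-Computational_Algebra.Primes"
begin

definition nint_dist :: "real \<Rightarrow> real" where
  "nint_dist x = \<bar>x - of_int (round x)\<bar>"

text \<open>The \<open>j\<close>-fold iterated natural logarithm (as opposed to a logarithm to base \<open>j\<close>).\<close>

definition iter_ln :: "nat \<Rightarrow> real \<Rightarrow> real" where
  "iter_ln j x = (ln ^^ j) x"

definition smooth_set :: "real \<Rightarrow> real \<Rightarrow> nat set" where
  "smooth_set y' y = {n. n > 0 \<and> (\<forall>p. prime p \<and> p dvd n \<longrightarrow> real p \<in> {y'..y})}"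

definition smooth_upto :: "real \<Rightarrow> real \<Rightarrow> real \<Rightarrow> nat set" where
  "smooth_upto N y' y = smooth_set y' y \<inter> {n. real n \<in> {1..N}}"

definition smooth_count :: "real \<Rightarrow> real \<Rightarrow> real \<Rightarrow> nat" where
  "smooth_count N y' y = card (smooth_upto N y' y)"

end

theory Submission
  imports Defs "HOL-Number_Theory.Cong" "HOL-Real_Asymp.Real_Asymp"
begin

text \<open>Call \<open>n\<close> near if \<open>n ^ k * \<theta>\<close> is within \<open>\<epsilon>\<close> of an integer \<open>r\<^sub>n\<close>, and let \<open>p\<close> be a large prime
  factor of a near \<open>n = m * p\<close>. By double counting over \<open>m\<close>, for most such pairs a proportion at least
  \<open>1 / (ln N)\<^sup>2\<close> of all integers \<open>p' \<le> p\<close> makes \<open>m * p'\<close> near as well. Repeated differencing then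
  shows that \<open>m ^ k * \<theta>\<close> is very close to a fraction with denominator smaller than \<open>p\<close>, which forces
  \<open>p ^ k\<close> to divide \<open>r\<^sub>n\<close>. Hence for most near \<open>n\<close> the fraction \<open>r\<^sub>n / n ^ k\<close> has a denominator below
  \<open>N ^ (k / 5)\<close>, while it approximates \<open>\<theta>\<close> with error about \<open>\<epsilon> / N ^ k\<close>; so all these fractions
  coincide. The common fraction has denominator dividing \<open>q = g ^ k\<close>, where \<open>g\<close> is the greatest common
  divisor of the \<open>n\<close> involved.

  It remains to see that \<open>g\<close> and \<open>N / n\<close>, for the largest such \<open>n\<close>, are at most a power of
  \<open>1 / \<delta>\<close>. This follows from a power decay of the count of smooth integers below \<open>N / u\<close>: a typical
  smooth integer cannot have almost all of its prime factors within a constant factor of \<open>y\<close>, and each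
  prime factor \<open>p \<le> y / z\<close> can be replaced by about \<open>z * p\<close> primes up to \<open>z * p\<close>.\<close>

section \<open>Chebyshev bounds\<close>

text \<open>The counting part is shaped by the range of \<open>y\<close>, from a fixed power of
  \<open>L = ln N\<close> up to \<open>N powr (1/40)\<close>: a smooth integer may have boundedly
  many prime factors or about \<open>L / ln L\<close>. Instead of an asymptotic formula, counts are
  compared with each other by summing \<open>ln p\<close> over pairs \<open>n = m * p\<close>,
  grouped by \<open>n\<close>, by \<open>p\<close> or by \<open>m\<close>; this needs only Chebyshev
  bounds, but loses powers of \<open>L\<close>. In the recurrence the loss is paid by the factor
  \<open>ln N powr (- C\<^sub>1)\<close> in the bound for \<open>\<epsilon>\<close>, and exceptional
  sets of density \<open>O(1 / L)\<close> are harmless since \<open>\<delta> > 1 / ln L\<close>. The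
  bounds for \<open>g\<close> and \<open>N / n\<close>, however, must be free of \<open>L\<close>.
  This is why a doubling \<open>Psi a b x \<le> Psi a b (z * x) / 2\<close> with a constant
  \<open>z\<close> has to be proved.

  The threshold between small and large primes is \<open>w = L powr (K / 2)\<close>. It exceeds
  \<open>y'\<close> by a power of \<open>L\<close>, so that Chebyshev bounds hold for the primes
  from \<open>y'\<close> to \<open>w\<close>, and it exceeds all denominators of the recurrence; yet
  the part of \<open>n\<close> made of primes up to \<open>w\<close> is typically below
  \<open>N powr (1/10)\<close>. That part and the primes where the recurrence fails make up the
  denominators.\<close>

definition theta :: "real \<Rightarrow> real" where
  "theta x = (\<Sum>p | prime p \<and> real p \<le> x. ln (real p))"

lemma finite_nat_le_real [simp]: "finite {n::nat. real n \<le> x}"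
proof (rule finite_subset)
  show "{n::nat. real n \<le> x} \<subseteq> {..nat \<lfloor>x\<rfloor>}"
    by (auto simp: le_nat_floor)
qed simp

lemma finite_le_real [simp]: "finite {n::nat. P n \<and> real n \<le> x}"
  by (rule finite_subset[OF _ finite_nat_le_real[of x]]) auto

section \<open>The upper Chebyshev bound\<close>

lemma prod_primes_dvd:
  assumes "finite P" "\<And>p. p \<in> P \<Longrightarrow> prime p" "\<And>p. p \<in> P \<Longrightarrow> p dvd n"
  shows "\<Prod>P dvd (n::nat)"
  using assms
proof (induction P rule: finite_induct)
  case (insert p P)
  have "coprime p (\<Prod>P)"
    by (rule prod_coprime_right) (use insert in \<open>auto intro: primes_coprime\<close>)
  with insert show ?case by (simp add: divides_mult)
qed simp

text \<open>Erdos's argument. Every prime in \<open>{m + 2..2 * m + 1}\<close> divides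
  \<open>(2 * m + 1) choose m\<close>, and this coefficient is at most \<open>4 ^ m\<close> because
  it occurs twice in a row with sum \<open>2 * 4 ^ m\<close>; the primes up to \<open>m + 1\<close>
  are left to induction. An even \<open>n > 2\<close> is not prime and reduces to
  \<open>n - 1\<close>.\<close>

lemma primorial_le: "(\<Prod>p | prime p \<and> p \<le> n. p) \<le> 4 ^ (n::nat)"
proof (induction n rule: less_induct)
  case (less n)
  consider "n \<le> 2" | "n > 2" "even n" | m where "n = 2 * m + 1" "m \<ge> 1"
  proof (cases "n \<le> 2 \<or> even n")
    case False
    then obtain m where "n = 2 * m + 1" by (auto elim: oddE)
    with False that(3)[of m] show ?thesis by auto
  next
    case True
    thus ?thesis using that(1,2) by (metis not_le)
  qed
  then show ?case
  proof cases
    case 1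
    have "\<Prod>{p::nat. prime p \<and> p \<le> n} \<le> n ^ card {p::nat. prime p \<and> p \<le> n}"
      using prod_mono[of "{p::nat. prime p \<and> p \<le> n}" "\<lambda>p. p" "\<lambda>_. n"] by simp
    also have "\<dots> \<le> 4 ^ card {p::nat. prime p \<and> p \<le> n}"
      using 1 by (intro power_mono) auto
    also have "card {p::nat. prime p \<and> p \<le> n} \<le> card {1..n}"
      by (intro card_mono) (auto dest: prime_ge_1_nat)
    hence "(4::nat) ^ card {p::nat. prime p \<and> p \<le> n} \<le> 4 ^ n" by (intro power_increasing) auto
    finally show ?thesis .
  next
    case 2
    have "\<not> prime n" using 2 prime_odd_nat by auto
    hence "p \<le> n \<longleftrightarrow> p \<le> n - 1" if "prime p" for p
      using that 2 by (cases "p = n") auto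
    hence "{p. prime p \<and> p \<le> n} = {p. prime p \<and> p \<le> n - 1}" by blast
    moreover have "(\<Prod>p | prime p \<and> p \<le> n - 1. p) \<le> 4 ^ (n - 1)" using less[of "n-1"] 2 by auto
    moreover have "(4::nat) ^ (n - 1) \<le> 4 ^ n" by (intro power_increasing) auto
    ultimately show ?thesis by (metis le_trans)
  next
    case 3
    define P where "P = {p. prime p \<and> m + 1 < p \<and> p \<le> 2 * m + 1}"
    have fin: "finite P" "finite {p::nat. prime p \<and> p \<le> m + 1}" unfolding P_def by auto
    have eq: "{p. prime p \<and> p \<le> n} = {p. prime p \<and> p \<le> m + 1} \<union> P" using 3 by (auto simp: P_def)
    have F: "fact m * fact (m + 1) * ((2 * m + 1) choose m) = (fact (2 * m + 1) :: nat)"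
      using binomial_fact_lemma[of m "2 * m + 1"] by (simp add: mult.commute)
    have "\<Prod>P dvd ((2 * m + 1) choose m)"
    proof (rule prod_primes_dvd)
      fix p assume p: "p \<in> P"
      hence "p dvd fact m * fact (m + 1) * ((2 * m + 1) choose m)"
        unfolding F by (subst prime_dvd_fact_iff) (auto simp: P_def)
      with p show "p dvd ((2 * m + 1) choose m)"
        by (auto simp: P_def prime_dvd_mult_iff prime_dvd_fact_iff simp del: fact_Suc)
    qed (auto simp: fin P_def)
    hence "\<Prod>P \<le> ((2 * m + 1) choose m)" by (rule dvd_imp_le) auto
    also have "\<dots> \<le> 4 ^ m"
    proof -
      have "2 * ((2 * m + 1) choose m) = (\<Sum>k\<in>{m, m + 1}. (2 * m + 1) choose k)"
      proof -
        have "2 * m + 1 - m = m + 1" by simp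
        with binomial_symmetric[of m "2 * m + 1"]
        have sym: "(2 * m + 1) choose m = (2 * m + 1) choose (m + 1)" by (simp only: le_add1 mult_2 add.assoc)
        show ?thesis by (subst sum.insert) (simp_all only: sym, simp_all del: binomial_Suc_Suc)
      qed
      also have "\<dots> \<le> (\<Sum>k\<le>2 * m + 1. (2 * m + 1) choose k)" by (intro sum_mono2) auto
      also have "\<dots> = 2 ^ (2 * m + 1)" by (rule choose_row_sum)
      finally show ?thesis by (simp add: power_mult)
    qed
    finally have 1: "\<Prod>P \<le> 4 ^ m" .
    have 2: "(\<Prod>p | prime p \<and> p \<le> m + 1. p) \<le> 4 ^ (m + 1)" using less[of "m+1"] 3 by auto
    have "(\<Prod>p | prime p \<and> p \<le> n. p) = (\<Prod>p | prime p \<and> p \<le> m + 1. p) * \<Prod>P"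
      unfolding eq by (subst prod.union_disjoint) (use fin in \<open>auto simp: P_def\<close>)
    also have "\<dots> \<le> 4 ^ (m + 1) * 4 ^ m" by (intro mult_mono 1 2) auto
    also have "\<dots> = 4 ^ n" using 3 by (simp add: power_add [symmetric])
    finally show ?thesis .
  qed
qed

lemma theta_le: 
  assumes "x \<ge> 0" shows "theta x \<le> 2 * x"
proof -
  define n where "n = nat \<lfloor>x\<rfloor>"
  have eq: "{p. prime p \<and> real p \<le> x} = {p. prime p \<and> p \<le> n}"
    using assms by (auto simp: n_def le_nat_floor) (metis le_floor_iff le_nat_iff nat_le_iff of_int_of_nat_eq zero_le_floor)
  have "theta x = ln (\<Prod>p | prime p \<and> p \<le> n. real p)"
    unfolding theta_def eq by (subst ln_prod) (auto simp: prime_gt_0_nat)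
  also have "(\<Prod>p | prime p \<and> p \<le> n. real p) = real (\<Prod>p | prime p \<and> p \<le> n. p)" by simp
  also have "ln \<dots> \<le> ln (real (4 ^ n))"
  proof (subst ln_le_cancel_iff)
    show "real (\<Prod>p | prime p \<and> p \<le> n. p) \<le> real (4 ^ n)"
      using primorial_le[of n] by (simp only: of_nat_le_iff)
    show "real (\<Prod>p | prime p \<and> p \<le> n. p) > 0"
      by (simp only: of_nat_0_less_iff) (auto intro!: prod_pos simp: prime_gt_0_nat)
  qed simp
  also have "\<dots> = n * ln 4" by (simp add: ln_realpow)
  also have "ln (4::real) \<le> 2" 
  proof -
    have "ln (4::real) = 2 * ln 2" using ln_realpow[of 2 2] by simp
    thus ?thesis using ln_le_minus_one[of 2] by simp
  qed
  hence "n * ln 4 \<le> n * (2::real)" by (intro mult_left_mono) auto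
  also have "\<dots> \<le> 2 * x" using assms by (simp add: n_def)
  finally show ?thesis by simp
qed

section \<open>Legendre's formula and the lower Chebyshev bound\<close>

lemma card_prime_power_dvd:
  assumes "prime (p::nat)" "k > 0" "k \<le> J"
  shows "card {j \<in> {1..J}. p ^ j dvd k} = multiplicity p k"
proof -
  define v where "v = multiplicity p k"
  have iff: "p ^ j dvd k \<longleftrightarrow> j \<le> v" for j
    using assms unfolding v_def by (intro power_dvd_iff_le_multiplicity) auto
  have "v < p ^ v" using prime_gt_Suc_0_nat[OF assms(1)] by (rule power_gt_expt)
  also have "\<dots> \<le> k" unfolding v_def by (rule dvd_imp_le[OF multiplicity_dvd assms(2)])
  finally have "v \<le> J" using assms by simp
  hence "{j \<in> {1..J}. p ^ j dvd k} = {1..v}" unfolding iff by auto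
  thus ?thesis by (simp add: v_def)
qed

text \<open>Legendre's formula. Any cutoff \<open>J \<ge> m\<close> will do, since
  \<open>p ^ j > j\<close> makes the terms with \<open>j > m\<close> vanish. A common cutoff
  \<open>2 * n\<close> later lets the formulas for \<open>n\<close> and \<open>2 * n\<close> be
  subtracted term by term.\<close>

lemma multiplicity_fact:
  assumes "prime (p::nat)" "m \<le> J"
  shows "multiplicity p (fact m) = (\<Sum>j=1..J. m div p ^ j)"
  using assms(2)
proof (induction m)
  case (Suc m)
  have "(\<Sum>j=1..J. Suc m div p ^ j) = (\<Sum>j=1..J. m div p ^ j + (if p ^ j dvd Suc m then 1 else 0))"
    by (intro sum.cong refl) (auto simp: div_Suc dvd_eq_mod_eq_0)
  also have "\<dots> = multiplicity p (fact m) + card {j \<in> {1..J}. p ^ j dvd Suc m}"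
    using Suc by (simp add: sum.distrib sum.If_cases Int_def)
  also have "card {j \<in> {1..J}. p ^ j dvd Suc m} = multiplicity p (Suc m)"
    using Suc assms by (intro card_prime_power_dvd) auto
  finally show ?case using assms
    by (simp add: prime_elem_multiplicity_mult_distrib del: mult_Suc)
qed simp

text \<open>By Legendre's formula the exponent is a sum of differences
  \<open>(2 * n) div p ^ j - 2 * (n div p ^ j)\<close>, each at most one and zero once
  \<open>p ^ j > 2 * n\<close>. Hence it is at most the number of \<open>j \<ge> 1\<close> with
  \<open>p ^ j \<le> 2 * n\<close>.\<close>

lemma prime_power_central_binomial_le:
  assumes p: "prime (p::nat)" and n: "n > 0"
  shows "p ^ multiplicity p ((2 * n) choose n) \<le> 2 * n"
proof -
  define v where "v = multiplicity p ((2 * n) choose n)"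
  have F: "fact n * fact n * ((2 * n) choose n) = (fact (2 * n) :: nat)"
    using binomial_fact_lemma[of n "2 * n"] by simp
  have "multiplicity p (fact (2 * n)) = 2 * multiplicity p (fact n :: nat) + v"
    unfolding F[symmetric] v_def using p
    by (subst prime_elem_multiplicity_mult_distrib; simp add: prime_elem_multiplicity_mult_distrib)+
  hence "(\<Sum>j=1..2*n. (2 * n) div p ^ j) = (\<Sum>j=1..2*n. 2 * (n div p ^ j)) + v"
    using multiplicity_fact[OF p, of "2*n" "2*n"] multiplicity_fact[OF p, of n "2*n"] by (simp add: sum_distrib_left)
  hence "(\<Sum>j=1..2*n. 2 * (n div p ^ j)) + v = (\<Sum>j=1..2*n. (2 * n) div p ^ j)" by (rule sym)
  also have "\<dots> \<le> (\<Sum>j=1..2*n. 2 * (n div p ^ j) + (if p ^ j \<le> 2 * n then 1 else 0))"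
  proof (intro sum_mono)
    fix j
    have "p ^ j > 0" using p by (simp add: prime_gt_0_nat)
    show "(2 * n) div p ^ j \<le> 2 * (n div p ^ j) + (if p ^ j \<le> 2 * n then 1 else 0)"
    proof (cases "p ^ j \<le> 2 * n")
      case True
      have "n < (n div p ^ j + 1) * p ^ j" using \<open>p ^ j > 0\<close> by (metis add.commute dividend_less_div_times mult.commute mult_Suc_right plus_1_eq_Suc)
      hence "2 * n < (2 * (n div p ^ j) + 2) * p ^ j" by (simp add: algebra_simps)
      hence "(2 * n) div p ^ j < 2 * (n div p ^ j) + 2" by (simp add: less_mult_imp_div_less)
      thus ?thesis using True by simp
    qed auto
  qed
  also have "\<dots> = (\<Sum>j=1..2*n. 2 * (n div p ^ j)) + card {j \<in> {1..2*n}. p ^ j \<le> 2 * n}"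
    by (simp add: sum.distrib sum.If_cases Int_def del: One_nat_def)
  finally have v: "v \<le> card {j \<in> {1..2*n}. p ^ j \<le> 2 * n}" by simp
  show ?thesis
  proof (rule ccontr)
    assume *: "\<not> ?thesis"
    \<comment> \<open>If \<open>p ^ v\<close> exceeded \<open>2 * n\<close>, only exponents strictly
      below \<open>v\<close> would count, at most \<open>v - 1\<close> of them.\<close>
    have "{j \<in> {1..2*n}. p ^ j \<le> 2 * n} \<subseteq> {1..<v}"
    proof safe
      fix j assume "j \<in> {1..2*n}" "p ^ j \<le> 2 * n"
      with * have "p ^ j < p ^ v" by (simp add: v_def)
      hence "j < v" using prime_gt_1_nat[OF p] by (simp add: power_strict_increasing_iff)
      thus "j \<in> {1..<v}" using \<open>j \<in> _\<close> by simp
    qed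
    from card_mono[OF _ this] v have "v = 0" by simp
    with * n show False by (simp add: v_def)
  qed
qed

text \<open>The central binomial coefficient is at least \<open>4 ^ n / (2 * n)\<close> and at most
  \<open>2 * n\<close> to the power of the number of primes up to \<open>2 * n\<close>, so these
  primes are many. At most \<open>sqrt (2 * n)\<close> of them are no larger than
  \<open>sqrt (2 * n)\<close>, and each of the others has a logarithm of at least
  \<open>ln (2 * n) / 2\<close>.\<close>

lemma theta_ge_aux:
  assumes n: "n > 0"
  shows "theta (2 * real n) \<ge> (n * ln 4 - ln (2 * n) - sqrt (2 * n) * ln (2 * n)) / 2"
proof -
  let ?P = "{p. prime p \<and> real p \<le> 2 * real n}"
  let ?C = "(2 * n) choose n"
  let ?S = "{p::nat. prime p \<and> real p \<le> sqrt (2 * n)}"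
  have C0: "?C > 0" by simp
  have "4 ^ n / (2 * real n) \<le> real ?C" by (rule central_binomial_lower_bound[OF n])
  also have "?C = (\<Prod>p\<in>prime_factors ?C. p ^ multiplicity p ?C)"
    using C0 by (intro prime_factorization_nat) auto
  also have "\<dots> \<le> (\<Prod>p\<in>prime_factors ?C. 2 * n)"
    by (intro prod_mono conjI prime_power_central_binomial_le n) auto
  also have "\<dots> = (2 * n) ^ card (prime_factors ?C)" by simp
  also have "\<dots> \<le> (2 * n) ^ card ?P"
  proof (intro power_increasing card_mono)
    show "prime_factors ?C \<subseteq> ?P"
    proof
      fix p assume p: "p \<in> prime_factors ?C"
      hence "p dvd fact n * fact n * ?C" "prime p" by auto
      hence "p dvd fact (2 * n)" using binomial_fact_lemma[of n "2 * n"] by simp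
      thus "p \<in> ?P" using \<open>prime p\<close> by (simp add: prime_dvd_fact_iff)
    qed
  qed (use n in auto)
  finally have "4 ^ n / (2 * real n) \<le> real ((2 * n) ^ card ?P)" by simp
  hence "ln (4 ^ n / (2 * real n)) \<le> ln (real ((2 * n) ^ card ?P))"
    using n by (subst ln_le_cancel_iff) auto
  also have "ln (real ((2 * n) ^ card ?P)) = card ?P * ln (2 * n)"
    using n ln_realpow[of "2 * real n" "card ?P"] by (simp del: power_mult_distrib)
  finally have 1: "n * ln 4 - ln (2 * n) \<le> card ?P * ln (2 * n)"
    using n by (simp add: ln_div ln_realpow del: power_mult_distrib)
  have fs: "finite ?S" "?S \<subseteq> ?P"
  proof -
    have "sqrt (2 * n) \<le> 2 * n"
      using n self_le_power[of "2 * real n" 2] by (intro real_le_lsqrt) auto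
    thus "?S \<subseteq> ?P" by auto
  qed auto
  have cardS: "real (card ?S) \<le> sqrt (2 * n)"
  proof -
    have "?S \<subseteq> {1..nat \<lfloor>sqrt (2 * n)\<rfloor>}" by (auto simp: le_nat_floor Suc_le_eq prime_gt_0_nat)
    from card_mono[OF _ this] have "card ?S \<le> nat \<lfloor>sqrt (2 * n)\<rfloor>" by simp
    hence "real (card ?S) \<le> real (nat \<lfloor>sqrt (2 * n)\<rfloor>)" by (simp only: of_nat_le_iff)
    also have "\<dots> \<le> sqrt (2 * n)" by (rule of_nat_floor) simp
    finally show ?thesis .
  qed
  have "(card ?P - sqrt (2 * n)) * (ln (2 * n) / 2) \<le> (card ?P - card ?S) * (ln (2 * n) / 2)"
    using n cardS by (intro mult_right_mono) auto
  also have "\<dots> = (\<Sum>p\<in>?P - ?S. ln (2 * n) / 2)"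
    using fs by (subst sum_constant, subst card_Diff_subset) (auto simp: of_nat_diff card_mono)
  also have "\<dots> \<le> (\<Sum>p\<in>?P - ?S. ln (real p))"
  proof (intro sum_mono)
    fix p assume "p \<in> ?P - ?S"
    hence p: "real p > sqrt (2 * n)" "prime p" by auto
    have "ln (2 * real n) / 2 = ln (sqrt (2 * n))" using n by (simp add: ln_sqrt)
    also have "\<dots> \<le> ln p" using p n by (subst ln_le_cancel_iff) (auto simp: prime_gt_0_nat)
    finally show "ln (2 * n) / 2 \<le> ln (real p)" by simp
  qed
  also have "\<dots> \<le> (\<Sum>p\<in>?P. ln (real p))"
    by (intro sum_mono2) (auto simp: prime_gt_0_nat Suc_leI)
  finally have "(card ?P - sqrt (2 * n)) * (ln (2 * n) / 2) \<le> theta (2 * real n)" by (simp add: theta_def)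
  with 1 show ?thesis by (simp add: field_simps)
qed

lemma theta_mono: "x \<le> y \<Longrightarrow> theta x \<le> theta y"
  unfolding theta_def by (intro sum_mono2) (auto simp: prime_gt_0_nat Suc_leI)

lemma theta_ge: "\<exists>c>0. \<forall>x\<ge>2. theta x \<ge> c * x"
proof -
  have "\<forall>\<^sub>F x in at_top. ((x/2 - 1) * 1 - ln x - sqrt x * ln x) / 2 \<ge> x / 8"
    by real_asymp
  then obtain X where X: "\<And>x. x \<ge> X \<Longrightarrow> ((x/2 - 1) * 1 - ln x - sqrt x * ln x) / 2 \<ge> (x::real) / 8"
    by (auto simp: eventually_at_top_linorder)
  define Y where "Y = max X 2"
  have big: "theta x \<ge> x / 8" if x: "x \<ge> Y" for x
  proof -
    have x0: "x \<ge> 2" using x by (simp add: Y_def)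
    define n where "n = nat \<lfloor>x / 2\<rfloor>"
    have n: "n > 0" "real n \<le> x / 2" "real n \<ge> x / 2 - 1" using x0 unfolding n_def by linarith+
    have "(1::real) \<le> ln 4" using exp_le by (subst ln_ge_iff) auto
    have "x / 8 \<le> ((x/2 - 1) * 1 - ln x - sqrt x * ln x) / 2" using X[of x] x by (simp add: Y_def)
    also have "\<dots> \<le> (n * ln 4 - ln (2 * n) - sqrt (2 * n) * ln (2 * n)) / 2"
    proof (intro divide_right_mono diff_mono)
      show "(x / 2 - 1) * 1 \<le> n * ln 4"
        using n x0 \<open>1 \<le> ln 4\<close> by (intro mult_mono) auto
      show "ln (2 * n) \<le> ln x" using n x0 by (subst ln_le_cancel_iff) auto
      thus "sqrt (2 * n) * ln (2 * n) \<le> sqrt x * ln x" using n x0 by (intro mult_mono) auto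
    qed auto
    also have "\<dots> \<le> theta (2 * real n)" using theta_ge_aux[OF n(1)] by simp
    also have "\<dots> \<le> theta x" using n by (intro theta_mono) auto
    finally show ?thesis .
  qed
  have small: "theta x \<ge> ln 2" if "x \<ge> 2" for x
  proof -
    have "(\<Sum>p\<in>{2::nat}. ln (real p)) \<le> theta x"
      unfolding theta_def using that by (intro sum_mono2) (auto simp: prime_gt_0_nat Suc_leI)
    thus ?thesis by simp
  qed
  \<comment> \<open>The constant \<open>1 / 8\<close> serves \<open>x \<ge> Y\<close>; for
    \<open>2 \<le> x \<le> Y\<close> the prime 2 alone contributes \<open>ln 2\<close>, which is at
    least \<open>(ln 2 / Y) * x\<close>.\<close>
  define c where "c = min (1/8) (ln 2 / Y)"
  have "Y \<ge> 2" by (simp add: Y_def)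
  have "theta x \<ge> c * x" if x: "x \<ge> 2" for x
  proof (cases "x \<ge> Y")
    case True
    have "c \<le> 1 / 8" unfolding c_def by (rule min.cobounded1)
    hence "c * x \<le> 1 / 8 * x" using x by (intro mult_right_mono) auto
    with big[OF True] show ?thesis by linarith
  next
    case False
    have "c * x \<le> ln 2 / Y * Y" using x False \<open>Y \<ge> 2\<close> by (intro mult_mono) (auto simp: c_def)
    with small[OF x] \<open>Y \<ge> 2\<close> show ?thesis by simp
  qed
  moreover have "c > 0" using \<open>Y \<ge> 2\<close> by (simp add: c_def)
  ultimately show ?thesis by blast
qed

section \<open>Polynomial recurrence on dense sets of integers\<close>

lemma nint_dist_le: "nint_dist x \<le> \<bar>x - of_int m\<bar>"
  unfolding nint_dist_def by (rule round_diff_minimal)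

lemma nint_dist_nonneg [simp]: "nint_dist x \<ge> 0"
  by (simp add: nint_dist_def)

lemma nint_dist_add_int [simp]: "nint_dist (x + of_int m) = nint_dist x"
proof -
  have *: "nint_dist (y + of_int k) \<le> nint_dist y" for y :: real and k
    using nint_dist_le[of "y + of_int k" "round y + k"] by (simp add: nint_dist_def)
  show ?thesis using *[of x m] *[of "x + of_int m" "-m"] by simp
qed

lemma nint_dist_diff_le: "nint_dist (x - y) \<le> nint_dist x + nint_dist y"
  using nint_dist_le[of "x - y" "round x - round y"] by (simp add: nint_dist_def)

lemma nint_dist_eq_abs:
  assumes "\<bar>x\<bar> < 1/2" shows "nint_dist x = \<bar>x\<bar>"
proof -
  have "round x = 0" using assms by (intro round_unique') auto
  thus ?thesis by (simp add: nint_dist_def)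
qed

text \<open>Polynomials of exact degree \<open>j\<close> with natural coefficients, where
  \<open>M\<close> bounds the coefficient sum, that is, the value at 1. Natural coefficients make
  \<open>f\<close> monotone and survive forward differencing, so that all differences of values stay
  in \<open>nat\<close>.\<close>

definition npoly :: "nat \<Rightarrow> real \<Rightarrow> (nat \<Rightarrow> nat) \<Rightarrow> bool" where
  "npoly j M f \<longleftrightarrow> (\<exists>c :: nat \<Rightarrow> nat. f = (\<lambda>p. \<Sum>i\<le>j. c i * p ^ i) \<and> c j \<ge> 1 \<and> real (\<Sum>i\<le>j. c i) \<le> M)"

lemma npoly_ge1: "npoly j M f \<Longrightarrow> M \<ge> 1"
proof -
  assume "npoly j M f"
  then obtain c :: "nat \<Rightarrow> nat" where c: "c j \<ge> 1" "real (\<Sum>i\<le>j. c i) \<le> M" by (auto simp: npoly_def)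
  have "1 \<le> c j" using c by simp
  also have "\<dots> \<le> (\<Sum>i\<le>j. c i)" by (rule member_le_sum) auto
  finally have "1 \<le> real (\<Sum>i\<le>j. c i)" by linarith
  with c show ?thesis by simp
qed

lemma npoly_power: "npoly k 1 (\<lambda>p. p ^ k)"
proof -
  define c :: "nat \<Rightarrow> nat" where "c = (\<lambda>i. if i = k then 1 else 0)"
  have "(\<Sum>i\<le>k. c i * p ^ i) = (\<Sum>i\<in>{k}. c i * p ^ i)" for p
    by (rule sum.mono_neutral_right) (auto simp: c_def)
  moreover have "(\<Sum>i\<le>k. c i) = (\<Sum>i\<in>{k}. c i)"
    by (rule sum.mono_neutral_right) (auto simp: c_def)
  ultimately show ?thesis unfolding npoly_def by (intro exI[of _ c]) (simp add: c_def)
qed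

text \<open>The new coefficient sum is the value of the difference at 1, hence at most
  \<open>f (1 + h)\<close>. The new leading coefficient is \<open>(j + 1) * h * c (Suc j)\<close>,
  which is where \<open>h \<ge> 1\<close> enters.\<close>

lemma npoly_diff:
  assumes "npoly (Suc j) M f" "h \<ge> 1"
  shows "npoly j (M * (1 + real h) ^ Suc j) (\<lambda>p. f (p + h) - f p)"
proof -
  obtain c :: "nat \<Rightarrow> nat" where c: "f = (\<lambda>p. \<Sum>i\<le>Suc j. c i * p ^ i)" "c (Suc j) \<ge> 1" "real (\<Sum>i\<le>Suc j. c i) \<le> M"
    using assms by (auto simp: npoly_def)
  define g where "g = (\<lambda>l. \<Sum>i=Suc l..Suc j. c i * ((i choose l) * h ^ (i - l)))"
  have f_eq: "f (p + h) = f p + (\<Sum>l\<le>j. g l * p ^ l)" for p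
  proof -
    have "f (p + h) = (\<Sum>i\<le>Suc j. c i * (\<Sum>l\<le>i. (i choose l) * p ^ l * h ^ (i - l)))"
      unfolding c(1) by (simp add: binomial)
    also have "\<dots> = (\<Sum>i\<le>Suc j. c i * p ^ i + (\<Sum>l<i. c i * ((i choose l) * h ^ (i - l)) * p ^ l))"
    proof (intro sum.cong refl)
      fix i
      have "(\<Sum>l\<le>i. (i choose l) * p ^ l * h ^ (i - l)) = p ^ i + (\<Sum>l<i. (i choose l) * p ^ l * h ^ (i - l))"
        by (simp add: lessThan_Suc_atMost[symmetric])
      thus "c i * (\<Sum>l\<le>i. (i choose l) * p ^ l * h ^ (i - l)) = c i * p ^ i + (\<Sum>l<i. c i * ((i choose l) * h ^ (i - l)) * p ^ l)"
        by (simp add: distrib_left sum_distrib_left mult_ac)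
    qed
    also have "\<dots> = f p + (\<Sum>i\<le>Suc j. \<Sum>l<i. c i * ((i choose l) * h ^ (i - l)) * p ^ l)"
      unfolding c(1) by (rule sum.distrib)
    also have "(\<Sum>i\<le>Suc j. \<Sum>l<i. c i * ((i choose l) * h ^ (i - l)) * p ^ l) = (\<Sum>l<Suc j. g l * p ^ l)"
      by (subst sum.nested_swap') (simp only: g_def sum_distrib_right)
    finally show ?thesis by (simp only: lessThan_Suc_atMost)
  qed
  have "real (\<Sum>l\<le>j. g l) \<le> real (f (1 + h))" using f_eq[of 1] by (simp del: of_nat_sum)
  also have "f (1 + h) \<le> (\<Sum>i\<le>Suc j. c i * (1 + h) ^ Suc j)"
    unfolding c(1) by (intro sum_mono mult_left_mono power_increasing) auto
  also have "real (\<Sum>i\<le>Suc j. c i * (1 + h) ^ Suc j) = real (\<Sum>i\<le>Suc j. c i) * (1 + real h) ^ Suc j"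
    by (simp only: sum_distrib_right[symmetric] of_nat_mult of_nat_power of_nat_add of_nat_1)
  also have "\<dots> \<le> M * (1 + real h) ^ Suc j" using c(3) by (intro mult_right_mono) auto
  finally have "real (\<Sum>l\<le>j. g l) \<le> M * (1 + real h) ^ Suc j" by (simp del: of_nat_sum power_Suc)
  moreover have "g j \<ge> 1" using c(2) assms(2) by (simp add: g_def)
  moreover have "(\<lambda>p. f (p + h) - f p) = (\<lambda>p. \<Sum>l\<le>j. g l * p ^ l)" by (simp add: f_eq)
  ultimately show ?thesis unfolding npoly_def by blast
qed

lemma npoly_mono: "npoly j M f \<Longrightarrow> p \<le> p' \<Longrightarrow> f p \<le> f p'"
  by (auto simp: npoly_def intro!: sum_mono mult_left_mono power_mono)

lemma npoly_cong: "npoly j M f \<Longrightarrow> [p = p'] (mod q) \<Longrightarrow> [f p = f p'] (mod q)"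
  by (auto simp: npoly_def intro!: cong_sum cong_mult cong_pow)

text \<open>No coefficient is negative, so the leading term alone gives a lower bound, independent
  of the height \<open>M\<close>.\<close>

lemma npoly_increment_ge:
  assumes "npoly (Suc j) M f" "p \<le> p'"
  shows "real (f p') - real (f p) \<ge> (real p' - real p) * real p ^ j"
proof -
  obtain c :: "nat \<Rightarrow> nat" where c: "f = (\<lambda>p. \<Sum>i\<le>Suc j. c i * p ^ i)" "c (Suc j) \<ge> 1"
    using assms by (auto simp: npoly_def)
  have "p' * p ^ j \<le> p' ^ Suc j" using assms by (auto intro!: mult_left_mono power_mono)
  hence "(real p' - real p) * real p ^ j \<le> real p' ^ Suc j - real p ^ Suc j"
    by (simp add: left_diff_distrib flip: of_nat_power of_nat_mult)
  also have "\<dots> \<le> real (c (Suc j)) * (real p' ^ Suc j - real p ^ Suc j)"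
    using c assms mult_right_mono[of 1 "real (c (Suc j))" "real p' ^ Suc j - real p ^ Suc j"] by (auto simp del: power_Suc intro!: power_mono)
  also have "\<dots> \<le> (\<Sum>i\<le>Suc j. real (c i) * (real p' ^ i - real p ^ i))"
    by (rule member_le_sum) (use assms in \<open>auto intro!: mult_nonneg_nonneg power_mono\<close>)
  also have "\<dots> = real (f p') - real (f p)" unfolding c(1) by (simp add: right_diff_distrib sum_subtractf del: sum.atMost_Suc)
  finally show ?thesis .
qed

lemma power_diff_le:
  assumes "0 \<le> p" "p \<le> p'" "p' \<le> (P::real)"
  shows "p' ^ Suc i - p ^ Suc i \<le> (real i + 1) * P ^ i * (p' - p)"
proof (induction i)
  case (Suc i)
  have "p' ^ Suc (Suc i) - p ^ Suc (Suc i) = p' * (p' ^ Suc i - p ^ Suc i) + (p' - p) * p ^ Suc i"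
    by (simp add: algebra_simps)
  also have "\<dots> \<le> P * ((real i + 1) * P ^ i * (p' - p)) + (p' - p) * P ^ Suc i"
    using assms Suc by (intro add_mono mult_mono power_mono) (auto simp del: power_Suc intro!: power_mono)
  also have "\<dots> = (real (Suc i) + 1) * P ^ Suc i * (p' - p)" by (simp add: algebra_simps)
  finally show ?case .
qed simp

lemma npoly_increment_le:
  assumes "npoly (Suc j) M f" "p \<le> p'" "p' \<le> P" "P \<ge> 1"
  shows "real (f p') - real (f p) \<le> M * (real j + 1) * real P ^ j * (real p' - real p)"
proof -
  obtain c :: "nat \<Rightarrow> nat" where c: "f = (\<lambda>p. \<Sum>i\<le>Suc j. c i * p ^ i)" "real (\<Sum>i\<le>Suc j. c i) \<le> M"
    using assms by (auto simp: npoly_def)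
  have "real (f p') - real (f p) = (\<Sum>i\<le>Suc j. real (c i) * (real p' ^ i - real p ^ i))"
    unfolding c(1) by (simp add: right_diff_distrib sum_subtractf del: sum.atMost_Suc)
  also have "\<dots> \<le> (\<Sum>i\<le>Suc j. real (c i) * ((real j + 1) * real P ^ j * (real p' - real p)))"
  proof (intro sum_mono mult_left_mono)
    fix i assume i: "i \<in> {..Suc j}"
    show "real p' ^ i - real p ^ i \<le> (real j + 1) * real P ^ j * (real p' - real p)"
    proof (cases i)
      case 0
      thus ?thesis using assms by simp
    next
      case (Suc l)
      have "real p' ^ i - real p ^ i \<le> (real l + 1) * real P ^ l * (real p' - real p)"
        unfolding Suc using assms by (intro power_diff_le) auto
      also have "\<dots> \<le> (real j + 1) * real P ^ j * (real p' - real p)"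
        using assms i Suc by (intro mult_mono power_increasing) auto
      finally show ?thesis .
    qed
  qed auto
  also have "\<dots> = real (\<Sum>i\<le>Suc j. c i) * ((real j + 1) * real P ^ j * (real p' - real p))"
    by (simp only: sum_distrib_right of_nat_sum)
  also have "\<dots> \<le> M * ((real j + 1) * real P ^ j * (real p' - real p))"
    using c assms by (intro mult_right_mono) auto
  finally show ?thesis by (simp add: mult_ac)
qed

text \<open>Two elements of \<open>A\<close> in one block of length \<open>H\<close> differ by less
  than \<open>H\<close>, so a block has at most one element that is not followed by another within
  distance \<open>H\<close>. There are at most \<open>P / H + 1 \<le> d * P / 2\<close> such
  elements. The others have a companion at some distance \<open>h \<le> H\<close>, and as
  \<open>H \<le> 5 / d\<close>, one distance serves at least \<open>d\<^sup>2 / 10 * P\<close> of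
  them.\<close>

lemma popular_difference:
  fixes A :: "nat set" and d :: real
  assumes A: "A \<subseteq> {1..P}" "real (card A) \<ge> d * P" and d: "0 < d" "d \<le> 1" and P: "real P \<ge> 4 / d"
  shows "\<exists>h\<ge>1. real h \<le> 5 / d \<and> real (card {p\<in>A. p + h \<in> A}) \<ge> d\<^sup>2 / 10 * P"
proof -
  define H where "H = nat \<lceil>4 / d\<rceil>"
  have "4 / d > 0" using d by simp
  hence H: "real H \<ge> 4 / d" "real H \<le> 4 / d + 1" "H \<ge> 1" unfolding H_def by linarith+
  have H5: "real H \<le> 5 / d" using H(2) d by (simp add: field_simps)
  have finA: "finite A" using A(1) finite_subset by blast
  define B where "B = (\<lambda>h. {p\<in>A. p + h \<in> A})"
  define D where "D = A - (\<Union>h\<in>{1..H}. B h)"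
  have "inj_on (\<lambda>p. p div H) D"
  proof (rule linorder_inj_onI)
    fix p p' assume pp: "p < p'" "p \<in> D" "p' \<in> D"
    show "p div H \<noteq> p' div H"
    proof
      assume eq: "p div H = p' div H"
      have "p = p div H * H + p mod H" "p' = p' div H * H + p' mod H" by (simp_all only: div_mult_mod_eq)
      hence "p' - p = p' mod H - p mod H" unfolding eq by linarith
      also have "\<dots> < H" using H by (meson diff_le_self le_less_trans mod_less_divisor less_le_trans zero_less_one)
      finally have "p' - p \<in> {1..H}" "p + (p' - p) \<in> A" using pp by (auto simp: D_def)
      moreover have "p \<in> A" using pp by (simp add: D_def)
      ultimately have "p \<in> (\<Union>h\<in>{1..H}. B h)" unfolding B_def by blast
      thus False using pp by (simp add: D_def)
    qed
  qed (simp add: linorder_linear)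
  moreover have "(\<lambda>p. p div H) ` D \<subseteq> {..P div H}" using A(1) by (auto simp: D_def intro!: div_le_mono)
  ultimately have "card D \<le> card {..P div H}" by (intro card_inj_on_le) auto
  hence "real (card D) \<le> real (P div H) + 1" by simp
  also have "real (P div H) \<le> P / H" by (rule of_nat_div_le_of_nat) 
  also have "real P / real H \<le> P / (4 / d)" using H d by (intro divide_left_mono) auto
  finally have cD: "real (card D) \<le> d * P / 4 + 1" by (simp add: mult.commute)
  have "A = D \<union> (\<Union>h\<in>{1..H}. B h)" by (auto simp: D_def B_def)
  hence "card A \<le> card D + card (\<Union>h\<in>{1..H}. B h)" using card_Un_le[of D "\<Union>h\<in>{1..H}. B h"] by simp
  also have "card (\<Union>h\<in>{1..H}. B h) \<le> (\<Sum>h\<in>{1..H}. card (B h))" by (rule card_UN_le) simp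
  finally have "card A \<le> card D + (\<Sum>h\<in>{1..H}. card (B h))" by simp
  hence "real (card A) \<le> real (card D + (\<Sum>h\<in>{1..H}. card (B h)))" by (simp only: of_nat_le_iff)
  hence "real (card A) \<le> real (card D) + (\<Sum>h\<in>{1..H}. real (card (B h)))" by simp
  hence sum: "d * P / 2 \<le> (\<Sum>h\<in>{1..H}. real (card (B h)))"
    using cD A(2) P d by (simp add: field_simps)
  have "\<exists>h\<in>{1..H}. real (card (B h)) \<ge> d\<^sup>2 / 10 * P"
  proof (rule ccontr)
    assume *: "\<not> ?thesis"
    have "(\<Sum>h\<in>{1..H}. real (card (B h))) < (\<Sum>h\<in>{1..H}. d\<^sup>2 / 10 * P)"
    proof (rule sum_strict_mono)
      show "real (card (B h)) < d\<^sup>2 / 10 * P" if "h \<in> {1..H}" for h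
        using * that by (meson not_le)
    qed (use H in auto)
    also have "\<dots> = H * (d\<^sup>2 / 10 * P)" by simp
    also have "\<dots> \<le> 5 / d * (d\<^sup>2 / 10 * P)" using H5 by (intro mult_right_mono) auto
    also have "\<dots> = d * P / 2" using d by (simp add: power2_eq_square)
    finally show False using sum by simp
  qed
  then obtain h where "h \<in> {1..H}" "real (card (B h)) \<ge> d\<^sup>2 / 10 * P" by blast
  moreover from this H5 have "real h \<le> 5 / d" by (auto intro: order_trans[rotated])
  ultimately show ?thesis by (auto simp: B_def)
qed

text \<open>Two members of one cell (short interval and residue class modulo \<open>q\<close>) that are far apart:
  there the increment of \<open>f p * x\<close> modulo one is a small multiple of \<open>t\<close> and cannot wrap around.\<close>

lemma slow_variation:
  fixes A :: "nat set" and P R q :: nat and d t x e :: real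
  assumes A: "A \<subseteq> {1..P}" "real (card A) \<ge> d * P" and d: "0 < d" "d \<le> 1"
    and f: "npoly (Suc j) M f" and q: "q \<ge> 1" and R: "R \<ge> 1" "R \<le> P" "16 * q / d \<le> R"
    and x: "x = of_int b / real q + t"
    and small: "M * (real j + 1) * real P ^ j * R * \<bar>t\<bar> < 1 / 2"
    and near: "\<And>p. p \<in> A \<Longrightarrow> nint_dist (real (f p) * x) \<le> e"
  shows "\<bar>t\<bar> * (d * R / 8) * (d * P / 4) ^ j \<le> 2 * e"
proof -
  \<comment> \<open>Discarding the small \<open>p\<close> costs at most \<open>d * P / 4\<close>
    elements and provides the lower bound \<open>(d * P / 4) ^ j\<close> for \<open>p1 ^ j\<close>
    in the growth of \<open>f\<close>.\<close>
  define A' where "A' = {p\<in>A. real p \<ge> d * P / 4}"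
  have finA: "finite A" using A(1) finite_subset by blast
  have P1: "P \<ge> 1" using R by simp
  have "card {p\<in>A. real p < d * P / 4} \<le> card {1..nat \<lfloor>d * P / 4\<rfloor>}"
    using A(1) by (intro card_mono) (auto simp: le_nat_floor)
  also have "\<dots> = nat \<lfloor>d * P / 4\<rfloor>" by simp
  also have "real \<dots> \<le> d * P / 4" using d by (intro of_nat_floor) simp
  finally have c1: "real (card {p\<in>A. real p < d * P / 4}) \<le> d * P / 4" by simp
  have "A = A' \<union> {p\<in>A. real p < d * P / 4}" by (auto simp: A'_def)
  hence "card A \<le> card A' + card {p\<in>A. real p < d * P / 4}"
    using card_Un_le[of A' "{p\<in>A. real p < d * P / 4}"] by simp
  with c1 A(2) have cA': "real (card A') \<ge> 3 * d * P / 4" by linarith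
  define cell where "cell = (\<lambda>p. (p div R, p mod q))"
  let ?cells = "{..P div R} \<times> {..<q}"
  have finA': "finite A'" using finA by (simp add: A'_def)
  have sub: "cell ` A' \<subseteq> ?cells" using A(1) q by (auto simp: cell_def A'_def intro!: div_le_mono)
  \<comment> \<open>There are at most \<open>2 * (P / R) * q\<close> cells, and some cell holds at
    least the average share of \<open>3 * d * P / 4\<close>.\<close>
  have "\<exists>z\<in>?cells. real (card {p\<in>A'. cell p = z}) \<ge> 3 * d * R / (8 * q)"
  proof (rule ccontr)
    assume *: "\<not> ?thesis"
    have "card A' = (\<Sum>z\<in>?cells. card {p\<in>A'. cell p = z})"
      using sum.group[OF finA' _ sub, of "\<lambda>_. 1::nat"] by simp
    hence "real (card A') = (\<Sum>z\<in>?cells. real (card {p\<in>A'. cell p = z}))" by (simp only: of_nat_sum)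
    also have "\<dots> < (\<Sum>z\<in>?cells. 3 * d * R / (8 * q))"
    proof (rule sum_strict_mono)
      show "real (card {p\<in>A'. cell p = z}) < 3 * d * R / (8 * q)" if "z \<in> ?cells" for z
        using * that by (meson not_le)
    qed (use q in \<open>auto simp: lessThan_empty_iff\<close>)
    also have "\<dots> = real (card ?cells) * (3 * d * R / (8 * q))" by simp
    also have "real (card ?cells) = (real (P div R) + 1) * q" by (simp add: card_cartesian_product algebra_simps)
    also have "real (P div R) + 1 \<le> 2 * (P / R)"
      using of_nat_div_le_of_nat[of P R, where ?'a = real] R by (simp add: field_simps)
    hence "(real (P div R) + 1) * q * (3 * d * R / (8 * q)) \<le> 2 * (P / R) * q * (3 * d * R / (8 * q))"
      using d by (intro mult_right_mono) auto
    also have "\<dots> = 3 * d * P / 4" using R q by simp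
    finally show False using cA' by simp
  qed
  then obtain z where z: "real (card {p\<in>A'. cell p = z}) \<ge> 3 * d * R / (8 * q)" by blast
  define Z where "Z = {p\<in>A'. cell p = z}"
  have finZ: "finite Z" using finA' by (simp add: Z_def)
  have "real (card Z) > 0" using z d R q by (intro less_le_trans[OF _ z[folded Z_def]]) auto
  hence "Z \<noteq> {}" by auto
  define p1 p2 where "p1 = Min Z" and "p2 = Max Z"
  have p12: "p1 \<in> Z" "p2 \<in> Z" "\<And>p. p \<in> Z \<Longrightarrow> p1 \<le> p \<and> p \<le> p2"
    using finZ \<open>Z \<noteq> {}\<close> by (auto simp: p1_def p2_def)
  have le: "p1 \<le> p2" using p12 by auto
  have modeq: "p mod q = p1 mod q" "p div R = p1 div R" if "p \<in> Z" for p
    using that p12(1) by (auto simp: Z_def cell_def)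
  have "inj_on (\<lambda>p. (p - p1) div q) Z"
  proof (rule inj_onI)
    fix p p' assume pp: "p \<in> Z" "p' \<in> Z" "(p - p1) div q = (p' - p1) div q"
    have "q dvd p - p1" "q dvd p' - p1" using modeq[OF pp(1)] modeq[OF pp(2)] p12(3)[OF pp(1)] p12(3)[OF pp(2)] by (auto simp: mod_eq_dvd_iff_nat)
    hence "p - p1 = p' - p1" using pp(3) by (metis dvd_div_mult_self)
    thus "p = p'" using p12(3)[OF pp(1)] p12(3)[OF pp(2)] by linarith
  qed
  moreover have "(\<lambda>p. (p - p1) div q) ` Z \<subseteq> {..(p2 - p1) div q}" using p12(3) by (auto intro!: div_le_mono diff_le_mono)
  ultimately have "card Z \<le> card {..(p2 - p1) div q}" by (intro card_inj_on_le) auto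
  hence "real (card Z) \<le> real ((p2 - p1) div q) + 1" by simp
  also have "real ((p2 - p1) div q) \<le> real (p2 - p1) / q" by (rule of_nat_div_le_of_nat)
  finally have "3 * d * R / (8 * q) \<le> (real p2 - real p1) / q + 1" using z le by (simp add: Z_def of_nat_diff)
  \<comment> \<open>Members of a cell differ by multiples of \<open>q\<close>, so a full cell is
    long. The assumption \<open>16 * q / d \<le> R\<close> makes the loss of \<open>q\<close>
    harmless.\<close>
  hence "3 * d * R / 8 \<le> real p2 - real p1 + q" using q by (simp add: field_simps)
  moreover have "real q \<le> d * R / 16" using R(3) d by (simp add: field_simps)
  moreover have "d * R \<ge> 0" using d by simp
  ultimately have gap: "real p2 - real p1 \<ge> d * R / 8" by linarith
  have pA: "p1 \<in> A" "p2 \<in> A" "real p1 \<ge> d * P / 4" "p2 \<le> P" using p12 A(1) by (auto simp: Z_def A'_def)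
  have len: "real p2 - real p1 \<le> R"
  proof -
    have "p2 = p2 div R * R + p2 mod R" "p1 = p1 div R * R + p1 mod R" by (simp_all only: div_mult_mod_eq)
    hence "p2 - p1 = p2 mod R - p1 mod R" unfolding modeq(2)[OF p12(2)] by linarith
    also have "\<dots> \<le> R" using R by (meson diff_le_self le_trans less_imp_le mod_less_divisor less_le_trans zero_less_one)
    finally show ?thesis using le by linarith
  qed
  define D where "D = real (f p2) - real (f p1)"
  have D_ge: "D \<ge> (d * R / 8) * (d * P / 4) ^ j"
  proof -
    have "(d * R / 8) * (d * P / 4) ^ j \<le> (real p2 - real p1) * real p1 ^ j"
      using gap pA d le by (intro mult_mono power_mono) auto
    also have "\<dots> \<le> D" unfolding D_def by (rule npoly_increment_ge[OF f le])
    finally show ?thesis .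
  qed
  have "D \<ge> 0" using npoly_mono[OF f le] by (simp add: D_def)
  have "D \<le> M * (real j + 1) * real P ^ j * (real p2 - real p1)"
    unfolding D_def by (rule npoly_increment_le[OF f le pA(4) P1])
  also have "\<dots> \<le> M * (real j + 1) * real P ^ j * R"
    using len npoly_ge1[OF f] by (intro mult_left_mono) auto
  finally have "D * \<bar>t\<bar> \<le> M * (real j + 1) * real P ^ j * R * \<bar>t\<bar>" by (intro mult_right_mono) auto
  with small \<open>D \<ge> 0\<close> have Dt: "\<bar>D * t\<bar> < 1 / 2" by (simp add: abs_mult)
  have "q dvd f p2 - f p1"
  proof -
    have "[f p2 = f p1] (mod q)" using modeq(1)[OF p12(2)] by (intro npoly_cong[OF f]) (simp add: unique_euclidean_semiring_class.cong_def)
    thus ?thesis using npoly_mono[OF f le] by (simp add: unique_euclidean_semiring_class.cong_def mod_eq_dvd_iff_nat)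
  qed
  then obtain m where m: "f p2 - f p1 = q * m" by (auto elim: dvdE)
  have D_m: "D = real q * real m" using m npoly_mono[OF f le] unfolding D_def by (metis of_nat_diff of_nat_mult)
  \<comment> \<open>As \<open>q\<close> divides \<open>f p2 - f p1\<close>, the rational part of
    \<open>x\<close> contributes an integer and only \<open>D * t\<close> is left modulo one. By
    \<open>Dt\<close> it is shorter than one half, so its distance to the nearest integer is
    \<open>\<bar>D * t\<bar>\<close> itself.\<close>
  have "D * x = D * t + of_int (int m * b)" unfolding x using D_m q by (simp add: field_simps)
  hence "nint_dist (D * t) = nint_dist (D * x)" by (simp only: nint_dist_add_int)
  also have "D * x = real (f p2) * x - real (f p1) * x" by (simp add: D_def left_diff_distrib)
  also have "nint_dist \<dots> \<le> nint_dist (real (f p2) * x) + nint_dist (real (f p1) * x)" by (rule nint_dist_diff_le)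
  also have "\<dots> \<le> 2 * e" using near[OF pA(1)] near[OF pA(2)] by simp
  finally have "D * \<bar>t\<bar> \<le> 2 * e" using nint_dist_eq_abs[OF Dt] \<open>D \<ge> 0\<close> by (simp add: abs_mult)
  moreover have "(d * R / 8) * (d * P / 4) ^ j * \<bar>t\<bar> \<le> D * \<bar>t\<bar>" using D_ge by (intro mult_right_mono) auto
  ultimately show ?thesis by (simp add: mult_ac)
qed


text \<open>Induction on the degree: differencing passes to degree \<open>j\<close> and gives \<open>q\<close> with
  \<open>q * x\<close> so close to an integer that \<open>f p * x\<close> varies slowly on residue classes modulo \<open>q\<close>.\<close>

lemma polynomial_recurrence:
  "\<exists>C\<ge>1. \<forall>M d P e x f. npoly j M f \<longrightarrow> 0 < d \<longrightarrow> d \<le> 1 \<longrightarrow>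
     real C * (M / d) ^ C \<le> real P \<longrightarrow> 0 \<le> e \<longrightarrow> e * (real C * (M / d) ^ C) \<le> 1 \<longrightarrow>
     real (card {p\<in>{1..P}. nint_dist (real (f p) * x) \<le> e}) \<ge> d * real P \<longrightarrow>
     (\<exists>q\<ge>1. real q \<le> real C * (M / d) ^ C \<and> nint_dist (real q * x) \<le> real C * (M / d) ^ C * e / real P ^ j)"
  (is "\<exists>C\<ge>1. ?P j C")
proof (induction j)
  case 0
  show ?case
  proof (rule exI[of _ "1::nat"], intro conjI allI impI)
    fix M d e x :: real and P :: nat and f
    assume f: "npoly 0 M f" and d: "0 < d" "d \<le> 1" and P: "real 1 * (M / d) ^ 1 \<le> real P" and e: "0 \<le> e"
      and c: "real (card {p\<in>{1..P}. nint_dist (real (f p) * x) \<le> e}) \<ge> d * real P"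
    have M: "M \<ge> 1" by (rule npoly_ge1[OF f])
    hence Md: "M \<le> M / d" "1 \<le> M / d" using d by (auto simp: field_simps intro: order_trans)
    \<comment> \<open>For a constant polynomial one element of the set suffices, and
      \<open>q\<close> is the constant itself.\<close>
    obtain c0 where c0: "f = (\<lambda>_. c0)" "c0 \<ge> 1" "real c0 \<le> M" using f by (auto simp: npoly_def)
    have "P > 0" using P Md by (cases P) auto
    hence "real (card {p\<in>{1..P}. nint_dist (real (f p) * x) \<le> e}) > 0" using c d by (intro less_le_trans[OF _ c]) auto
    hence "nint_dist (real c0 * x) \<le> e" unfolding c0(1) by (auto simp: card_gt_0_iff)
    moreover have "e \<le> (M / d) * e" using mult_right_mono[OF Md(2) e] by simp
    ultimately have "nint_dist (real c0 * x) \<le> real 1 * (M / d) ^ 1 * e / real P ^ 0" by simp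
    moreover have "real c0 \<le> real 1 * (M / d) ^ 1" using c0 Md by simp
    ultimately show "\<exists>q\<ge>1. real q \<le> real 1 * (M / d) ^ 1 \<and> nint_dist (real q * x) \<le> real 1 * (M / d) ^ 1 * e / real P ^ 0"
      using c0 by blast
  qed simp
next
  case (Suc j)
  then obtain C where C: "C \<ge> 1" "?P j C" by blast
  \<comment> \<open>With \<open>X = M / d\<close>, the bound \<open>a * X ^ E\<close> is what degree
    \<open>j\<close> yields for the differenced polynomial: the quotient of its height and its
    density is at most \<open>10 * 6 ^ Suc j * X ^ (j + 3)\<close>.\<close>
  define a E where "a = C * (10 * 6 ^ Suc j) ^ C" and "E = (j + 3) * C"
  \<comment> \<open>Large enough to dominate the coefficients and exponents of the finitely many
    monomials in \<open>X\<close> met below; \<open>C'_ge\<close> and \<open>E_le\<close> list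
    them.\<close>
  define C' where "C' = 256 * (j + 1) * 8 ^ Suc j * a\<^sup>2 + 2 * E + j + 3"
  have a1: "a \<ge> 1" using C(1) by (simp add: a_def)
  have aa: "a \<le> a\<^sup>2" using a1 by (simp add: power2_eq_square)
  have "C' \<ge> 1" by (simp add: C'_def)
  moreover have "?P (Suc j) C'"
  proof (intro allI impI)
    fix M d e x :: real and P :: nat and f
    assume f: "npoly (Suc j) M f" and d: "0 < d" "d \<le> 1" and P: "real C' * (M / d) ^ C' \<le> real P" 
      and e: "0 \<le> e" "e * (real C' * (M / d) ^ C') \<le> 1"
      and c: "real (card {p\<in>{1..P}. nint_dist (real (f p) * x) \<le> e}) \<ge> d * real P"
    define X where "X = M / d"
    define Y where "Y = real a * X ^ E"
    have M: "M \<ge> 1" by (rule npoly_ge1[OF f])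
    have X: "M \<le> X" "1 \<le> X" "1 / d \<le> X" using d M by (auto simp: X_def field_simps intro: order_trans)
    have Y1: "Y \<ge> 1" unfolding Y_def using a1 X mult_mono[of 1 "real a" 1 "X ^ E"] by simp
    have bound: "real k * X ^ l \<le> real C' * X ^ C'" if "k \<le> C'" "l \<le> C'" for k l
      using that X by (intro mult_mono power_increasing) auto
    have C'_ge: "16 * a \<le> C'" "2 * a \<le> C'" "136 * (j + 1) * a\<^sup>2 * 2 \<le> C'" "2 * 8 ^ Suc j * a \<le> C'" "256 * (j + 1) * 4 ^ j \<le> C'"
    proof -
      have 8: "(1::nat) \<le> 8 ^ Suc j" by simp
      have m: "k * a\<^sup>2 \<le> C'" if "k \<le> 256 * (j + 1) * 8 ^ Suc j" for k :: nat
        using mult_right_mono[OF that, of "a\<^sup>2"] unfolding C'_def by linarith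
      have k1: "256 \<le> 256 * (j + 1) * (8::nat) ^ Suc j"
      proof -
        have "0 < (j + 1) * (8::nat) ^ Suc j" by simp
        hence "1 \<le> (j + 1) * (8::nat) ^ Suc j" by linarith
        from mult_le_mono2[OF this, of 256] show ?thesis by (simp only: mult.assoc mult_1_right)
      qed
      show "16 * a \<le> C'" using m[of 16] k1 aa by linarith
      show "2 * a \<le> C'" using m[of 2] k1 aa by linarith
      have "272 * (j + 1) \<le> 256 * (j + 1) * (8::nat) ^ Suc j"
        using mult_left_mono[of 2 "(8::nat) ^ Suc j" "256 * (j + 1)"] by simp
      from m[OF this] show "136 * (j + 1) * a\<^sup>2 * 2 \<le> C'" by (simp add: algebra_simps)
      have "2 * 8 ^ Suc j \<le> 256 * (j + 1) * (8::nat) ^ Suc j" by simp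
      from m[OF this] show "2 * 8 ^ Suc j * a \<le> C'" using aa mult_left_mono[OF aa, of "2 * 8 ^ Suc j"] by linarith
      have "(4::nat) ^ j \<le> 8 ^ Suc j" by (rule order_trans[OF power_mono[of 4 8 j]]) auto
      hence "256 * (j + 1) * 4 ^ j \<le> 256 * (j + 1) * (8::nat) ^ Suc j" by simp
      note m[OF this]
      moreover have "256 * (j + 1) * 4 ^ j * 1 \<le> 256 * (j + 1) * 4 ^ j * a\<^sup>2"
        by (intro mult_le_mono2 order_trans[OF a1 aa])
      ultimately show "256 * (j + 1) * 4 ^ j \<le> C'" unfolding mult_1_right by (rule order_trans[rotated])
    qed
    have E_le: "E \<le> C'" "E + 1 \<le> C'" "2 * E + 2 \<le> C'" "E + j + 1 \<le> C'" "j + 1 \<le> C'"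
      by (auto simp: C'_def)
    have le: "real C' * X ^ C' \<le> P" "e * (real C' * X ^ C') \<le> 1" using P e by (auto simp: X_def)
    have Pbig: "real k * X ^ l \<le> P" if "k \<le> C'" "l \<le> C'" for k l using bound[OF that] le by linarith
    have esmall: "e * (real k * X ^ l) \<le> 1" if "k \<le> C'" "l \<le> C'" for k l 
      using mult_left_mono[OF bound[OF that] e(1)] le by linarith
    define A where "A = {p\<in>{1..P}. nint_dist (real (f p) * x) \<le> e}"
    have A: "A \<subseteq> {1..P}" "real (card A) \<ge> d * P" using c by (auto simp: A_def)
    have "4 / d \<le> real 16 * X ^ 1" using X(3) X(2) by (simp add: field_simps)
    also have "\<dots> \<le> P" using C'_ge(1) a1 by (intro Pbig) (auto simp: C'_def)
    finally obtain h where h: "h \<ge> 1" "real h \<le> 5 / d" "real (card {p\<in>A. p + h \<in> A}) \<ge> d\<^sup>2 / 10 * P"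
      using popular_difference[OF A d] by blast
    define M1 d1 where "M1 = M * (1 + real h) ^ Suc j" and "d1 = d\<^sup>2 / 10"
    define f1 where "f1 = (\<lambda>p. f (p + h) - f p)"
    have f1: "npoly j M1 f1" unfolding f1_def M1_def by (rule npoly_diff[OF f h(1)])
    have d1: "0 < d1" "d1 \<le> 1" using d power_le_one[of d 2] by (auto simp: d1_def)
    have "1 \<le> 1 / d" using d by simp
    hence "1 + real h \<le> 6 / d" using h(2) by (simp add: field_simps)
    also have "\<dots> \<le> 6 * X" using X(3) by simp
    finally have "M1 \<le> M * (6 * X) ^ Suc j" unfolding M1_def using M by (intro mult_left_mono power_mono) auto
    hence "M1 / d1 \<le> M * (6 * X) ^ Suc j / d1" using d1 by (intro divide_right_mono) auto
    also have "\<dots> = 10 * (6 * X) ^ Suc j * X * (1 / d)" using d by (simp add: d1_def X_def power2_eq_square field_simps del: power_Suc)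
    also have "\<dots> \<le> 10 * (6 * X) ^ Suc j * X * X" using X by (intro mult_left_mono) auto
    also have "\<dots> = 10 * 6 ^ Suc j * X ^ (j + 3)" by (simp add: power_mult_distrib power_add eval_nat_numeral)
    finally have Md1: "M1 / d1 \<le> 10 * 6 ^ Suc j * X ^ (j + 3)" .
    have "M1 / d1 \<ge> 0" using npoly_ge1[OF f1] d1 by simp
    hence "real C * (M1 / d1) ^ C \<le> real C * (10 * 6 ^ Suc j * X ^ (j + 3)) ^ C"
      using Md1 by (intro mult_left_mono power_mono) auto
    also have "\<dots> = Y" by (simp add: Y_def a_def E_def power_mult_distrib power_mult)
    finally have CY: "real C * (M1 / d1) ^ C \<le> Y" .
    have "Y \<le> P" unfolding Y_def using C'_ge(2) E_le by (intro Pbig) auto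
    have eY: "2 * e * Y \<le> 1" using esmall[OF C'_ge(2) E_le(1)] by (simp add: Y_def mult_ac)
    have sub: "{p\<in>A. p + h \<in> A} \<subseteq> {p\<in>{1..P}. nint_dist (real (f1 p) * x) \<le> 2 * e}"
    proof safe
      fix p assume p: "p \<in> A" "p + h \<in> A"
      have "real (f1 p) * x = real (f (p + h)) * x - real (f p) * x"
        using npoly_mono[OF f, of p "p + h"] by (simp add: f1_def of_nat_diff left_diff_distrib)
      also have "nint_dist \<dots> \<le> nint_dist (real (f (p + h)) * x) + nint_dist (real (f p) * x)" by (rule nint_dist_diff_le)
      also have "\<dots> \<le> 2 * e" using p by (simp add: A_def)
      finally show "nint_dist (real (f1 p) * x) \<le> 2 * e" .
    qed (use A in auto)
    have c1: "d1 * P \<le> real (card {p\<in>{1..P}. nint_dist (real (f1 p) * x) \<le> 2 * e})"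
      using h(3) card_mono[OF _ sub] by (simp add: d1_def)
    have e1: "2 * e * (real C * (M1 / d1) ^ C) \<le> 1"
      using mult_left_mono[OF CY, of "2 * e"] e eY by simp
    have PC: "real C * (M1 / d1) ^ C \<le> P" using CY \<open>Y \<le> P\<close> by simp
    have "0 \<le> 2 * e" using e by simp
    from C(2)[rule_format, OF f1 d1 PC this e1 c1] obtain q where q: "q \<ge> 1" "real q \<le> real C * (M1 / d1) ^ C"
        "nint_dist (real q * x) \<le> real C * (M1 / d1) ^ C * (2 * e) / real P ^ j" by blast
    have qY: "real q \<le> Y" using q(2) CY by simp
    have P1: "P \<ge> 1" using \<open>Y \<le> P\<close> Y1 by simp
    have "real C * (M1 / d1) ^ C * (2 * e) / real P ^ j \<le> Y * (2 * e) / real P ^ j"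
      using CY e by (intro divide_right_mono mult_right_mono) auto
    with q(3) have qx: "nint_dist (real q * x) \<le> Y * (2 * e) / real P ^ j" by simp
    define b where "b = round (real q * x)"
    define t where "t = x - of_int b / real q"
    have qt: "real q * \<bar>t\<bar> = nint_dist (real q * x)"
    proof -
      have "real q * \<bar>t\<bar> = \<bar>real q * t\<bar>" by (simp add: abs_mult)
      also have "real q * t = real q * x - of_int b" using q by (simp add: t_def right_diff_distrib)
      finally show ?thesis by (simp add: nint_dist_def b_def)
    qed
    have "\<bar>t\<bar> \<le> real q * \<bar>t\<bar>" using mult_right_mono[of 1 "real q" "\<bar>t\<bar>"] q by simp
    hence t_le: "\<bar>t\<bar> \<le> Y * (2 * e) / real P ^ j" using qt qx by simp
    have xeq: "x = of_int b / real q + t" by (simp add: t_def)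
    \<comment> \<open>\<open>V * R\<close> bounds the change of \<open>f p * t\<close> over a
      subinterval of \<open>{1..P}\<close> of length \<open>R\<close>; \<open>slow_variation\<close>
      requires it to be below one half.\<close>
    define V where "V = M * (real j + 1) * real P ^ j * \<bar>t\<bar>"
    have Vnn: "V \<ge> 0" using M by (simp add: V_def)
    have "V \<le> M * (real j + 1) * real P ^ j * (Y * (2 * e) / real P ^ j)"
      unfolding V_def using t_le M by (intro mult_left_mono) auto
    also have "\<dots> = M * (real j + 1) * (Y * (2 * e))" using P1 by simp
    also have "\<dots> \<le> X * (real j + 1) * (Y * (2 * e))" using X e Y1 by (intro mult_right_mono) auto
    finally have V_le: "V \<le> X * (real j + 1) * (Y * (2 * e))" .
    have nearA: "\<And>p. p \<in> A \<Longrightarrow> nint_dist (real (f p) * x) \<le> e" by (simp add: A_def)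
    have goalbound: "\<bar>t\<bar> * (d * R / 8) * (d * P / 4) ^ j \<le> 2 * e" 
      if R: "R \<ge> 1" "R \<le> P" "16 * q / d \<le> R" and "V * R < 1 / 2" for R :: nat
      by (rule slow_variation[OF A d f q(1) R xeq _ nearA]) (use that in \<open>simp add: V_def mult_ac\<close>)
    have "real q * (1 / d) \<le> Y * X" using qY X Y1 d by (intro mult_mono) auto
    hence qd: "16 * q / d \<le> 16 * (Y * X)" by simp
    show "\<exists>q\<ge>1. real q \<le> real C' * (M / d) ^ C' \<and> nint_dist (real q * x) \<le> real C' * (M / d) ^ C' * e / real P ^ Suc j"
    \<comment> \<open>If the total variation is small, the single interval \<open>R = P\<close>
      gives the claim. Otherwise a length \<open>R\<close> of about \<open>1 / (4 * V)\<close> is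
      still admissible. Since \<open>V\<close> is proportional to \<open>\<bar>t\<bar>\<close>, that
      factor cancels from the conclusion of \<open>slow_variation\<close>, which becomes a lower
      bound for \<open>e\<close> and contradicts the smallness of \<open>e\<close>.\<close>
    proof (cases "V * P < 1 / 2")
      case True
      have "16 * (Y * X) = real (16 * a) * X ^ (E + 1)" by (simp add: Y_def)
      also have "\<dots> \<le> P" using C'_ge(1) E_le by (intro Pbig) auto
      finally have "16 * q / d \<le> P" using qd by simp
      from goalbound[OF P1 order_refl this True]
      have *: "\<bar>t\<bar> * (d * P / 8) * (d * P / 4) ^ j \<le> 2 * e" .
      have "\<bar>t\<bar> * (d * P / 8) ^ Suc j \<le> \<bar>t\<bar> * (d * P / 8) * (d * P / 4) ^ j"
        using d by (auto simp: mult.assoc intro!: mult_left_mono power_mono)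
      with * have "\<bar>t\<bar> * (d * P / 8) ^ Suc j \<le> 2 * e" by simp
      hence "\<bar>t\<bar> \<le> 2 * e / (d * P / 8) ^ Suc j" using d P1 by (simp add: field_simps del: power_Suc)
      also have "\<dots> = 2 * 8 ^ Suc j * (1 / d) ^ Suc j * e / real P ^ Suc j"
        by (simp add: power_mult_distrib power_divide field_simps del: power_Suc)
      also have "\<dots> \<le> 2 * 8 ^ Suc j * X ^ Suc j * e / real P ^ Suc j"
        using X e d by (intro divide_right_mono mult_right_mono mult_left_mono power_mono) auto
      finally have "real q * \<bar>t\<bar> \<le> Y * (2 * 8 ^ Suc j * X ^ Suc j * e / real P ^ Suc j)"
        using qY Y1 by (intro mult_mono) auto
      also have "\<dots> = real (2 * 8 ^ Suc j * a) * X ^ (E + j + 1) * e / real P ^ Suc j"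
        by (simp add: Y_def power_add)
      also have "\<dots> \<le> real C' * X ^ C' * e / real P ^ Suc j"
        using bound[OF C'_ge(4) E_le(4)] e by (intro divide_right_mono mult_right_mono) auto
      finally have "nint_dist (real q * x) \<le> real C' * (M / d) ^ C' * e / real P ^ Suc j"
        unfolding qt X_def .
      moreover have "real q \<le> real C' * X ^ C'"
        using qY bound[of a E] C'_ge(2) E_le(1) by (simp add: Y_def)
      ultimately show ?thesis using q(1) by (auto simp: X_def)
    next
      case False
      hence VP: "V * P \<ge> 1 / 2" by simp
      hence Vpos: "V > 0" using Vnn by (cases "V = 0") auto
      define R where "R = nat \<lfloor>1 / (4 * V)\<rfloor>"
      \<comment> \<open>The factor 17, where 16 is needed for \<open>R\<close>, leaves room for
        rounding \<open>1 / (4 * V)\<close> down.\<close>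
      have "V * (4 * (17 * (Y * X))) \<le> X * (real j + 1) * (Y * (2 * e)) * (4 * (17 * (Y * X)))"
        using V_le X Y1 by (intro mult_right_mono) auto
      also have "\<dots> = e * (real (136 * (j + 1) * a\<^sup>2) * X ^ (2 * E + 2))"
      proof -
        have "X ^ (2 * E + 2) = X * X * (X ^ E * X ^ E)" by (simp add: power_add mult_2 power2_eq_square)
        moreover have "real (136 * (j + 1) * a\<^sup>2) = 136 * (real j + 1) * (real a * real a)"
          by (simp only: of_nat_mult of_nat_add of_nat_power power2_eq_square of_nat_numeral of_nat_1)
        moreover have "x * k * (A * Z * (2 * w)) * (4 * (17 * (A * Z * x))) = w * (136 * k * (A * A) * (x * x * (Z * Z)))"
          for x k A Z w :: real by (simp add: algebra_simps)
        ultimately show ?thesis unfolding Y_def by (simp only:)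
      qed
      also have "\<dots> \<le> 1" using C'_ge(3) E_le(3) by (intro esmall) auto
      finally have R4: "17 * (Y * X) \<le> 1 / (4 * V)" using Vpos by (simp add: field_simps)
      have YX: "Y * X \<ge> 1" using Y1 X mult_mono[of 1 Y 1 X] by simp
      have R: "real R \<ge> 1 / (4 * V) - 1" "real R \<le> 1 / (4 * V)" unfolding R_def using Vpos of_nat_floor[of "1 / (4 * V)"] by (linarith, simp)
      have R16: "real R \<ge> 16 * (Y * X)" using R(1) R4 YX by linarith
      have R1: "R \<ge> 1" using R16 YX by linarith
      have R8: "real R \<ge> 1 / (8 * V)" using R(1) R4 YX by (simp add: field_simps) 
      have "1 / (4 * V) \<le> P" using VP Vpos by (simp add: field_simps)
      hence RP: "R \<le> P" using R(2) by linarith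
      have VR: "V * R < 1 / 2" using R(2) Vpos by (simp add: field_simps)
      have *: "\<bar>t\<bar> * (d * R / 8) * (d * P / 4) ^ j \<le> 2 * e"
        using goalbound[OF R1 RP _ VR] qd R16 by linarith
      have t0: "\<bar>t\<bar> > 0" using Vpos M by (auto simp: V_def zero_less_mult_iff)
      have "1 / (64 * (real j + 1) * 4 ^ j * X ^ (j + 1)) \<le> d / (64 * (real j + 1) * M * (4 / d) ^ j)"
      proof -
        have "64 * (real j + 1) * M * (4 / d) ^ j \<le> d * (64 * (real j + 1) * 4 ^ j * X ^ (j + 1))"
        proof -
          have "64 * (real j + 1) * M * (4 / d) ^ j = d * (64 * (real j + 1) * 4 ^ j * (X * (1 / d) ^ j))"
            using d by (simp add: X_def power_divide field_simps)
          also have "\<dots> \<le> d * (64 * (real j + 1) * 4 ^ j * (X * X ^ j))"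
            using X d by (intro mult_left_mono power_mono) auto
          finally show ?thesis by simp
        qed
        moreover have "1 / b \<le> d / a" if "a \<le> d * b" "a > 0" "b > 0" for a b :: real
          using that by (simp add: field_simps)
        ultimately show ?thesis using X d M by simp
      qed
      also have "\<dots> = \<bar>t\<bar> * (d * (1 / (8 * V)) / 8) * (d * P / 4) ^ j"
      proof -
        have 1: "(d * P / 4) ^ j = real P ^ j / (4 / d) ^ j"
          by (simp add: power_divide power_mult_distrib)
        have 2: "d / (64 * u * M * Z) = w * (d * (1 / (8 * (M * u * Q * w))) / 8) * (Q / Z)"
          if "u > 0" "Z > 0" "w > 0" "Q > 0" for u Z w Q :: real
          using that M by (simp add: field_simps)
        show ?thesis unfolding 1 V_def by (rule 2) (use t0 P1 d in auto)
      qed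
      also have "\<dots> \<le> \<bar>t\<bar> * (d * R / 8) * (d * P / 4) ^ j"
        using R8 d by (intro mult_right_mono mult_left_mono divide_right_mono) auto
      also have "\<dots> \<le> 2 * e" by (rule *)
      finally have *: "1 / (64 * (real j + 1) * 4 ^ j * X ^ (j + 1)) \<le> 2 * e" .
      have "1 \<le> w * Z" if "1 / Z \<le> w" "Z > 0" for w Z :: real using that by (simp add: field_simps)
      from this[OF *] have "1 \<le> 2 * e * (64 * (real j + 1) * 4 ^ j * X ^ (j + 1))" using X by simp
      also have "\<dots> = e * (real (256 * (j + 1) * 4 ^ j) * X ^ (j + 1)) / 2" by (simp add: field_simps)
      also have "\<dots> \<le> 1 / 2" using esmall[OF C'_ge(5) E_le(5)] by simp
      finally show ?thesis by simp
    qed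
  qed
  ultimately show ?case by blast
qed

section \<open>Counting smooth integers\<close>

text \<open>The count as a real number and for any real \<open>x\<close>; it is 0 for
  \<open>x < 1\<close>, so that arguments such as \<open>x / p\<close> may drop below 1 without
  harm.\<close>

definition Psi :: "real \<Rightarrow> real \<Rightarrow> real \<Rightarrow> real" where
  "Psi a b x = real (card (smooth_upto x a b))"

lemma smooth_upto_iff: "n \<in> smooth_upto x a b \<longleftrightarrow> n \<in> smooth_set a b \<and> real n \<le> x"
  by (auto simp: smooth_upto_def smooth_set_def)

lemma finite_smooth_upto [simp]: "finite (smooth_upto x a b)"
  by (rule finite_subset[OF _ finite_nat_le_real[of x]]) (auto simp: smooth_upto_iff)

lemma smooth_set_pos: "n \<in> smooth_set a b \<Longrightarrow> n > 0"
  by (simp add: smooth_set_def)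

lemma smooth_set_1 [simp]: "Suc 0 \<in> smooth_set a b"
  by (auto simp: smooth_set_def)

lemma smooth_set_mult: "m \<in> smooth_set a b \<Longrightarrow> n \<in> smooth_set a b \<Longrightarrow> m * n \<in> smooth_set a b"
  by (auto simp: smooth_set_def prime_dvd_mult_iff)

lemma smooth_set_dvd: "n \<in> smooth_set a b \<Longrightarrow> d dvd n \<Longrightarrow> d \<in> smooth_set a b"
  by (auto simp: smooth_set_def intro!: Nat.gr0I dest: dvd_trans)

lemma prime_in_smooth_set: "prime p \<Longrightarrow> a \<le> real p \<Longrightarrow> real p \<le> b \<Longrightarrow> p \<in> smooth_set a b"
  by (auto simp: smooth_set_def prime_gt_0_nat dest: primes_dvd_imp_eq)

lemma prime_dvd_smooth: "n \<in> smooth_set a b \<Longrightarrow> prime p \<Longrightarrow> p dvd n \<Longrightarrow> a \<le> real p \<and> real p \<le> b"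
  by (auto simp: smooth_set_def)

lemma prod_list_smooth: "(\<And>x. x \<in> set xs \<Longrightarrow> x \<in> smooth_set a b) \<Longrightarrow> prod_list xs \<in> smooth_set a b"
  by (induction xs) (auto intro: smooth_set_mult)

lemma Psi_nonneg [simp]: "Psi a b x \<ge> 0"
  by (simp add: Psi_def)

lemma Psi_mono: "x \<le> y \<Longrightarrow> Psi a b x \<le> Psi a b y"
  unfolding Psi_def by (auto intro!: card_mono simp: smooth_upto_iff)

lemma Psi_eq_0: "x < 1 \<Longrightarrow> Psi a b x = 0"
  by (auto simp: Psi_def smooth_upto_iff card_eq_0_iff dest!: smooth_set_pos)

lemma Psi_ge_1: "x \<ge> 1 \<Longrightarrow> Psi a b x \<ge> 1"
proof -
  assume "x \<ge> 1"
  hence "{1} \<subseteq> smooth_upto x a b" by (auto simp: smooth_upto_iff)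
  from card_mono[OF _ this] show ?thesis by (simp add: Psi_def)
qed

lemma card_smooth_multiples:
  assumes "d > 0"
  shows "real (card {n \<in> smooth_upto x a b. d dvd n}) \<le> Psi a b (x / d)"
proof -
  have "inj_on (\<lambda>n. n div d) {n \<in> smooth_upto x a b. d dvd n}"
    by (rule inj_onI) (auto elim!: dvdE)
  moreover have "(\<lambda>n. n div d) ` {n \<in> smooth_upto x a b. d dvd n} \<subseteq> smooth_upto (x / d) a b"
    using assms by (auto simp: smooth_upto_iff field_simps intro: smooth_set_dvd[OF _ dvd_triv_left] elim!: dvdE)
  ultimately show ?thesis unfolding Psi_def by (auto intro!: card_inj_on_le)
qed

lemma card_smooth_multiples_eq:
  assumes "d \<in> smooth_set a b"
  shows "real (card {n \<in> smooth_upto x a b. d dvd n}) = Psi a b (x / d)"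
proof -
  have d: "d > 0" using assms by (rule smooth_set_pos)
  have "inj_on (\<lambda>n. n * d) (smooth_upto (x / d) a b)" using d by (auto intro: inj_onI)
  moreover have "(\<lambda>n. n * d) ` smooth_upto (x / d) a b \<subseteq> {n \<in> smooth_upto x a b. d dvd n}"
    using d assms by (auto simp: smooth_upto_iff field_simps intro: smooth_set_mult)
  ultimately have "card (smooth_upto (x / d) a b) \<le> card {n \<in> smooth_upto x a b. d dvd n}"
    by (auto intro!: card_inj_on_le)
  thus ?thesis using card_smooth_multiples[OF d, of x a b] by (simp add: Psi_def)
qed

lemma sum_over_prime_divisors:
  assumes "finite P" "\<And>p. p \<in> P \<Longrightarrow> p \<in> smooth_set a b"
  shows "(\<Sum>n\<in>smooth_upto x a b. \<Sum>p | p \<in> P \<and> p dvd n. g p) = (\<Sum>p\<in>P. g p * Psi a b (x / real p))"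
proof -
  have "(\<Sum>n\<in>smooth_upto x a b. \<Sum>p | p \<in> P \<and> p dvd n. g p) =
        (\<Sum>p\<in>P. \<Sum>n | n \<in> smooth_upto x a b \<and> p dvd n. g p)"
    by (rule sum.swap_restrict) (use assms in auto)
  also have "\<dots> = (\<Sum>p\<in>P. g p * Psi a b (x / real p))"
    by (intro sum.cong refl) (simp add: card_smooth_multiples_eq[OF assms(2), symmetric])
  finally show ?thesis .
qed

text \<open>Both sides sum \<open>g p\<close> over pairs with \<open>m * p \<le> x\<close>. Together
  with \<open>sum_over_prime_divisors\<close> this turns information on the prime factors of
  \<open>n\<close> into information on the primes that may be attached to a cofactor
  \<open>m\<close>, and to those Chebyshev bounds apply.\<close>

lemma sum_over_cofactors:
  assumes "finite P" "\<And>p. p \<in> P \<Longrightarrow> p > 0"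
  shows "(\<Sum>p\<in>P. g p * Psi a b (x / real p)) = 
         (\<Sum>m\<in>smooth_upto x a b. \<Sum>p | p \<in> P \<and> real p \<le> x / real m. g p)"
proof -
  have *: "Psi a b (x / real p) = real (card {m \<in> smooth_upto x a b. real p \<le> x / real m})" if "p \<in> P" for p
  proof -
    have "smooth_upto (x / real p) a b = {m \<in> smooth_upto x a b. real p \<le> x / real m}"
    proof safe
      fix m assume m: "m \<in> smooth_upto (x / real p) a b"
      have mp: "m > 0" "real p \<ge> 1" using m assms(2)[OF that] by (auto simp: smooth_upto_iff smooth_set_pos)
      have "real m * real p \<le> x" using m mp by (simp add: smooth_upto_iff field_simps)
      moreover have "real m * 1 \<le> real m * real p" using mp by (intro mult_left_mono) auto
      ultimately have "real m \<le> x" by linarith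
      thus "m \<in> smooth_upto x a b" "real p \<le> x / real m"
        using m mp \<open>real m * real p \<le> x\<close> by (auto simp: smooth_upto_iff field_simps)
    next
      fix m assume "m \<in> smooth_upto x a b" "real p \<le> x / real m"
      thus "m \<in> smooth_upto (x / real p) a b" using assms(2)[OF that]
        by (auto simp: smooth_upto_iff field_simps dest: smooth_set_pos)
    qed
    thus ?thesis by (simp add: Psi_def)
  qed
  have "(\<Sum>p\<in>P. g p * Psi a b (x / real p)) = (\<Sum>p\<in>P. \<Sum>m | m \<in> smooth_upto x a b \<and> real p \<le> x / real m. g p)"
    by (intro sum.cong refl) (simp add: *)
  also have "\<dots> = (\<Sum>m\<in>smooth_upto x a b. \<Sum>p | p \<in> P \<and> real p \<le> x / real m. g p)"
    by (rule sum.swap_restrict) (use assms in auto)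
  finally show ?thesis .
qed

lemma sum_ln_prime_divisors_le:
  assumes "finite P" "\<And>p. p \<in> P \<Longrightarrow> prime p" "n > 0"
  shows "(\<Sum>p | p \<in> P \<and> p dvd n. ln (real p)) \<le> ln (real n)"
proof -
  let ?Q = "{p. p \<in> P \<and> p dvd n}"
  have fin: "finite ?Q" using assms by auto
  have "\<Prod>?Q dvd n" using assms by (intro prod_primes_dvd) auto
  hence "real (\<Prod>?Q) \<le> real n" using assms by (simp only: of_nat_le_iff dvd_imp_le)
  moreover have "(\<Sum>p\<in>?Q. ln (real p)) = ln (real (\<Prod>?Q))"
  proof -
    have "real p > 0" if "p \<in> ?Q" for p using that assms by (auto simp: prime_gt_0_nat)
    thus ?thesis using fin unfolding of_nat_prod by (subst ln_prod) auto
  qed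
  moreover have "real (\<Prod>?Q) > 0" using assms by (auto simp: prime_gt_0_nat intro!: prod_pos)
  ultimately show ?thesis using assms by simp
qed

text \<open>Grouped by the product \<open>n = m * p\<close>, each \<open>n\<close> collects at most
  \<open>ln n \<le> L\<close>. With \<open>L\<close> in place of \<open>ln x\<close>, one
  \<open>L\<close> serves all smaller arguments, positive or not.\<close>

lemma sum_ln_primes_Psi_le:
  assumes "finite P" "\<And>p. p \<in> P \<Longrightarrow> prime p \<and> a \<le> real p \<and> real p \<le> b" "x \<le> exp L" "L \<ge> 0"
  shows "(\<Sum>p\<in>P. ln (real p) * Psi a b (x / real p)) \<le> Psi a b x * L"
proof -
  have "(\<Sum>p\<in>P. ln (real p) * Psi a b (x / real p)) = (\<Sum>n\<in>smooth_upto x a b. \<Sum>p | p \<in> P \<and> p dvd n. ln (real p))"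
    by (rule sum_over_prime_divisors[symmetric]) (use assms in \<open>auto intro: prime_in_smooth_set\<close>)
  also have "\<dots> \<le> (\<Sum>n\<in>smooth_upto x a b. L)"
  proof (rule sum_mono)
    fix n assume n: "n \<in> smooth_upto x a b"
    hence n0: "n > 0" by (auto simp: smooth_upto_iff smooth_set_pos)
    have "(\<Sum>p | p \<in> P \<and> p dvd n. ln (real p)) \<le> ln (real n)"
      using assms n0 by (intro sum_ln_prime_divisors_le) auto
    also have "\<dots> \<le> ln (exp L)" using n n0 assms(3) by (subst ln_le_cancel_iff) (auto simp: smooth_upto_iff)
    finally show "(\<Sum>p | p \<in> P \<and> p dvd n. ln (real p)) \<le> L" by simp
  qed
  finally show ?thesis by (simp add: Psi_def)
qed

lemma rough_theta_le: "t \<ge> 0 \<Longrightarrow> (\<Sum>p | prime p \<and> a \<le> real p \<and> real p \<le> t. ln (real p)) \<le> 2 * t"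
proof -
  assume t: "t \<ge> 0"
  have "(\<Sum>p | prime p \<and> a \<le> real p \<and> real p \<le> t. ln (real p)) \<le> theta t"
    unfolding theta_def by (intro sum_mono2) (auto simp: prime_gt_0_nat Suc_leI)
  with theta_le[OF t] show ?thesis by simp
qed

section \<open>Comparison of counts by Chebyshev bounds and Rankin's method\<close>

locale chebyshev =
  fixes c :: real
  assumes c_pos: "c > 0" and theta_lower: "\<And>x. x \<ge> 2 \<Longrightarrow> theta x \<ge> c * x"
begin

lemma c_le: "c \<le> 2"
  using theta_lower[of 2] theta_le[of 2] by simp

text \<open>Origin of the recurring ratio \<open>4 / c\<close>: the primes below \<open>a\<close>
  weigh at most \<open>2 * a \<le> c / 2 * t\<close>, half of the guaranteed \<open>c * t\<close>,
  so half is left for the primes from \<open>a\<close> to \<open>t\<close>.\<close>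

lemma rough_theta_ge:
  assumes "t \<ge> 2" "t \<ge> 4 / c * a"
  shows "(\<Sum>p | prime p \<and> a \<le> real p \<and> real p \<le> t. ln (real p)) \<ge> c / 2 * t"
proof -
  let ?W = "{p. prime p \<and> a \<le> real p \<and> real p \<le> t}"
  let ?T = "{p. prime p \<and> real p \<le> t}"
  have nn: "ln (real p) \<ge> 0" if "prime p" for p using that by (simp add: prime_gt_0_nat Suc_leI)
  have fin: "finite (?T - ?W)" "finite ?W" "finite ?T"
    using finite_le_real[of prime t] by (auto intro: finite_subset[rotated])
  have "theta t = (\<Sum>p\<in>?T - ?W. ln (real p)) + (\<Sum>p\<in>?W. ln (real p))"
    unfolding theta_def using fin by (intro sum.subset_diff) auto
  also have "(\<Sum>p\<in>?T - ?W. ln (real p)) \<le> theta (max a 0)"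
    unfolding theta_def using nn by (intro sum_mono2) auto
  also have "\<dots> \<le> 2 * max a 0" by (rule theta_le) simp
  also have "2 * max a 0 \<le> c / 2 * t" using assms c_pos by (simp add: field_simps max_def)
  finally show ?thesis using theta_lower[OF assms(1)] by simp
qed

text \<open>Averages \<open>Psi a b (x / t) \<le> Psi a b (x / p)\<close> over the primes
  \<open>p\<close> from \<open>a\<close> to \<open>t\<close> with weights \<open>ln p\<close>, whose
  total is at least \<open>c / 2 * t\<close>. Passing from \<open>x\<close> to \<open>x / t\<close>
  thus gains the factor \<open>2 * L / (c * t)\<close>, which is small once \<open>t\<close> is well
  above \<open>L\<close>.\<close>

lemma Psi_div_le:
  assumes "t \<ge> 2" "t \<ge> 4 / c * a" "t \<le> b" "x \<le> exp L" "L \<ge> 0"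
  shows "Psi a b (x / t) * (c / 2 * t) \<le> Psi a b x * L"
proof -
  let ?P = "{p. prime p \<and> a \<le> real p \<and> real p \<le> t}"
  have fin: "finite ?P" using finite_le_real[of prime t] by (auto intro: finite_subset[rotated])
  have "Psi a b (x / t) * (c / 2 * t) \<le> Psi a b (x / t) * (\<Sum>p\<in>?P. ln (real p))"
    by (intro mult_left_mono rough_theta_ge assms) auto
  also have "\<dots> = (\<Sum>p\<in>?P. ln (real p) * Psi a b (x / t))" by (simp add: sum_distrib_left mult.commute)
  also have "\<dots> \<le> (\<Sum>p\<in>?P. ln (real p) * Psi a b (x / real p))"
  proof (rule sum_mono)
    fix p assume p: "p \<in> ?P"
    hence p0: "real p \<ge> 1" using prime_ge_1_nat by auto
    have "Psi a b (x / t) \<le> Psi a b (x / real p)"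
    proof (cases "x \<ge> 0")
      case True
      thus ?thesis using p p0 by (intro Psi_mono divide_left_mono) auto
    next
      case False
      hence "x / t < 1" using assms(1) by (simp add: field_simps)
      thus ?thesis by (simp add: Psi_eq_0)
    qed
    thus "ln (real p) * Psi a b (x / t) \<le> ln (real p) * Psi a b (x / real p)"
      using p0 by (intro mult_left_mono) auto
  qed
  also have "\<dots> \<le> Psi a b x * L" using fin assms by (intro sum_ln_primes_Psi_le) auto
  finally show ?thesis .
qed

lemma Psi_div_power_le:
  assumes "t \<ge> 2" "t \<ge> 4 / c * a" "t \<le> b" "x \<le> exp L" "L \<ge> 0" 
    and s: "L / (c / 2 * t) \<le> t powr (-s)"
  shows "Psi a b (x / t ^ j) \<le> t powr (- s * j) * Psi a b x"
proof (induction j)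
  case (Suc j)
  have xj: "x / t ^ j \<le> exp L"
  proof (cases "x \<ge> 0")
    case True
    have "1 \<le> t ^ j" using assms(1) by (intro one_le_power) auto
    hence "x / t ^ j \<le> x / 1" using True by (intro divide_left_mono) auto
    thus ?thesis using assms by simp
  next
    case False
    hence "x / t ^ j \<le> 0" using assms(1) by (auto simp: field_simps)
    thus ?thesis by (rule order_trans) simp
  qed
  have "Psi a b (x / t ^ j / t) * (c / 2 * t) \<le> Psi a b (x / t ^ j) * L"
    by (rule Psi_div_le[OF assms(1,2,3) xj assms(5)])
  hence "Psi a b (x / t ^ Suc j) \<le> Psi a b (x / t ^ j) * (L / (c / 2 * t))"
    using c_pos assms(1) by (simp add: field_simps)
  also have "\<dots> \<le> (t powr (- s * j) * Psi a b x) * t powr (-s)"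
    using Suc.IH s assms c_pos by (intro mult_mono) auto
  also have "\<dots> = t powr (- s * Suc j) * Psi a b x"
    by (simp add: powr_add[symmetric] algebra_simps)
  finally show ?case .
qed (use assms in simp)

text \<open>\<open>d\<close> is rounded down to a power of \<open>t\<close>, which loses a factor of
  at most \<open>t powr s \<le> t\<close>.\<close>

lemma Psi_div_le_powr:
  assumes t: "t \<ge> 2" "t \<ge> 4 / c * a" "t \<le> b" and x: "x \<le> exp L" "x \<ge> 0" "L \<ge> 0" 
    and s: "L / (c / 2 * t) \<le> t powr (-s)" "0 \<le> s" "s \<le> 1" and d: "d \<ge> 1"
  shows "Psi a b (x / d) \<le> t * d powr (-s) * Psi a b x"
proof -
  define j where "j = nat \<lfloor>ln d / ln t\<rfloor>"
  have lt: "ln t > 0" using t by simp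
  have "ln d / ln t \<ge> 0" using d lt by simp
  hence j: "real j \<le> ln d / ln t" "ln d / ln t \<le> real j + 1" unfolding j_def by linarith+
  have "t ^ j = exp (j * ln t)" using t by (simp add: exp_of_nat_mult)
  also have "\<dots> \<le> exp (ln d)" using j lt by (subst exp_le_cancel_iff) (simp add: field_simps)
  finally have tj: "t ^ j \<le> d" using d by simp
  have "Psi a b (x / d) \<le> Psi a b (x / t ^ j)"
    using tj t x d by (intro Psi_mono divide_left_mono) auto
  also have "\<dots> \<le> t powr (- s * j) * Psi a b x" by (rule Psi_div_power_le[OF t x(1,3) s(1)])
  also have "t powr (- s * j) \<le> t * d powr (-s)"
  proof -
    have "s * (ln d - j * ln t) \<le> 1 * ln t" using j lt s by (intro mult_mono) (auto simp: field_simps)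
    hence "- s * j * ln t \<le> ln t + - s * ln d" by (simp add: algebra_simps)
    hence "exp (- s * j * ln t) \<le> exp (ln t + - s * ln d)" by simp
    also have "\<dots> = t * d powr (-s)" using t d by (simp add: exp_add powr_def exp_diff exp_minus field_simps)
    finally show ?thesis using t by (simp add: powr_def)
  qed
  finally show ?thesis by (simp add: mult_right_mono)
qed

end

text \<open>One factor of an Euler product per induction step: the power of \<open>q\<close> is
  split off each \<open>n\<close>, and these powers sum to at most \<open>1 / (1 - t)\<close> with
  \<open>t = q powr (-s)\<close>. As \<open>s \<ge> 1/2\<close> gives \<open>t \<le> 3/4\<close>,
  this is at most \<open>1 + 4 * t \<le> exp (4 * t)\<close>.\<close>

lemma euler_product_bound:
  assumes "finite P" "\<And>p. p \<in> P \<Longrightarrow> prime p" "finite F" 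
    "\<And>n. n \<in> F \<Longrightarrow> n > 0 \<and> (\<forall>p. prime p \<longrightarrow> p dvd n \<longrightarrow> p \<in> P)" and s: "s \<ge> 1/2"
  shows "(\<Sum>n\<in>F. real n powr (-s)) \<le> exp (4 * (\<Sum>p\<in>P. real p powr (-s)))"
  using assms(1-4)
proof (induction P arbitrary: F rule: finite_induct)
  case empty
  have "F \<subseteq> {1}"
  proof
    fix n assume "n \<in> F"
    with empty.prems(3) have "n > 0" "\<And>p. prime p \<Longrightarrow> \<not> p dvd n" by auto
    thus "n \<in> {1}" using prime_factor_nat[of n] by auto
  qed
  hence "(\<Sum>n\<in>F. real n powr (-s)) \<le> (\<Sum>n\<in>{1::nat}. real n powr (-s))" by (intro sum_mono2) auto
  thus ?case by simp
next
  case (insert q P)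
  have q: "prime q" using insert.prems by auto
  hence q2: "real q \<ge> 2" using prime_ge_2_nat by auto
  define V where "V = Max (insert 0 (multiplicity q ` F))"
  define cof where "cof = (\<lambda>n. n div q ^ multiplicity q n)"
  define t where "t = real q powr (-s)"
  have fac: "n = q ^ multiplicity q n * cof n" for n
    unfolding cof_def by (simp add: multiplicity_dvd)
  have inj: "inj_on (\<lambda>n. (multiplicity q n, cof n)) F"
    by (rule inj_onI) (metis fac prod.inject)
  have sub: "(\<lambda>n. (multiplicity q n, cof n)) ` F \<subseteq> {..V} \<times> cof ` F"
    using insert.prems(2) by (auto simp: V_def intro!: Max_ge)
  have IH: "(\<Sum>m\<in>cof ` F. real m powr (-s)) \<le> exp (4 * (\<Sum>p\<in>P. real p powr (-s)))"
  proof (rule insert.IH)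
    fix m assume "m \<in> cof ` F"
    then obtain n where n: "n \<in> F" "m = cof n" by blast
    have n0: "n > 0" using insert.prems(3) n by auto
    have "m > 0" using n0 fac[of n] n by (cases m) auto
    moreover have "p \<in> P" if p: "prime p" "p dvd m" for p
    proof -
      have "p dvd n" using fac[of n] p n by (metis dvd_mult)
      hence "p \<in> insert q P" using insert.prems(3) n p by blast
      moreover have "p \<noteq> q"
      proof
        assume "p = q"
        hence "q dvd cof n" using p n by simp
        moreover have "\<not> q dvd n div q ^ multiplicity q n" 
          using n0 q by (intro multiplicity_decompose) auto
        ultimately show False by (simp add: cof_def)
      qed
      ultimately show ?thesis by simp
    qed
    ultimately show "m > 0 \<and> (\<forall>p. prime p \<longrightarrow> p dvd m \<longrightarrow> p \<in> P)" by blast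
  qed (use insert.prems in auto)
  have t: "0 < t" "t \<le> 3/4"
  proof -
    have "t \<le> real q powr (-(1/2))" unfolding t_def using s q2 by (intro powr_mono) auto
    also have "\<dots> \<le> 2 powr (-(1/2))" using q2 by (intro powr_mono2') auto
    also have "\<dots> = 1 / sqrt 2" by (simp add: powr_minus powr_half_sqrt field_simps)
    also have "\<dots> \<le> 3/4"
    proof -
      have "4/3 \<le> sqrt (2::real)" by (rule real_le_rsqrt) (simp add: power2_eq_square)
      thus ?thesis by (simp add: field_simps)
    qed
    finally show "t \<le> 3/4" .
  qed (use q2 in \<open>simp add: t_def\<close>)
  have "(\<Sum>n\<in>F. real n powr (-s)) = (\<Sum>z\<in>(\<lambda>n. (multiplicity q n, cof n)) ` F. t ^ fst z * real (snd z) powr (-s))"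
  proof (subst sum.reindex[OF inj], intro sum.cong refl)
    fix n assume n: "n \<in> F"
    have "real n = real q ^ multiplicity q n * real (cof n)" by (subst fac) simp
    hence "real n powr (-s) = (real q ^ multiplicity q n) powr (-s) * real (cof n) powr (-s)"
      by (simp add: powr_mult)
    also have "(real q ^ multiplicity q n) powr (-s) = t ^ multiplicity q n"
      using q2 unfolding t_def by (simp add: powr_realpow[symmetric] powr_powr powr_power mult.commute)
    finally show "real n powr (-s) = ((\<lambda>z. t ^ fst z * real (snd z) powr (-s)) \<circ> (\<lambda>n. (multiplicity q n, cof n))) n" by simp
  qed
  also have "\<dots> \<le> (\<Sum>z\<in>{..V} \<times> cof ` F. t ^ fst z * real (snd z) powr (-s))"
    using insert.prems t by (intro sum_mono2 sub) auto
  also have "\<dots> = (\<Sum>v\<le>V. t ^ v) * (\<Sum>m\<in>cof ` F. real m powr (-s))"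
    by (simp add: sum_product sum.cartesian_product split_def)
  also have "\<dots> \<le> exp (4 * t) * exp (4 * (\<Sum>p\<in>P. real p powr (-s)))"
  proof (intro mult_mono IH)
    have "(\<Sum>v\<le>V. t ^ v) = (1 - t ^ Suc V) / (1 - t)" using t by (subst sum_gp0) auto
    also have "\<dots> \<le> 1 / (1 - t)" using t by (intro divide_right_mono) auto
    also have "\<dots> = 1 + t / (1 - t)" using t by (simp add: field_simps)
    also have "\<dots> \<le> 1 + 4 * t"
    proof -
      have "t / (1 - t) \<le> t / (1 / 4)" using t by (intro divide_left_mono) auto
      thus ?thesis by simp
    qed
    also have "\<dots> \<le> exp (4 * t)" by (rule exp_ge_add_one_self)
    finally show "(\<Sum>v\<le>V. t ^ v) \<le> exp (4 * t)" .
  qed (auto intro!: sum_nonneg)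
  also have "\<dots> = exp (4 * (\<Sum>p\<in>insert q P. real p powr (-s)))"
    using insert.hyps by (simp add: t_def exp_add[symmetric] algebra_simps)
  finally show ?case .
qed

lemma sum_inverse_le: "m \<ge> 1 \<Longrightarrow> (\<Sum>n=1..m. 1 / real n) \<le> 1 + ln (real m)"
proof (induction m rule: nat_induct_at_least)
  case (Suc m)
  have "ln (real m / real (Suc m)) \<le> real m / real (Suc m) - 1" using Suc by (intro ln_le_minus_one) auto
  also have "\<dots> = - (1 / real (Suc m))" by (simp add: field_simps)
  finally show ?case using Suc by (simp add: ln_div)
qed simp

lemma sum_primes_powr_le:
  assumes "w \<ge> 1" "s \<le> 1"
  shows "(\<Sum>p | prime p \<and> real p \<le> w. real p powr (-s)) \<le> w powr (1 - s) * (1 + ln w)"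
proof -
  define m where "m = nat \<lfloor>w\<rfloor>"
  have m: "real m \<le> w" "m \<ge> 1" unfolding m_def using assms by (auto simp: le_nat_floor)
  have "(\<Sum>p | prime p \<and> real p \<le> w. real p powr (-s)) \<le> (\<Sum>n=1..m. real n powr (-s))"
    by (intro sum_mono2) (auto simp: m_def le_nat_floor prime_gt_0_nat Suc_leI)
  also have "\<dots> \<le> (\<Sum>n=1..m. w powr (1 - s) * (1 / real n))"
  proof (rule sum_mono)
    fix n assume n: "n \<in> {1..m}"
    have "real n powr (-s) = real n powr (1 - s) * (1 / real n)"
      using n by (simp add: powr_diff powr_minus field_simps)
    also have "\<dots> \<le> w powr (1 - s) * (1 / real n)"
      using n m assms by (intro mult_right_mono powr_mono2) auto
    finally show "real n powr (-s) \<le> w powr (1 - s) * (1 / real n)" .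
  qed
  also have "\<dots> = w powr (1 - s) * (\<Sum>n=1..m. 1 / real n)" by (simp only: sum_distrib_left)
  also have "\<dots> \<le> w powr (1 - s) * (1 + ln w)"
  proof (intro mult_left_mono)
    have "ln (real m) \<le> ln w" using m by simp
    thus "(\<Sum>n=1..m. 1 / real n) \<le> 1 + ln w" using sum_inverse_le[OF m(2)] by linarith
  qed simp
  finally show ?thesis .
qed

text \<open>Rankin's trick. The multiples of \<open>d\<close> have density at most
  \<open>t * d powr (-s)\<close>, and
  \<open>d powr (-s) \<le> E powr (- (s - s')) * d powr (-s')\<close> for \<open>d \<ge> E\<close>.
  The sum of \<open>d powr (-s')\<close> over integers with primes up to \<open>w\<close> is bounded
  by an Euler product, and the gap between \<open>s'\<close> and \<open>s\<close> has to pay for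
  it.\<close>

lemma (in chebyshev) card_large_smooth_divisor:
  assumes t: "t \<ge> 2" "t \<ge> 4 / c * a" "t \<le> b" and x: "x \<le> exp L" "x \<ge> 0" "L \<ge> 0" 
    and s: "L / (c / 2 * t) \<le> t powr (-s)" "s \<le> 1" and s': "1 / 2 \<le> s'" "s' \<le> s" and w: "w \<ge> 1" and E: "E \<ge> 1"
  shows "real (card {n \<in> smooth_upto x a b. \<exists>d. d dvd n \<and> d \<in> smooth_set a w \<and> real d \<ge> E})
    \<le> t * E powr (- (s - s')) * exp (4 * (w powr (1 - s') * (1 + ln w))) * Psi a b x"
proof -
  define D where "D = {d \<in> smooth_upto x a w. real d \<ge> E}"
  have finD: "finite D" by (simp add: D_def)
  have "{n \<in> smooth_upto x a b. \<exists>d. d dvd n \<and> d \<in> smooth_set a w \<and> real d \<ge> E} \<subseteq> (\<Union>d\<in>D. {n \<in> smooth_upto x a b. d dvd n})"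
  proof safe
    fix n d assume nd: "n \<in> smooth_upto x a b" "d dvd n" "d \<in> smooth_set a w" "E \<le> real d"
    hence "d \<le> n" by (auto simp: smooth_upto_iff smooth_set_pos intro: dvd_imp_le)
    hence "d \<in> D" using nd by (auto simp: D_def smooth_upto_iff)
    thus "n \<in> (\<Union>d\<in>D. {n \<in> smooth_upto x a b. d dvd n})" using nd by blast
  qed
  hence "card {n \<in> smooth_upto x a b. \<exists>d. d dvd n \<and> d \<in> smooth_set a w \<and> real d \<ge> E} \<le> card (\<Union>d\<in>D. {n \<in> smooth_upto x a b. d dvd n})"
    using finD by (intro card_mono) auto
  also have "\<dots> \<le> (\<Sum>d\<in>D. card {n \<in> smooth_upto x a b. d dvd n})" by (rule card_UN_le[OF finD])
  finally have "real (card {n \<in> smooth_upto x a b. \<exists>d. d dvd n \<and> d \<in> smooth_set a w \<and> real d \<ge> E})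
     \<le> real (\<Sum>d\<in>D. card {n \<in> smooth_upto x a b. d dvd n})" by (simp only: of_nat_le_iff)
  also have "\<dots> \<le> (\<Sum>d\<in>D. t * Psi a b x * E powr (- (s - s')) * real d powr (-s'))"
    unfolding of_nat_sum
  proof (rule sum_mono)
    fix d assume d: "d \<in> D"
    have d1: "d > 0" "real d \<ge> E" using d by (auto simp: D_def smooth_upto_iff smooth_set_pos)
    have "real (card {n \<in> smooth_upto x a b. d dvd n}) \<le> Psi a b (x / d)" by (rule card_smooth_multiples[OF d1(1)])
    also have "\<dots> \<le> t * real d powr (-s) * Psi a b x"
      using d1 s s' by (intro Psi_div_le_powr[OF t x s(1)]) auto
    also have "real d powr (-s) = real d powr (- (s - s')) * real d powr (-s')"
      by (simp add: powr_add[symmetric])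
    also have "t * (real d powr (- (s - s')) * real d powr (-s')) * Psi a b x \<le> t * (E powr (- (s - s')) * real d powr (-s')) * Psi a b x"
      using t d1 s' E by (intro mult_right_mono mult_left_mono powr_mono2') auto
    finally show "real (card {n \<in> smooth_upto x a b. d dvd n}) \<le> t * Psi a b x * E powr (- (s - s')) * real d powr (-s')"
      by (simp add: mult_ac)
  qed
  also have "\<dots> = t * Psi a b x * E powr (- (s - s')) * (\<Sum>d\<in>D. real d powr (-s'))" by (simp add: sum_distrib_left)
  also have "\<dots> \<le> t * Psi a b x * E powr (- (s - s')) * exp (4 * (w powr (1 - s') * (1 + ln w)))"
  proof (intro mult_left_mono)
    have "(\<Sum>d\<in>D. real d powr (-s')) \<le> exp (4 * (\<Sum>p | prime p \<and> real p \<le> w. real p powr (-s')))"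
      using s' finD by (intro euler_product_bound) (auto simp: D_def smooth_upto_iff smooth_set_pos dest: prime_dvd_smooth)
    also have "\<dots> \<le> exp (4 * (w powr (1 - s') * (1 + ln w)))"
      using s' s w by (auto intro!: sum_primes_powr_le)
    finally show "(\<Sum>d\<in>D. real d powr (-s')) \<le> exp (4 * (w powr (1 - s') * (1 + ln w)))" .
  qed (use t in auto)
  finally show ?thesis by (simp add: mult_ac)
qed

section \<open>Local growth of the count of smooth integers\<close>

lemma prod_list_ge: 
  fixes v :: real
  assumes "\<And>x. x \<in> set xs \<Longrightarrow> v \<le> real x" "v \<ge> 0" 
  shows "v ^ length xs \<le> real (prod_list xs)"
  using assms by (induction xs) (auto intro!: mult_mono)

lemma prod_list_le: 
  fixes v :: real
  assumes "\<And>x. x \<in> set xs \<Longrightarrow> real x \<le> v" "v \<ge> 0" 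
  shows "real (prod_list xs) \<le> v ^ length xs"
  using assms by (induction xs) (auto intro!: mult_mono)

lemma sum_lists_prod:
  fixes g :: "'a \<Rightarrow> real"
  assumes "finite A"
  shows "(\<Sum>xs | set xs \<subseteq> A \<and> length xs = r. prod_list (map g xs)) = (\<Sum>x\<in>A. g x) ^ r"
proof (induction r)
  case 0
  have "{xs. set xs \<subseteq> A \<and> length xs = 0} = {[]}" by auto
  thus ?case by simp
next
  case (Suc r)
  let ?l = "{xs. set xs \<subseteq> A \<and> length xs = r}"
  have eq: "{xs. set xs \<subseteq> A \<and> length xs = Suc r} = (\<lambda>(x, xs). x # xs) ` (A \<times> ?l)"
    by (auto simp: length_Suc_conv image_iff)
  have inj: "inj_on (\<lambda>(x, xs). x # xs) (A \<times> ?l)" by (auto intro!: inj_onI)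
  have "(\<Sum>xs | set xs \<subseteq> A \<and> length xs = Suc r. prod_list (map g xs)) = (\<Sum>(x, xs)\<in>A \<times> ?l. g x * prod_list (map g xs))"
    unfolding eq by (subst sum.reindex[OF inj]) (auto intro!: sum.cong)
  also have "\<dots> = (\<Sum>x\<in>A. g x) * (\<Sum>xs\<in>?l. prod_list (map g xs))"
    by (simp add: sum_product sum.cartesian_product)
  finally show ?case using Suc by simp
qed

lemma prod_list_inverse: "prod_list (map (\<lambda>x. 1 / real x) xs) = 1 / real (prod_list xs)"
  by (induction xs) auto

lemma card_prime_divisors_le:
  assumes "finite W" "\<And>p. p \<in> W \<Longrightarrow> prime p \<and> v \<le> real p" "v > 1" "n > 0" "real n \<le> exp L"
  shows "real (card {p \<in> W. p dvd n}) \<le> L / ln v"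
proof -
  have "real (card {p \<in> W. p dvd n}) * ln v = (\<Sum>p\<in>{p \<in> W. p dvd n}. ln v)" by simp
  also have "\<dots> \<le> (\<Sum>p\<in>{p \<in> W. p dvd n}. ln (real p))"
    using assms by (intro sum_mono) (auto simp: prime_gt_0_nat)
  also have "\<dots> \<le> ln (real n)" by (rule sum_ln_prime_divisors_le) (use assms in auto)
  also have "\<dots> \<le> ln (exp L)" using assms by (subst ln_le_cancel_iff) auto
  finally show ?thesis using assms(3) by (simp add: field_simps)
qed

text \<open>Exchange argument: in \<open>n\<close> replace \<open>r\<close> of its prime factors from \<open>T\<close> by \<open>r\<close> smaller primes
  from \<open>W\<close> and one prime that fills up the remaining room.\<close>

lemma (in chebyshev) card_many_top_primes:
  fixes r k :: nat and a b z x L u v :: real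
  assumes b: "b > 1" and z: "z \<ge> 1" and k: "2 * r \<le> k" and xL: "x \<le> exp L"
    and T: "finite T" "\<And>p. p \<in> T \<Longrightarrow> prime p \<and> a \<le> real p \<and> b / z \<le> real p \<and> real p \<le> b"
    and W: "finite W" "\<And>p. p \<in> W \<Longrightarrow> prime p \<and> a \<le> real p \<and> v \<le> real p \<and> real p \<le> u \<and> real p \<le> b"
    and v: "v > 1" and u: "u \<ge> 0" and F: "(b / z) ^ r \<le> b * v ^ r" "max 2 (4 / c * a) * u ^ r \<le> (b / z) ^ r"
  shows "real (card {n \<in> smooth_upto x a b. card {p \<in> T. p dvd n} \<ge> k}) * (real k / 2) ^ r * (c / (2 * ln b)) * (b / z) ^ r * (\<Sum>p\<in>W. 1 / real p) ^ r
     \<le> Psi a b x * (real (card T) * (L / ln v)) ^ r * (L / ln 2)"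
proof -
  define X where "X = {n \<in> smooth_upto x a b. card {p \<in> T. p dvd n} \<ge> k}"
  define PS where "PS = (\<lambda>n. {ps. length ps = r \<and> distinct ps \<and> set ps \<subseteq> {p \<in> T. p dvd n}})"
  define QS where "QS = {qs. set qs \<subseteq> W \<and> length qs = r}"
  \<comment> \<open>\<open>G qs\<close> is the room left for the filling prime \<open>f\<close>: it
    ensures \<open>prod_list qs * f \<le> (b / z) ^ r \<le> prod_list ps\<close>, so that the new
    integer does not exceed \<open>n\<close>.\<close>
  define G where "G = (\<lambda>qs. (b / z) ^ r / real (prod_list qs))"
  define FS where "FS = (\<lambda>qs. {f. prime f \<and> a \<le> real f \<and> real f \<le> G qs})"
  define Om where "Om = (SIGMA n:X. SIGMA ps:PS n. SIGMA qs:QS. FS qs)"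
  define PS' where "PS' = {ps. set ps \<subseteq> T \<and> length ps = r}"
  define QS' where "QS' = (\<lambda>n. {qs. set qs \<subseteq> {p \<in> W. p dvd n} \<and> length qs = r})"
  define FS' where "FS' = (\<lambda>n. {f. prime f \<and> f dvd (n::nat)})"
  define Om' where "Om' = (SIGMA n:smooth_upto x a b. SIGMA ps:PS'. SIGMA qs:QS' n. FS' n)"
  \<comment> \<open>Keeping \<open>ps\<close>, \<open>qs\<close> and \<open>f\<close> beside the new
    integer makes \<open>g\<close> injective. In the upper bound \<open>qs\<close> and
    \<open>f\<close> are confined to prime factors of the new integer; only \<open>ps\<close> is
    free in \<open>T\<close>.\<close>
  define g where "g = (\<lambda>(n, ps, qs, f). (n div prod_list ps * (prod_list qs * f), ps, qs, f::nat))"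
  have fin: "finite X" "finite (PS n)" "finite QS" "finite (FS qs)" "finite PS'" "finite (QS' n)" for n qs
    unfolding X_def PS_def QS_def FS_def PS'_def QS'_def
    using T(1) W(1) finite_le_real[of "\<lambda>f. prime f \<and> a \<le> real f" "G qs"]
    by (auto simp: finite_lists_length_eq conj_assoc intro: finite_subset[OF _ finite_lists_length_eq[of T r]])
  have finF': "finite (FS' n)" if "n > 0" for n using that
    by (auto simp: FS'_def intro: finite_subset[OF _ finite_divisors_nat[of n]])
  have QS_pos: "prod_list qs > 0" if "qs \<in> QS" for qs
  proof -
    have "0 \<notin> set qs" using that W(2)[of 0] by (auto simp: QS_def)
    hence "prod_list qs \<noteq> 0" by (simp add: prod_list_zero_iff)
    thus ?thesis by simp
  qed
  have QS_le: "real (prod_list qs) \<le> u ^ r" "v ^ r \<le> real (prod_list qs)" if "qs \<in> QS" for qs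
    using that W(2) prod_list_le[of qs u] prod_list_ge[of qs v] u v by (auto simp: QS_def subset_iff)
  have ps_dvd: "prod_list ps dvd n" "real (prod_list ps) \<ge> (b / z) ^ r" if "ps \<in> PS n" for ps n
  proof -
    have "prod_list ps = \<Prod>(set ps)" using that by (simp add: PS_def prod.distinct_set_conv_list)
    also have "\<dots> dvd n" using that T(2) by (intro prod_primes_dvd) (auto simp: PS_def)
    finally show "prod_list ps dvd n" .
    show "real (prod_list ps) \<ge> (b / z) ^ r"
      using that T(2) prod_list_ge[of ps "b / z"] b z by (auto simp: PS_def subset_iff)
  qed
  have bz: "(b / z) ^ r > 0" using b z by simp
  have v0: "v ^ r > 0" using v by simp
  have inj: "inj_on g Om"
  proof (rule inj_onI)
    fix A B assume AB: "A \<in> Om" "B \<in> Om" "g A = g B"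
    obtain n ps qs f where A: "A = (n, ps, qs, f)" by (cases A) 
    obtain n' ps' qs' f' where B: "B = (n', ps', qs', f')" by (cases B) 
    have eq: "ps' = ps" "qs' = qs" "f' = f" "n div prod_list ps * (prod_list qs * f) = n' div prod_list ps * (prod_list qs * f)"
      using AB(3) by (auto simp: A B g_def)
    have "prod_list qs > 0" "f > 0" using AB(1) QS_pos by (auto simp: A Om_def FS_def prime_gt_0_nat)
    hence "n div prod_list ps = n' div prod_list ps" using eq(4) by simp
    moreover have "prod_list ps dvd n" "prod_list ps dvd n'" using AB ps_dvd by (auto simp: A B Om_def eq)
    ultimately have "n = n'" by (metis dvd_div_mult_self)
    thus "A = B" by (simp add: A B eq)
  qed
  have sub: "g ` Om \<subseteq> Om'"
  proof
    fix B assume "B \<in> g ` Om"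
    then obtain n ps qs f where A: "(n, ps, qs, f) \<in> Om" "B = g (n, ps, qs, f)" by auto
    have n: "n \<in> smooth_upto x a b" and ps: "ps \<in> PS n" and qs: "qs \<in> QS" and f: "prime f" "a \<le> real f" "real f \<le> G qs"
      using A by (auto simp: Om_def X_def FS_def)
    define n' where "n' = n div prod_list ps * (prod_list qs * f)"
    \<comment> \<open>The first part of \<open>F\<close> keeps the filling prime at most
      \<open>b\<close>; the second part, used in the lower bound for \<open>card Om\<close>, keeps
      \<open>G qs\<close> large enough for a Chebyshev bound.\<close>
    have "G qs \<le> (b / z) ^ r / v ^ r"
      unfolding G_def using QS_le[OF qs] bz v by (intro divide_left_mono) (auto intro!: mult_pos_pos intro: less_le_trans[of _ "v ^ r"])
    also have "\<dots> \<le> b" by (simp only: pos_divide_le_eq[OF v0] F(1))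
    finally have fb: "real f \<le> b" using f by simp
    have fs: "f \<in> smooth_set a b" using f fb by (intro prime_in_smooth_set) auto
    have qss: "prod_list qs \<in> smooth_set a b" using qs W(2) by (intro prod_list_smooth prime_in_smooth_set) (auto simp: QS_def)
    have nps: "n div prod_list ps \<in> smooth_set a b"
      using n ps_dvd(1)[OF ps] by (auto simp: smooth_upto_iff intro!: smooth_set_dvd[of n] elim!: dvdE)
    have "real n' = real (n div prod_list ps) * (real (prod_list qs) * real f)" by (simp add: n'_def)
    also have "\<dots> \<le> real (n div prod_list ps) * real (prod_list ps)"
    proof (intro mult_left_mono)
      have "real (prod_list qs) * real f \<le> real (prod_list qs) * G qs" using f by (intro mult_left_mono) auto
      also have "\<dots> = (b / z) ^ r" using QS_pos[OF qs] by (simp add: G_def)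
      also have "\<dots> \<le> real (prod_list ps)" by (rule ps_dvd(2)[OF ps])
      finally show "real (prod_list qs) * real f \<le> real (prod_list ps)" .
    qed auto
    also have "\<dots> = real n" using ps_dvd(1)[OF ps] by (metis dvd_div_mult_self of_nat_mult)
    finally have "real n' \<le> x" using n by (simp add: smooth_upto_iff)
    moreover have "n' \<in> smooth_set a b" unfolding n'_def by (intro smooth_set_mult fs qss nps)
    ultimately have n'S: "n' \<in> smooth_upto x a b" by (simp add: smooth_upto_iff)
    have "q dvd n'" if "q \<in> set qs" for q
    proof -
      have "q dvd prod_list qs" using that by (induction qs) auto
      thus ?thesis by (simp add: n'_def)
    qed
    hence "qs \<in> QS' n'" using qs by (auto simp: QS_def QS'_def)
    moreover have "f \<in> FS' n'" using f by (simp add: FS'_def n'_def)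
    moreover have "ps \<in> PS'" using ps by (auto simp: PS_def PS'_def)
    ultimately show "B \<in> Om'" using n'S by (simp add: A g_def Om'_def n'_def)
  qed
  have finOm': "finite Om'"
    unfolding Om'_def by (intro finite_SigmaI fin finF') (auto simp: smooth_upto_iff smooth_set_pos)
  have le: "real (card Om) \<le> real (card Om')" using card_inj_on_le[OF inj sub finOm'] by simp
  have lb: "b > 1" "ln b > 0" using b by auto
  have "real (card Om) = (\<Sum>n\<in>X. \<Sum>ps\<in>PS n. \<Sum>qs\<in>QS. real (card (FS qs)))"
    unfolding Om_def using fin by (simp add: card_SigmaI)
  also have "\<dots> \<ge> (\<Sum>n\<in>X. \<Sum>ps\<in>PS n. \<Sum>qs\<in>QS. c / (2 * ln b) * G qs)"
  proof (intro sum_mono)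
    fix qs assume qs: "qs \<in> QS"
    have "max 2 (4 / c * a) \<le> G qs"
    proof -
      have "max 2 (4 / c * a) * real (prod_list qs) \<le> max 2 (4 / c * a) * u ^ r" using QS_le[OF qs] by (intro mult_left_mono) auto
      also have "\<dots> \<le> (b / z) ^ r" by (rule F(2))
      finally show ?thesis using QS_pos[OF qs] pos_le_divide_eq[of "real (prod_list qs)"]
        unfolding G_def by simp
    qed
    hence "c / 2 * G qs \<le> (\<Sum>f\<in>FS qs. ln (real f))" unfolding FS_def by (intro rough_theta_ge) auto
    also have "\<dots> \<le> (\<Sum>f\<in>FS qs. ln b)"
    proof (intro sum_mono)
      fix f assume f: "f \<in> FS qs"
      have "G qs \<le> (b / z) ^ r / v ^ r"
        unfolding G_def using QS_le[OF qs] bz v by (intro divide_left_mono) (auto intro!: mult_pos_pos intro: less_le_trans[of _ "v ^ r"])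
      also have "\<dots> \<le> b" by (simp only: pos_divide_le_eq[OF v0] F(1))
      finally show "ln (real f) \<le> ln b" using f b by (subst ln_le_cancel_iff) (auto simp: FS_def prime_gt_0_nat)
    qed
    finally show "c / (2 * ln b) * G qs \<le> real (card (FS qs))" using lb by (simp add: field_simps)
  qed
  also have "(\<Sum>n\<in>X. \<Sum>ps\<in>PS n. \<Sum>qs\<in>QS. c / (2 * ln b) * G qs) = 
      (\<Sum>n\<in>X. real (card (PS n)) * (c / (2 * ln b) * (b / z) ^ r * (\<Sum>p\<in>W. 1 / real p) ^ r))"
  proof -
    have "(\<Sum>qs\<in>QS. c / (2 * ln b) * G qs) = c / (2 * ln b) * (b / z) ^ r * (\<Sum>qs\<in>QS. prod_list (map (\<lambda>p. 1 / real p) qs))"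
      by (simp add: G_def prod_list_inverse sum_distrib_left)
    also have "(\<Sum>qs\<in>QS. prod_list (map (\<lambda>p. 1 / real p) qs)) = (\<Sum>p\<in>W. 1 / real p) ^ r"
      unfolding QS_def by (rule sum_lists_prod[OF W(1)])
    finally show ?thesis by simp
  qed
  finally have 1: "(\<Sum>n\<in>X. real (card (PS n)) * (c / (2 * ln b) * (b / z) ^ r * (\<Sum>p\<in>W. 1 / real p) ^ r)) \<le> real (card Om)" .
  define H where "H = c / (2 * ln b) * (b / z) ^ r * (\<Sum>p\<in>W. 1 / real p) ^ r"
  have H: "H \<ge> 0" unfolding H_def using c_pos lb bz z by (intro mult_nonneg_nonneg zero_le_power sum_nonneg) auto
  have "real (card X) * (real k / 2) ^ r * H = (\<Sum>n\<in>X. (real k / 2) ^ r * H)" by simp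
  also have "\<dots> \<le> (\<Sum>n\<in>X. real (card (PS n)) * H)"
  proof (intro sum_mono mult_right_mono H)
    fix n assume n: "n \<in> X"
    define t where "t = card {p \<in> T. p dvd n}"
    have t: "t \<ge> k" using n by (simp add: X_def t_def)
    have "card (PS n) = \<Prod>{t - r + 1..t}"
      unfolding PS_def t_def using T(1) t k by (intro card_lists_distinct_length_eq) (auto simp: t_def)
    hence "real (card (PS n)) = (\<Prod>i\<in>{t - r + 1..t}. real i)" by simp
    \<comment> \<open>As \<open>2 * r \<le> k \<le> t\<close>, each of the \<open>r\<close> factors
      exceeds \<open>t - r \<ge> k / 2\<close>.\<close>
    also have "\<dots> \<ge> (\<Prod>i\<in>{t - r + 1..t}. real k / 2)"
    proof (intro prod_mono conjI)
      fix i assume "i \<in> {t - r + 1..t}"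
      hence "i + r \<ge> k" using t by auto
      thus "real k / 2 \<le> real i" using k by linarith
    qed auto
    also have "(\<Prod>i\<in>{t - r + 1..t}. real k / 2) = (real k / 2) ^ r" using t k by simp
    finally show "(real k / 2) ^ r \<le> real (card (PS n))" .
  qed
  also have "\<dots> \<le> real (card Om')" using 1 le by (simp add: H_def)
  also have "real (card Om') = (\<Sum>n\<in>smooth_upto x a b. real (card PS') * (real (card (QS' n)) * real (card (FS' n))))"
    unfolding Om'_def using fin finF' by (subst card_SigmaI) (auto simp: card_SigmaI smooth_upto_iff smooth_set_pos intro!: finite_SigmaI sum.cong)
  also have "\<dots> \<le> (\<Sum>n\<in>smooth_upto x a b. real (card T) ^ r * ((L / ln v) ^ r * (L / ln 2)))"
  proof (intro sum_mono mult_mono)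
    fix n assume n: "n \<in> smooth_upto x a b"
    hence n0: "n > 0" "real n \<le> exp L" using xL by (auto simp: smooth_upto_iff smooth_set_pos)
    show "real (card PS') \<le> real (card T) ^ r" by (simp add: PS'_def card_lists_length_eq[OF T(1)])
    have "real (card {p \<in> W. p dvd n}) \<le> L / ln v"
      using W n0 v by (intro card_prime_divisors_le) auto
    hence "real (card {p \<in> W. p dvd n}) ^ r \<le> (L / ln v) ^ r" by (intro power_mono) auto
    thus "real (card (QS' n)) \<le> (L / ln v) ^ r" using W(1) by (simp add: QS'_def card_lists_length_eq)
    have "real (card {p \<in> FS' n. p dvd n}) \<le> L / ln 2"
      using finF'[OF n0(1)] n0 prime_ge_2_nat by (intro card_prime_divisors_le) (auto simp: FS'_def)
    thus "real (card (FS' n)) \<le> L / ln 2" by (simp add: FS'_def)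
    have "n \<ge> 1" using n0 by simp
    hence "1 \<le> exp L" using n0 by linarith
    thus "0 \<le> (L / ln v) ^ r" using v by simp
  qed auto
  also have "\<dots> = Psi a b x * (real (card T) * (L / ln v)) ^ r * (L / ln 2)"
    unfolding power_mult_distrib Psi_def by (simp only: sum_constant mult.assoc)
  finally show ?thesis by (simp add: X_def H_def mult_ac)
qed

text \<open>A window of ratio \<open>4 / c\<close> ending at \<open>t\<close> keeps a weight of at
  least \<open>c * t / 2\<close>, by the halving of \<open>rough_theta_ge\<close>; division by
  \<open>p * ln p \<le> t * ln b\<close> turns weights into reciprocals. Adding adjacent windows
  then gives a weak form of Mertens' theorem.\<close>

lemma (in chebyshev) sum_recip_primes_step:
  assumes "2 \<le> t" "t \<le> b"
  shows "(\<Sum>p | prime p \<and> t / (4 / c) < real p \<and> real p \<le> t. 1 / real p) \<ge> c / (2 * ln b)"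
proof -
  let ?W = "{p. prime p \<and> t / (4 / c) < real p \<and> real p \<le> t}"
  let ?T = "{p. prime p \<and> real p \<le> t}"
  have nn: "ln (real p) \<ge> 0" if "prime p" for p using that by (simp add: prime_gt_0_nat Suc_leI)
  have fin: "finite (?T - ?W)" "finite ?W" "finite ?T"
    using finite_le_real[of prime t] by (auto intro: finite_subset[rotated])
  have "c * t \<le> theta t" by (rule theta_lower) fact
  also have "theta t = (\<Sum>p\<in>?T - ?W. ln (real p)) + (\<Sum>p\<in>?W. ln (real p))"
    unfolding theta_def using fin by (intro sum.subset_diff) auto
  also have "(\<Sum>p\<in>?T - ?W. ln (real p)) \<le> theta (t / (4 / c))"
    unfolding theta_def
  proof (rule sum_mono2)
    show "finite {p. prime p \<and> real p \<le> t / (4 / c)}" by (rule finite_le_real)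
    show "?T - ?W \<subseteq> {p. prime p \<and> real p \<le> t / (4 / c)}" by (auto simp only: not_less)
  qed (use nn in blast)
  also have "\<dots> \<le> 2 * (t / (4 / c))" using c_pos assms by (intro theta_le) auto
  also have "\<dots> = c * t / 2" using c_pos by simp
  finally have 1: "c * t / 2 \<le> (\<Sum>p\<in>?W. ln (real p))" by simp
  also have "\<dots> \<le> (\<Sum>p\<in>?W. (t * ln b) * (1 / real p))"
  proof (rule sum_mono)
    fix p assume p: "p \<in> ?W"
    hence p0: "real p > 0" by (auto simp: prime_gt_0_nat)
    have "real p * ln (real p) \<le> t * ln b" using p p0 assms nn[of p] by (intro mult_mono) auto
    thus "ln (real p) \<le> (t * ln b) * (1 / real p)" using p0 by (simp add: field_simps)
  qed
  also have "\<dots> = (t * ln b) * (\<Sum>p\<in>?W. 1 / real p)" by (simp only: sum_distrib_left)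
  finally show ?thesis using assms by (simp add: field_simps)
qed

lemma (in chebyshev) sum_recip_primes:
  assumes "t \<le> b" "t / (4 / c) ^ i \<ge> 2" 
  shows "(\<Sum>p | prime p \<and> t / (4 / c) ^ i < real p \<and> real p \<le> t. 1 / real p) \<ge> real i * (c / (2 * ln b))"
  using assms(2)
proof (induction i)
  case 0
  thus ?case by (auto intro!: sum_nonneg)
next
  case (Suc i)
  have c4: "4 / c \<ge> 2" using c_le c_pos by (simp add: field_simps)
  have "(4 / c) ^ Suc i > 0" using c_pos by simp
  moreover have "t / (4 / c) ^ Suc i > 0" using Suc.prems by linarith
  ultimately have t0: "t \<ge> 0" by (auto simp only: zero_less_divide_iff)
  define t' where "t' = t / (4 / c) ^ i"
  have t'2: "t / (4 / c) ^ Suc i = t' / (4 / c)" by (simp add: t'_def)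
  have t'0: "t' \<ge> 0" using t0 c_pos by (simp add: t'_def)
  have "t' / (4 / c) \<le> t' / 1" using c4 t'0 c_pos c_le by (intro divide_left_mono) auto
  hence t'': "t' \<ge> 2" using Suc.prems unfolding t'2 by linarith
  have "1 \<le> (4 / c) ^ i" using c4 by (intro one_le_power) auto
  hence "t' \<le> t / 1" unfolding t'_def using t0 by (intro divide_left_mono) auto
  hence t'b: "t' \<le> b" "t' \<le> t" using assms by auto
  let ?A = "{p. prime p \<and> t' / (4 / c) < real p \<and> real p \<le> t'}"
  let ?B = "{p. prime p \<and> t' < real p \<and> real p \<le> t}"
  have fin: "finite ?A" "finite ?B" 
    using finite_le_real[of prime t'] finite_le_real[of prime t] by (auto intro: finite_subset[rotated])
  have "t' / (4 / c) \<le> t' / 1" using c4 t'0 c_pos c_le by (intro divide_left_mono) auto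
  hence eq: "{p. prime p \<and> t / (4 / c) ^ Suc i < real p \<and> real p \<le> t} = ?A \<union> ?B"
    unfolding t'2 using t'b by auto
  have "(\<Sum>p\<in>?A \<union> ?B. 1 / real p) = (\<Sum>p\<in>?A. 1 / real p) + (\<Sum>p\<in>?B. 1 / real p)"
    using fin by (intro sum.union_disjoint) auto
  moreover have "(\<Sum>p\<in>?A. 1 / real p) \<ge> c / (2 * ln b)" by (rule sum_recip_primes_step[OF t'' t'b(1)])
  moreover have "(\<Sum>p\<in>?B. 1 / real p) \<ge> real i * (c / (2 * ln b))" using Suc.IH t'' by (simp add: t'_def)
  moreover have "real (Suc i) * (c / (2 * ln b)) = c / (2 * ln b) + real i * (c / (2 * ln b))"
    by (simp only: of_nat_Suc distrib_right mult_1_left add.commute)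
  ultimately show ?case unfolding eq by linarith
qed

text \<open>Every prime \<open>p \<le> b / z\<close> may be replaced by about \<open>z * p\<close> primes below \<open>z * p\<close>, which
  stay inside \<open>[a, b]\<close>.\<close>

lemma (in chebyshev) Psi_growth:
  fixes a b x L :: real
  defines "z \<equiv> 160 / c"
  assumes x: "x \<ge> 1" and L: "ln x = L" "ln (z * x) \<le> 2 * L" and w: "w \<ge> 2" "w \<ge> 4 / c * a" and b: "b > 0"
    and G: "G \<subseteq> smooth_upto x a b" "real (card G) \<ge> Psi a b x / 4"
      "\<And>n. n \<in> G \<Longrightarrow> (\<Sum>p | prime p \<and> a \<le> real p \<and> w < real p \<and> real p \<le> b / z \<and> p dvd n. ln (real p)) \<ge> 2 / 5 * L"
  shows "Psi a b x \<le> Psi a b (z * x) / 2"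
proof -
  have z: "z \<ge> 80" using c_le c_pos by (simp add: z_def field_simps)
  have L0: "L \<ge> 0" using x L by auto
  define Q where "Q = {p. prime p \<and> a \<le> real p \<and> w < real p \<and> real p \<le> b / z}"
  define Q' where "Q' = {p. prime p \<and> a \<le> real p \<and> real p \<le> b}"
  have finQ: "finite Q" "finite Q'" unfolding Q_def Q'_def
    using finite_le_real[of prime b] finite_le_real[of prime "b / z"] by (auto intro: finite_subset[rotated])
  have bz: "b / z \<le> b" using z b by (simp add: field_simps)
  have Qs: "p \<in> smooth_set a b" if "p \<in> Q" for p
    using that bz by (intro prime_in_smooth_set) (auto simp: Q_def)
  have Qp: "p > 0" if "p \<in> Q" for p using that by (auto simp: Q_def prime_gt_0_nat)
  have Qp': "p > 0" if "p \<in> Q'" for p using that by (auto simp: Q'_def prime_gt_0_nat)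
  \<comment> \<open>\<open>h m\<close> limits the primes up to \<open>b / z\<close> that can be
    attached to \<open>m\<close> below \<open>x\<close>. For primes up to \<open>b\<close> and
    products below \<open>z * x\<close> the limit becomes exactly \<open>z * h m\<close>.\<close>
  define h where "h = (\<lambda>m::nat. min (b / z) (x / real m))"
  define M where "M = {m \<in> smooth_upto x a b. h m > w}"
  have "1 / 10 * L * Psi a b x \<le> 2 / 5 * L * real (card G)" using mult_left_mono[OF G(2) L0] by simp
  also have "\<dots> = (\<Sum>n\<in>G. 2 / 5 * L)" by simp
  also have "\<dots> \<le> (\<Sum>n\<in>G. \<Sum>p | p \<in> Q \<and> p dvd n. ln (real p))"
    using G(3) by (intro sum_mono) (auto simp: Q_def conj_ac)
  also have "\<dots> \<le> (\<Sum>n\<in>smooth_upto x a b. \<Sum>p | p \<in> Q \<and> p dvd n. ln (real p))"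
    using G(1) Qp by (intro sum_mono2 sum_nonneg) (auto simp: Suc_leI)
  also have "\<dots> = (\<Sum>p\<in>Q. ln (real p) * Psi a b (x / real p))" by (rule sum_over_prime_divisors[OF finQ(1) Qs])
  also have "\<dots> = (\<Sum>m\<in>smooth_upto x a b. \<Sum>p | p \<in> Q \<and> real p \<le> x / real m. ln (real p))"
    by (rule sum_over_cofactors[OF finQ(1) Qp])
  also have "\<dots> \<le> (\<Sum>m\<in>smooth_upto x a b. if h m > w then 2 * h m else 0)"
  proof (rule sum_mono)
    fix m assume m: "m \<in> smooth_upto x a b"
    show "(\<Sum>p | p \<in> Q \<and> real p \<le> x / real m. ln (real p)) \<le> (if h m > w then 2 * h m else 0)"
    proof (cases "h m > w")
      case True
      have "(\<Sum>p | p \<in> Q \<and> real p \<le> x / real m. ln (real p)) \<le> (\<Sum>p | prime p \<and> a \<le> real p \<and> real p \<le> h m. ln (real p))"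
        using finite_le_real[of "\<lambda>p. prime p \<and> a \<le> real p" "h m"]
        by (intro sum_mono2) (auto simp: Q_def h_def conj_assoc prime_gt_0_nat Suc_leI)
      also have "\<dots> \<le> 2 * h m" using True w by (intro rough_theta_le) auto
      finally show ?thesis using True by simp
    next
      case False
      hence eq: "{p. p \<in> Q \<and> real p \<le> x / real m} = {}" by (auto simp: Q_def h_def min_def split: if_splits)
      show ?thesis unfolding eq using False by simp
    qed
  qed
  also have "\<dots> = (\<Sum>m\<in>M. 2 * h m)" unfolding M_def by (simp add: sum.If_cases Int_def)
  finally have 1: "1 / 10 * L * Psi a b x \<le> 2 * (\<Sum>m\<in>M. h m)" by (simp add: sum_distrib_left)
  have "c / 2 * z * (\<Sum>m\<in>M. h m) = (\<Sum>m\<in>M. c / 2 * (z * h m))" by (simp only: sum_distrib_left mult.assoc)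
  also have "\<dots> \<le> (\<Sum>m\<in>M. \<Sum>p | p \<in> Q' \<and> real p \<le> z * x / real m. ln (real p))"
  proof (rule sum_mono)
    fix m assume m: "m \<in> M"
    have hm: "h m > w" using m by (simp add: M_def)
    have "1 * h m \<le> z * h m" using hm w z by (intro mult_right_mono) auto
    hence zh: "z * h m > w" using hm by simp
    have "c / 2 * (z * h m) \<le> (\<Sum>p | prime p \<and> a \<le> real p \<and> real p \<le> z * h m. ln (real p))"
      using zh w by (intro rough_theta_ge) linarith+
    also have eq: "z * h m = min b (z * x / real m)" using z by (simp add: h_def min_mult_distrib_left)
    also have "{p. prime p \<and> a \<le> real p \<and> real p \<le> min b (z * x / real m)} = {p. p \<in> Q' \<and> real p \<le> z * x / real m}"
      by (auto simp: Q'_def)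
    finally show "c / 2 * (z * h m) \<le> (\<Sum>p | p \<in> Q' \<and> real p \<le> z * x / real m. ln (real p))" unfolding eq .
  qed
  also have "\<dots> \<le> (\<Sum>m\<in>smooth_upto (z * x) a b. \<Sum>p | p \<in> Q' \<and> real p \<le> z * x / real m. ln (real p))"
  proof (intro sum_mono2 sum_nonneg)
    have "x \<le> z * x" using z x by simp
    thus "M \<subseteq> smooth_upto (z * x) a b" by (auto simp: M_def smooth_upto_iff)
  qed (use Qp' in \<open>auto simp: Suc_leI\<close>)
  also have "\<dots> = (\<Sum>p\<in>Q'. ln (real p) * Psi a b (z * x / real p))" by (rule sum_over_cofactors[OF finQ(2) Qp', symmetric])
  also have "\<dots> \<le> Psi a b (z * x) * (2 * L)"
  proof (rule sum_ln_primes_Psi_le[OF finQ(2)])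
    have "z * x = exp (ln (z * x))" using z x by simp
    also have "\<dots> \<le> exp (2 * L)" using L(2) by (subst exp_le_cancel_iff)
    finally show "z * x \<le> exp (2 * L)" .
  qed (use L0 in \<open>auto simp: Q'_def\<close>)
  \<comment> \<open>With \<open>z = 160 / c\<close> the factor \<open>c / 2 * z\<close> is 80. Fact
    \<open>1\<close> bounds \<open>L * Psi a b x\<close> by 20 times the same sum, so
    \<open>4 * L * Psi a b x \<le> 2 * L * Psi a b (z * x)\<close>.\<close>
  finally have 2: "80 * (\<Sum>m\<in>M. h m) \<le> Psi a b (z * x) * (2 * L)" using c_pos by (simp add: z_def)
  have "L > 0"
  proof (rule ccontr)
    assume "\<not> L > 0"
    hence "L = 0" using L0 by simp
    moreover have "ln (z * x) > ln x" using z x by (subst ln_less_cancel_iff) auto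
    ultimately show False using L by simp
  qed
  moreover from 1 2 have "L * Psi a b x \<le> L * (Psi a b (z * x) / 2)" by simp
  ultimately show ?thesis by simp
qed

text \<open>The typical shape: the distinct primes above \<open>w\<close> make up all of
  \<open>n\<close> but a factor below \<open>x powr (1/10)\<close>, hence multiply to more than
  \<open>x powr (8/10)\<close>. Squares of large primes are excluded because sums over prime
  divisors see each prime only once.\<close>

definition regular :: "real \<Rightarrow> real \<Rightarrow> real \<Rightarrow> nat \<Rightarrow> bool" where
  "regular a w x n \<longleftrightarrow> real n \<ge> x powr (9/10) \<and>
     (\<forall>d. d dvd n \<and> d \<in> smooth_set a w \<longrightarrow> real d < x powr (1/10)) \<and>
     (\<forall>p. prime p \<and> real p > w \<longrightarrow> \<not> p\<^sup>2 dvd n)"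

lemma sum_inverse_squares_le:
  assumes "finite P" "\<And>p. p \<in> P \<Longrightarrow> real p > w" "w \<ge> 2"
  shows "(\<Sum>p\<in>P. 1 / (real p)\<^sup>2) \<le> 2 / w"
proof -
  define m where "m = nat \<lfloor>w\<rfloor>"
  have m: "m \<ge> 1" "real m \<ge> w / 2" "\<And>p. real p > w \<Longrightarrow> p > m" using assms(3) unfolding m_def by linarith+
  have tel: "(\<Sum>n=Suc m..M. 1 / (real n)\<^sup>2) \<le> 1 / real m - 1 / real M" if "M \<ge> m" for M
    using that
  proof (induction M rule: dec_induct)
    case (step M)
    have "1 / (real (Suc M))\<^sup>2 \<le> 1 / (real M * real (Suc M))"
      using step m by (intro divide_left_mono) (auto simp: power2_eq_square intro!: mult_right_mono)
    also have "\<dots> = 1 / real M - 1 / real (Suc M)" using step m by (simp add: field_simps)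
    finally show ?case using step by simp
  qed simp
  define M where "M = Max (insert m P)"
  have M: "M \<ge> m" "\<And>p. p \<in> P \<Longrightarrow> p \<le> M" using assms(1) by (auto simp: M_def)
  have "(\<Sum>p\<in>P. 1 / (real p)\<^sup>2) \<le> (\<Sum>n=Suc m..M. 1 / (real n)\<^sup>2)"
    using m(3) assms M by (intro sum_mono2) (auto simp: Suc_le_eq)
  also have "\<dots> \<le> 1 / real m - 1 / real M" by (rule tel[OF M(1)])
  also have "\<dots> \<le> 1 / real m" by simp
  also have "\<dots> \<le> 1 / (w / 2)" using m assms(3) by (intro divide_left_mono) auto
  finally show ?thesis by simp
qed

text \<open>Integers below \<open>x powr (9/10)\<close> are rare by \<open>Psi_div_le_powr\<close>,
  and large divisors built from small primes are rare by Rankin's trick. For a square,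
  \<open>Psi_div_le\<close> is applied twice with \<open>t = p\<close>, which gains
  \<open>(2 * L / (c * p))\<^sup>2\<close>; the sum of this over \<open>p > w\<close> is of order
  \<open>L\<^sup>2 / w\<close>.\<close>

lemma (in chebyshev) card_irregular:
  assumes t: "t \<ge> 2" "t \<ge> 4 / c * a" "t \<le> b" and x: "x \<le> exp L" "x \<ge> 1" "L \<ge> 0" 
    and s: "L / (c / 2 * t) \<le> t powr (-s)" "s \<le> 1" and s': "1 / 2 \<le> s'" "s' \<le> s" 
    and w: "w \<ge> 2" "w \<ge> 4 / c * a"
  shows "real (card {n \<in> smooth_upto x a b. \<not> regular a w x n})
    \<le> (2 * t * x powr (- (s - s') / 10) * exp (4 * (w powr (1 - s') * (1 + ln w))) + 8 * L\<^sup>2 / (c\<^sup>2 * w)) * Psi a b x"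
proof -
  define E where "E = exp (4 * (w powr (1 - s') * (1 + ln w)))"
  define X1 where "X1 = {n \<in> smooth_upto x a b. real n < x powr (9/10)}"
  define X2 where "X2 = {n \<in> smooth_upto x a b. \<exists>d. d dvd n \<and> d \<in> smooth_set a w \<and> real d \<ge> x powr (1/10)}"
  define X3 where "X3 = {n \<in> smooth_upto x a b. \<exists>p. prime p \<and> real p > w \<and> p\<^sup>2 dvd n}"
  have fin: "finite X1" "finite X2" "finite X3" by (auto simp: X1_def X2_def X3_def)
  have "{n \<in> smooth_upto x a b. \<not> regular a w x n} \<subseteq> X1 \<union> X2 \<union> X3"
    by (auto simp: regular_def X1_def X2_def X3_def not_less)
  hence "card {n \<in> smooth_upto x a b. \<not> regular a w x n} \<le> card (X1 \<union> X2 \<union> X3)"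
    using fin by (intro card_mono) auto
  also have "\<dots> \<le> card X1 + card X2 + card X3" using card_Un_le[of "X1 \<union> X2" X3] card_Un_le[of X1 X2] by linarith
  finally have tot: "real (card {n \<in> smooth_upto x a b. \<not> regular a w x n}) \<le> real (card X1) + real (card X2) + real (card X3)" by simp
  have E1: "E \<ge> 1" unfolding E_def using w by simp
  have "real (card X1) \<le> Psi a b (x powr (9/10))"
    unfolding Psi_def X1_def by (auto intro!: card_mono simp: smooth_upto_iff)
  also have "x powr (9/10) = x / x powr (1/10)" using x powr_diff[of x 1 "1/10"] by simp
  also have "Psi a b (x / x powr (1/10)) \<le> t * (x powr (1/10)) powr (-s) * Psi a b x"
    using x s s' by (intro Psi_div_le_powr[OF t]) (auto intro: ge_one_powr_ge_zero)
  also have "(x powr (1/10)) powr (-s) = x powr (- s / 10)" by (simp add: powr_powr)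
  also have "x powr (- s / 10) \<le> x powr (- (s - s') / 10)" using x s' by (intro powr_mono) auto
  also have "x powr (- (s - s') / 10) \<le> x powr (- (s - s') / 10) * E" using E1 by (simp add: mult_le_cancel_left1)
  finally have c1: "real (card X1) \<le> t * (x powr (- (s - s') / 10) * E) * Psi a b x"
    using t by (simp add: mult_left_mono mult_right_mono)
  have "real (card X2) \<le> t * (x powr (1/10)) powr (- (s - s')) * E * Psi a b x"
    unfolding X2_def E_def using x s s' w by (intro card_large_smooth_divisor[OF t]) (auto intro: ge_one_powr_ge_zero)
  also have "(x powr (1/10)) powr (- (s - s')) = x powr (- (s - s') / 10)" by (simp add: powr_powr)
  finally have c2: "real (card X2) \<le> t * (x powr (- (s - s') / 10) * E) * Psi a b x" by (simp add: mult_ac)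
  define P where "P = {p. prime p \<and> w < real p \<and> real p \<le> b}"
  have finP: "finite P" unfolding P_def using finite_le_real[of prime b] by (auto intro: finite_subset[rotated])
  have "X3 \<subseteq> (\<Union>p\<in>P. {n \<in> smooth_upto x a b. p\<^sup>2 dvd n})"
  proof
    fix n assume "n \<in> X3"
    then obtain p where p: "n \<in> smooth_upto x a b" "prime p" "real p > w" "p\<^sup>2 dvd n" by (auto simp: X3_def)
    have "p dvd n" using p(4) by (rule dvd_trans[rotated]) simp
    hence "real p \<le> b" using p prime_dvd_smooth by (auto simp: smooth_upto_iff)
    thus "n \<in> (\<Union>p\<in>P. {n \<in> smooth_upto x a b. p\<^sup>2 dvd n})" using p by (auto simp: P_def)
  qed
  hence "card X3 \<le> card (\<Union>p\<in>P. {n \<in> smooth_upto x a b. p\<^sup>2 dvd n})" using finP by (intro card_mono) auto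
  also have "\<dots> \<le> (\<Sum>p\<in>P. card {n \<in> smooth_upto x a b. p\<^sup>2 dvd n})" by (rule card_UN_le[OF finP])
  finally have "real (card X3) \<le> real (\<Sum>p\<in>P. card {n \<in> smooth_upto x a b. p\<^sup>2 dvd n})" by (simp only: of_nat_le_iff)
  also have "\<dots> \<le> (\<Sum>p\<in>P. (4 * L\<^sup>2 / c\<^sup>2 * Psi a b x) * (1 / (real p)\<^sup>2))"
    unfolding of_nat_sum
  proof (rule sum_mono)
    fix p assume p: "p \<in> P"
    have p2: "real p \<ge> 2" "real p \<ge> 4 / c * a" "real p \<le> b" using p w by (auto simp: P_def)
    have "x / real p \<le> x" using x p2 by (simp add: field_simps mult_le_cancel_left1)
    hence xp: "x / real p \<le> exp L" using x by linarith
    have "real (card {n \<in> smooth_upto x a b. p\<^sup>2 dvd n}) \<le> Psi a b (x / real (p\<^sup>2))"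
      using p2 by (intro card_smooth_multiples) auto
    also have "x / real (p\<^sup>2) = x / real p / real p" by (simp add: power2_eq_square)
    also have "Psi a b (x / real p / real p) \<le> Psi a b (x / real p) * (2 * L / (c * real p))"
      using Psi_div_le[OF p2 xp x(3)] c_pos p2 by (simp add: field_simps)
    also have "\<dots> \<le> Psi a b x * (2 * L / (c * real p)) * (2 * L / (c * real p))"
      using Psi_div_le[OF p2 x(1,3)] c_pos p2 x by (intro mult_right_mono) (simp_all add: field_simps)
    also have "\<dots> = (4 * L\<^sup>2 / c\<^sup>2 * Psi a b x) * (1 / (real p)\<^sup>2)" by (simp add: power2_eq_square mult_ac)
    finally show "real (card {n \<in> smooth_upto x a b. p\<^sup>2 dvd n}) \<le> (4 * L\<^sup>2 / c\<^sup>2 * Psi a b x) * (1 / (real p)\<^sup>2)" .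
  qed
  also have "\<dots> = (4 * L\<^sup>2 / c\<^sup>2 * Psi a b x) * (\<Sum>p\<in>P. 1 / (real p)\<^sup>2)" by (simp only: sum_distrib_left)
  also have "\<dots> \<le> (4 * L\<^sup>2 / c\<^sup>2 * Psi a b x) * (2 / w)"
    using w finP by (intro mult_left_mono sum_inverse_squares_le) (auto simp: P_def)
  finally have c3: "real (card X3) \<le> 8 * L\<^sup>2 / (c\<^sup>2 * w) * Psi a b x" by simp
  show ?thesis using tot c1 c2 c3 unfolding E_def[symmetric] by (simp add: algebra_simps)
qed

text \<open>A prime above \<open>w\<close> dividing the cofactor would divide \<open>n\<close>
  twice. So the cofactor has only primes up to \<open>w\<close>, and \<open>regular\<close> bounds
  it.\<close>

lemma regular_decomposition:
  fixes a w x :: real and n :: nat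
  assumes n: "n \<in> smooth_set a b" and reg: "regular a w x n"
  defines "P \<equiv> {p. prime p \<and> p dvd n \<and> real p > w}"
  shows "\<Prod>P dvd n" "real (n div \<Prod>P) < x powr (1/10)" "finite P"
proof -
  have n0: "n > 0" using n by (rule smooth_set_pos)
  show fin: "finite P" unfolding P_def using n0 by (intro finite_subset[OF _ finite_divisors_nat[of n]]) auto
  show dvd: "\<Prod>P dvd n" using fin by (intro prod_primes_dvd) (auto simp: P_def)
  define d where "d = n div \<Prod>P"
  have nd: "n = \<Prod>P * d" using dvd by (simp add: d_def)
  hence d_dvd: "d dvd n" by simp
  have "real p \<le> w" if p: "prime p" "p dvd d" for p
  proof (rule ccontr)
    assume *: "\<not> real p \<le> w"
    have "p dvd n" using p d_dvd by (rule_tac dvd_trans)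
    with * p have "p \<in> P" by (simp add: P_def)
    hence "p dvd \<Prod>P" using fin by (rule_tac dvd_prodI)
    hence "p * p dvd n" unfolding nd using p by (intro mult_dvd_mono)
    with reg p * show False by (auto simp: regular_def power2_eq_square)
  qed
  moreover have "d \<in> smooth_set a b" using n d_dvd by (rule smooth_set_dvd)
  ultimately have "d \<in> smooth_set a w" by (auto simp: smooth_set_def)
  thus "real (n div \<Prod>P) < x powr (1/10)" using reg d_dvd by (simp add: regular_def d_def)
qed

text \<open>The exchange pays because the primes within a factor \<open>z\<close> of
  \<open>b\<close> have a reciprocal sum of order \<open>1 / ln b\<close>, while those between
  \<open>v\<close> and \<open>u\<close> reach order \<open>1 / r\<close>. Each exchanged prime gains
  \<open>\<kappa> * ln b / r\<close>, and \<open>big\<close> asks that \<open>r\<close> such gains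
  outweigh the logarithms lost on the filling prime.\<close>

lemma (in chebyshev) few_top_primes:
  fixes a b x z :: real and r k :: nat
  defines "B \<equiv> 4 / c"
  defines "\<kappa> \<equiv> c / (960 * z * ln B)"
  assumes r: "r \<ge> 4" "2 * r \<le> k" and k: "real k \<ge> 2 / 5 * ln x / ln b" and x: "x > 1"
    and z: "z \<ge> 1" "z\<^sup>2 \<le> b" "max 2 (4 / c * a) * z ^ r \<le> b powr (8/9)"
    and b: "a \<le> b powr (3/4)" "2 \<le> b powr (3/4)" "b > 1" "ln b / (9 * real r) \<ge> ln B"
    and big: "(\<kappa> * ln b / real r) ^ r \<ge> 16 * ln b * ln x / c"
  shows "real (card {n \<in> smooth_upto x a b. card {p. prime p \<and> a \<le> real p \<and> b / z \<le> real p \<and> real p \<le> b \<and> p dvd n} \<ge> k}) \<le> Psi a b x / 4"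
proof -
  define l L where "l = ln b" and "L = ln x"
  have B: "B \<ge> 2" using c_le c_pos by (simp add: B_def field_simps)
  have lB: "ln B > 0" using B by simp
  have l: "l > 0" using b by (simp add: l_def)
  have L: "L > 0" using x by (simp add: L_def)
  have r0: "real r \<ge> 4" using r by simp
  define T where "T = {p. prime p \<and> a \<le> real p \<and> b / z \<le> real p \<and> real p \<le> b}"
  \<comment> \<open>Chosen so that \<open>b * v ^ r = b ^ r\<close> and
    \<open>u ^ r = b ^ r * b powr (-(8/9))\<close>: up to the factor \<open>z ^ r\<close>, the room
    for the filling prime lies between \<open>b powr (8/9)\<close> and \<open>b\<close>. The window
    from \<open>v\<close> to \<open>u\<close> has logarithmic length
    \<open>J / 8 = l / (9 * r)\<close>.\<close>
  define J where "J = 8 * l / (9 * real r)"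
  define u v where "u = b * exp (-J)" and "v = b * exp (- 9 * J / 8)"
  define W where "W = {p. prime p \<and> v < real p \<and> real p \<le> u}"
  have bl: "b = exp l" using b by (simp add: l_def)
  have J9: "9 * J / 8 = l / real r" using r0 by (simp add: J_def)
  have J0: "J > 0" using l r0 by (simp add: J_def)
  have v_ge: "v \<ge> b powr (3/4)"
  proof -
    have "l / real r \<le> l / 4" using r0 l by (intro divide_left_mono) auto
    hence "3 / 4 * l \<le> l + - 9 * J / 8" using J9 by simp
    hence "exp (3 / 4 * l) \<le> exp (l + - 9 * J / 8)" by simp
    thus ?thesis unfolding v_def bl by (simp only: exp_add powr_def, simp)
  qed
  have v: "v > 1" "a \<le> v" "v \<ge> 2" using v_ge b by auto
  have ub: "u \<le> b" using J0 b by (simp add: u_def mult_le_cancel_left1)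
  have u0: "u \<ge> 0" using b by (simp add: u_def)
  have vr: "b * v ^ r = b ^ r"
  proof -
    have "v ^ r = b ^ r * exp (real r * (- 9 * J / 8))" unfolding v_def power_mult_distrib by (simp only: exp_of_nat_mult)
    also have "real r * (- 9 * J / 8) = - l" using J9 r0 by (simp add: field_simps)
    finally show ?thesis by (simp add: bl exp_minus)
  qed
  have ur: "u ^ r = b ^ r * b powr (-(8/9))"
  proof -
    have "u ^ r = b ^ r * exp (real r * (-J))" unfolding u_def power_mult_distrib by (simp only: exp_of_nat_mult)
    also have "real r * (-J) = - (8/9) * l" using r0 by (simp add: J_def field_simps)
    finally show ?thesis using b by (simp add: powr_def l_def)
  qed
  have F1: "(b / z) ^ r \<le> b * v ^ r"
    unfolding vr using z b by (intro power_mono) (auto simp: field_simps mult_le_cancel_left1)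
  have F2: "max 2 (4 / c * a) * u ^ r \<le> (b / z) ^ r"
  proof -
    have zr: "z ^ r > 0" using z by simp
    have "max 2 (4 / c * a) * u ^ r * z ^ r = (max 2 (4 / c * a) * z ^ r) * (b ^ r * b powr (-(8/9)))"
      unfolding ur by (simp only: mult_ac)
    also have "\<dots> \<le> b powr (8/9) * (b ^ r * b powr (-(8/9)))" using z b by (intro mult_right_mono) auto
    also have "\<dots> = b ^ r" using b by (simp add: powr_minus)
    finally show ?thesis using zr by (simp add: power_divide field_simps)
  qed
  have finT: "finite T" unfolding T_def using finite_le_real[of prime b] by (auto intro: finite_subset[rotated])
  have finW: "finite W" unfolding W_def using finite_le_real[of prime u] by (auto intro: finite_subset[rotated])
  have main: "real (card {n \<in> smooth_upto x a b. card {p \<in> T. p dvd n} \<ge> k}) * (real k / 2) ^ r * (c / (2 * ln b)) * (b / z) ^ r * (\<Sum>p\<in>W. 1 / real p) ^ r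
     \<le> Psi a b x * (real (card T) * (L / ln v)) ^ r * (L / ln 2)"
    by (rule card_many_top_primes[where u = u]) (use b z r x finT finW v ub u0 F1 F2 in \<open>auto simp: T_def W_def L_def\<close>)
  have cT: "real (card T) \<le> 4 * b / l"
  proof -
    have "z \<le> sqrt b" using z by (intro real_le_rsqrt) auto
    hence "b / sqrt b \<le> b / z" using z b by (intro divide_left_mono) auto
    moreover have "b / sqrt b = sqrt b" using b by (simp add: real_div_sqrt)
    moreover have "sqrt b = exp (l / 2)" using b by (simp add: l_def powr_half_sqrt[symmetric] powr_def)
    ultimately have "l / 2 \<le> ln (b / z)" using z b by (subst ln_ge_iff) auto
    hence "real (card T) * (l / 2) \<le> real (card T) * ln (b / z)" by (rule mult_left_mono) simp
    also have "\<dots> = (\<Sum>p\<in>T. ln (b / z))" by simp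
    also have "\<dots> \<le> (\<Sum>p\<in>T. ln (real p))"
      using z b by (intro sum_mono) (auto simp: T_def prime_gt_0_nat)
    also have "\<dots> \<le> theta b" unfolding theta_def T_def by (intro sum_mono2) (auto simp: prime_gt_0_nat Suc_leI)
    also have "\<dots> \<le> 2 * b" using b by (intro theta_le) auto
    finally show ?thesis using l by (simp add: field_simps)
  qed
  have lv: "L / ln v \<le> 4 / 3 * L / l"
  proof -
    have "3 / 4 * l = ln (b powr (3/4))" using b by (simp add: l_def ln_powr)
    also have "\<dots> \<le> ln v" using v_ge b by (subst ln_le_cancel_iff) auto
    finally have "L / ln v \<le> L / (3 / 4 * l)" using l L by (intro divide_left_mono) auto
    thus ?thesis by simp
  qed
  define i where "i = nat \<lfloor>J / (8 * ln B)\<rfloor>"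
  have J8: "J / (8 * ln B) \<ge> 1"
  proof -
    have "J / (8 * ln B) = ln b / (9 * real r) / ln B" by (simp add: J_def l_def)
    with b(4) lB show ?thesis by (simp only: pos_le_divide_eq mult_1_left)
  qed
  have i: "real i \<le> J / (8 * ln B)" "real i \<ge> J / (16 * ln B)" 
  proof -
    show "real i \<le> J / (8 * ln B)" unfolding i_def using J8 by (intro of_nat_floor) auto
    have "\<lfloor>J / (8 * ln B)\<rfloor> \<ge> 1" using J8 by (simp add: le_floor_iff)
    hence "real i \<ge> J / (8 * ln B) - 1" "real i \<ge> 1" unfolding i_def by linarith+
    moreover have "J / (16 * ln B) = J / (8 * ln B) / 2" by simp
    ultimately show "real i \<ge> J / (16 * ln B)" by linarith
  qed
  have uB: "v \<le> u / B ^ i"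
  proof -
    have "B ^ i = exp (real i * ln B)" using B by (simp add: exp_of_nat_mult)
    also have "\<dots> \<le> exp (J / 8)" using i(1) lB by (subst exp_le_cancel_iff) (simp add: field_simps)
    finally have "v * B ^ i \<le> v * exp (J / 8)" using v by simp
    also have "\<dots> = b * exp (- 9 * J / 8 + J / 8)" by (simp only: v_def mult.assoc exp_add)
    also have "- 9 * J / 8 + J / 8 = - J" by simp
    finally show ?thesis using B by (simp add: u_def field_simps)
  qed
  have "real i * (c / (2 * l)) \<le> (\<Sum>p | prime p \<and> u / B ^ i < real p \<and> real p \<le> u. 1 / real p)"
    unfolding B_def l_def using uB ub v unfolding B_def by (intro sum_recip_primes) auto
  also have "\<dots> \<le> (\<Sum>p\<in>W. 1 / real p)" using finW uB by (intro sum_mono2) (auto simp: W_def)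
  finally have sW: "real i * (c / (2 * l)) \<le> (\<Sum>p\<in>W. 1 / real p)" .
  define s where "s = l / (18 * real r * ln B) * (c / (2 * l))"
  have s0: "s > 0" unfolding s_def using l r0 lB c_pos by simp
  have "s \<le> real i * (c / (2 * l))" unfolding s_def using i(2) l c_pos by (intro mult_right_mono) (auto simp: J_def)
  with sW have sW: "s \<le> (\<Sum>p\<in>W. 1 / real p)" by simp
  define Xc where "Xc = real (card {n \<in> smooth_upto x a b. card {p \<in> T. p dvd n} \<ge> k})"
  have k5: "real k / 2 \<ge> L / (5 * l)" using k by (simp add: L_def l_def field_simps)
  define D where "D = L / (5 * l) * (b / z) * s"
  have D0: "D > 0" unfolding D_def using L l b z s0 by simp
  have "Xc * (c / (2 * l)) * D ^ r = Xc * (L / (5 * l)) ^ r * (c / (2 * l)) * (b / z) ^ r * s ^ r"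
    unfolding D_def power_mult_distrib by (simp only: mult_ac)
  also have "\<dots> \<le> Xc * (real k / 2) ^ r * (c / (2 * ln b)) * (b / z) ^ r * (\<Sum>p\<in>W. 1 / real p) ^ r"
    unfolding l_def[symmetric] using k5 sW s0 L l c_pos b z
    by (intro mult_mono power_mono order_refl mult_nonneg_nonneg zero_le_power) (auto simp: Xc_def intro: order_trans[OF less_imp_le])
  also have "\<dots> \<le> Psi a b x * (real (card T) * (L / ln v)) ^ r * (L / ln 2)" using main by (simp add: Xc_def)
  also have "\<dots> \<le> Psi a b x * (4 * b / l * (4 / 3 * L / l)) ^ r * (L / (1/2))"
  proof (intro mult_mono power_mono cT lv divide_left_mono)
    have "ln (1 / 2) \<le> (1 / 2 :: real) - 1" by (rule ln_le_minus_one) simp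
    thus "1 / 2 \<le> ln (2::real)" by (simp add: ln_div)
  qed (use L l v b in auto)
  finally have 1: "Xc * (c / (2 * l)) * D ^ r \<le> Psi a b x * (4 * b / l * (4 / 3 * L / l)) ^ r * (2 * L)" by simp
  \<comment> \<open>The 960 in \<open>\<kappa>\<close> is the product of \<open>16 / 3\<close> on
    the left, 5 from \<open>k5\<close>, and 36 from \<open>s = c / (36 * r * ln B)\<close>.\<close>
  have quot: "4 * b / l * (4 / 3 * L / l) = D * (real r / (\<kappa> * l))"
  proof -
    have "\<kappa> > 0" using c_pos z lB by (simp add: \<kappa>_def)
    thus ?thesis using L l b z lB c_pos r0 unfolding D_def s_def \<kappa>_def by (simp add: field_simps)
  qed
  define Y where "Y = \<kappa> * l / real r"
  have Y0: "Y > 0" using c_pos z lB l r0 by (simp add: Y_def \<kappa>_def)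
  have rY: "real r / (\<kappa> * l) = 1 / Y" by (simp add: Y_def)
  have "Xc * (c / (2 * l)) * D ^ r \<le> (Psi a b x * (1 / Y) ^ r * (2 * L)) * D ^ r"
    using 1 unfolding quot rY power_mult_distrib by (simp only: mult_ac)
  hence "Xc * (c / (2 * l)) \<le> Psi a b x * (1 / Y) ^ r * (2 * L)"
    by (rule mult_right_le_imp_le) (rule zero_less_power[OF D0])
  hence "Xc \<le> Psi a b x * ((4 * l * L / c) / Y ^ r)" using c_pos l Y0 by (simp add: power_divide field_simps)
  also have "\<dots> \<le> Psi a b x * (1 / 4)"
  proof (intro mult_left_mono)
    have *: "4 * (4 * l * L / c) \<le> Y ^ r" using big by (simp add: Y_def l_def L_def)
    have "v / w \<le> 1 / 4" if "4 * v \<le> w" "w > 0" for v w :: real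
      using that by (simp add: field_simps)
    from this[OF *] show "(4 * l * L / c) / Y ^ r \<le> 1 / 4" using Y0 by simp
  qed auto
  finally have "Xc \<le> Psi a b x / 4" by simp
  moreover have "Xc = real (card {n \<in> smooth_upto x a b. card {p. prime p \<and> a \<le> real p \<and> b / z \<le> real p \<and> real p \<le> b \<and> p dvd n} \<ge> k})"
    by (simp add: Xc_def T_def conj_assoc)
  ultimately show ?thesis by simp
qed

section \<open>Choice of parameters for large \<open>L\<close>, and the resulting power
  decay\<close>

lemma eventually_const_le_powr: "e > 0 \<Longrightarrow> \<forall>\<^sub>F L in at_top. (M::real) \<le> L powr e"
  by real_asymp

text \<open>Two regimes. If about \<open>3 * ln L\<close> exchanges are possible, each gains at
  least a factor 3, together more than \<open>L ^ 3\<close>. Otherwise \<open>k\<close> is of order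
  \<open>ln L\<close>, so \<open>ln b \<ge> L / (40 * ln L)\<close>, and four exchanges suffice
  since \<open>(ln b) ^ 4\<close> far exceeds \<open>ln b * L\<close>. The assumption
  \<open>ln b \<le> L / 40\<close> guarantees \<open>k \<ge> 8\<close>, as four exchanges
  require.\<close>

lemma (in chebyshev) few_top_primes_eventually:
  fixes K K' z :: real
  defines "B \<equiv> 4 / c"
  defines "\<kappa> \<equiv> c / (960 * z * ln B)"
  assumes z: "z \<ge> 1" and K: "K \<ge> 10 + 12 / \<kappa> + 36 * ln B + 9 * ln z" "K > 2 * K'"
  shows "\<forall>\<^sub>F L in at_top. \<forall>a b x k. a \<le> L powr K' \<longrightarrow> K * ln L \<le> ln b \<longrightarrow> b > 1 \<longrightarrow> ln b \<le> L / 40 \<longrightarrow>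
     L / 2 \<le> ln x \<longrightarrow> ln x \<le> L \<longrightarrow> x > 0 \<longrightarrow> 2 / 5 * ln x / ln b \<le> real k \<longrightarrow> real k < 2 / 5 * ln x / ln b + 1 \<longrightarrow>
     real (card {n \<in> smooth_upto x a b. card {p. prime p \<and> a \<le> real p \<and> b / z \<le> real p \<and> real p \<le> b \<and> p dvd n} \<ge> k}) \<le> Psi a b x / 4"
proof -
  have B: "B \<ge> 2" using c_le c_pos by (simp add: B_def field_simps)
  have lB: "ln B > 0" using B by simp
  have kap: "\<kappa> > 0" using c_pos z lB by (simp add: \<kappa>_def)
  have lz: "ln z \<ge> 0" using z by simp
  have "12 / \<kappa> > 0" using kap by simp
  \<comment> \<open>The summand \<open>12 / \<kappa>\<close> makes the gain per exchange at least 3,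
    \<open>36 * ln B\<close> makes the window from \<open>v\<close> to \<open>u\<close> at least one
    Chebyshev ratio long, and \<open>9 * ln z\<close> absorbs \<open>z ^ r\<close>, which is a power
    of \<open>L\<close>.\<close>
  hence K10: "K \<ge> 10" and K12: "K \<ge> 12 / \<kappa>" and K36: "K \<ge> 36 * ln B" and Kz: "K \<ge> 10 + 9 * ln z"
    using K lB lz by linarith+
  have e1: "\<forall>\<^sub>F L in at_top. ln L \<ge> (2::real)" by real_asymp
  have e2: "\<forall>\<^sub>F L in at_top. 16 / c \<le> (L::real)" by real_asymp
  have e3: "\<forall>\<^sub>F L in at_top. 4 / c \<le> L powr (K / 2 - K')" using K by (intro eventually_const_le_powr) auto
  have e4: "\<forall>\<^sub>F L in at_top. max (z ^ 4) (z ^ 2) \<le> (L::real)" by (rule eventually_ge_at_top)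
  have e5: "\<forall>\<^sub>F L in at_top. 4096 / c * L \<le> \<kappa> ^ 4 * (L / (40 * ln L)) ^ 3" using kap c_pos by real_asymp
  have e6: "\<forall>\<^sub>F L in at_top. 36 * ln B \<le> L / (40 * ln (L::real))" by real_asymp
  show ?thesis using e1 e2 e3 e4 e5 e6 eventually_ge_at_top[of "2::real"]
  proof eventually_elim
    case (elim L)
    show ?case
    proof (intro allI impI)
      fix a b x :: real and k :: nat
      assume a: "a \<le> L powr K'" and b: "K * ln L \<le> ln b" "b > 1" "ln b \<le> L / 40"
        and x: "L / 2 \<le> ln x" "ln x \<le> L" "x > 0" and k: "2 / 5 * ln x / ln b \<le> real k" "real k < 2 / 5 * ln x / ln b + 1"
      have L2: "L \<ge> 2" and lL: "ln L \<ge> 2" using elim by auto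
      have lb: "ln b > 0" using b by simp
      have bL: "b powr q \<ge> L powr (K * q)" if "q \<ge> 0" for q
      proof -
        have "K * ln L * q \<le> ln b * q" using b that by (intro mult_right_mono) auto
        thus ?thesis using b(2) L2 by (simp add: powr_def mult_ac)
      qed
      have zL: "z \<le> L" "z\<^sup>2 \<le> L" "z ^ 4 \<le> L" 
        using elim(4) self_le_power[of z 2] z by auto
      have w: "max 2 (4 / c * a) \<le> L powr (K / 2)"
      proof -
        have "4 / c * a \<le> 4 / c * L powr K'" using a c_pos by (intro mult_left_mono) auto
        also have "\<dots> \<le> L powr (K / 2 - K') * L powr K'" using elim(3) by (intro mult_right_mono) auto
        also have "\<dots> = L powr (K / 2)" by (simp add: powr_add[symmetric])
        finally have 1: "4 / c * a \<le> L powr (K / 2)" .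
        have "L powr 1 \<le> L powr (K / 2)" using L2 K10 by (intro powr_mono) auto
        with 1 L2 show ?thesis by simp
      qed
      have zr_aux: "max 2 (4 / c * a) * z ^ r \<le> b powr (8/9)" if "z ^ r \<le> L powr (1 + 3 * ln z)" for r :: nat
      proof -
        have "max 2 (4 / c * a) * z ^ r \<le> L powr (K / 2) * L powr (1 + 3 * ln z)"
          using w that z by (intro mult_mono) auto
        also have "\<dots> = L powr (K / 2 + (1 + 3 * ln z))" by (simp add: powr_add)
        also have "\<dots> \<le> L powr (K * (8 / 9))" using Kz lz L2 by (intro powr_mono) auto
        also have "\<dots> \<le> b powr (8/9)" by (rule bL) simp
        finally show ?thesis .
      qed
      have z2b: "z\<^sup>2 \<le> b"
      proof -
        have "z\<^sup>2 \<le> L powr 1" using zL L2 by simp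
        also have "\<dots> \<le> L powr (K * 1)" using K10 L2 by (intro powr_mono) auto
        also have "\<dots> \<le> b powr 1" by (rule bL) simp
        finally show ?thesis using b by simp
      qed
      have b34: "L powr (K / 2) \<le> b powr (3/4)"
      proof -
        have "L powr (K / 2) \<le> L powr (K * (3/4))" using K10 L2 by (intro powr_mono) auto
        also have "\<dots> \<le> b powr (3/4)" by (rule bL) simp
        finally show ?thesis .
      qed
      have ab: "a \<le> b powr (3/4)"
      proof -
        have "L powr K' \<le> L powr (K / 2)" using K L2 by (intro powr_mono) auto
        with a b34 show ?thesis by linarith
      qed
      have b2: "2 \<le> b powr (3/4)" using w b34 by simp
      have x1: "x > 1"
      proof -
        have "ln x > 0" using x L2 by linarith
        thus ?thesis using x(3) by (simp add: ln_gt_zero_iff)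
      qed
      define r where "r = nat \<lceil>3 * ln L\<rceil>"
      have r: "real r \<ge> 3 * ln L" "real r \<le> 3 * ln L + 1" using lL unfolding r_def by linarith+
      have r4: "r \<ge> 4" using r lL by linarith
      have r4L: "real r \<le> 4 * ln L" using r lL by linarith
      have lbK: "ln b / real r \<ge> K / 4"
      proof -
        have "K / 4 * real r \<le> K / 4 * (4 * ln L)" using r4L K10 by (intro mult_left_mono) auto
        also have "\<dots> \<le> ln b" using b by simp
        finally show ?thesis using r4 by (simp add: field_simps)
      qed
      show "real (card {n \<in> smooth_upto x a b. card {p. prime p \<and> a \<le> real p \<and> b / z \<le> real p \<and> real p \<le> b \<and> p dvd n} \<ge> k}) \<le> Psi a b x / 4"
      proof (cases "2 * r \<le> k")
        case True
        show ?thesis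
        proof (rule few_top_primes[OF r4 True k(1) x1 z z2b _ ab b2 b(2)])
          have "z ^ r = exp (real r * ln z)" using z by (simp add: exp_of_nat_mult)
          also have "\<dots> \<le> exp ((3 * ln L + 1) * ln z)" using r lz by (subst exp_le_cancel_iff) (intro mult_right_mono)
          also have "\<dots> = L powr (3 * ln z) * z" using z L2 by (simp add: powr_def exp_add[symmetric] algebra_simps exp_add)
          also have "\<dots> \<le> L powr (3 * ln z) * L powr 1" using zL L2 by (intro mult_left_mono) auto
          also have "\<dots> = L powr (1 + 3 * ln z)" by (simp add: powr_add mult.commute)
          finally show "max 2 (4 / c * a) * z ^ r \<le> b powr (8/9)" by (rule zr_aux)
          have "ln (4 / c) \<le> K / 4 / 9" using K36 unfolding B_def by linarith
          also have "\<dots> \<le> ln b / real r / 9" using lbK by (rule divide_right_mono) simp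
          finally show "ln (4 / c) \<le> ln b / (9 * real r)" by (simp add: field_simps)
          have "3 \<le> \<kappa> * (K / 4)" using K12 kap by (simp add: field_simps)
          also have "\<dots> \<le> \<kappa> * (ln b / real r)" using lbK kap by (intro mult_left_mono) auto
          finally have "exp 1 \<le> \<kappa> * ln b / real r" using exp_le by simp
          hence "exp 1 ^ r \<le> (\<kappa> * ln b / real r) ^ r" by (intro power_mono) auto
          moreover have "exp 1 ^ r = exp (real r)" by (simp add: exp_of_nat_mult[symmetric])
          moreover have "exp (3 * ln L) \<le> exp (real r)" using r by simp
          moreover have "exp (3 * ln L) = L ^ 3" using L2 exp_of_nat_mult[of 3 "ln L"] by simp
          moreover have "16 * ln b * ln x / c \<le> L ^ 3"
          proof -
            have "16 / c * (ln b * ln x) \<le> L * (L * L)"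
              using elim(2) b(3) x(2) L2 lb x1 by (intro mult_mono mult_nonneg_nonneg) auto
            thus ?thesis by (simp add: power3_eq_cube)
          qed
          ultimately show "16 * ln b * ln x / c \<le> (c / (960 * z * ln (4 / c)) * ln b / real r) ^ r"
            unfolding \<kappa>_def B_def by linarith
        qed
      next
        case False
        have "2 / 5 * (L / 2) / ln b \<le> 2 / 5 * ln x / ln b" using x lb by (intro divide_right_mono) auto
        also have "\<dots> \<le> 8 * ln L" using k False r4L by linarith
        finally have lM: "L / (40 * ln L) \<le> ln b" using lb lL by (simp add: field_simps)
        have "8 \<le> 2 / 5 * (L / 2) / ln b" using b lb by (simp add: field_simps)
        also have "\<dots> \<le> 2 / 5 * ln x / ln b" using x lb by (intro divide_right_mono) auto
        finally have k8: "2 * 4 \<le> k" using k by linarith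
        show ?thesis
        proof (rule few_top_primes[OF order_refl k8 k(1) x1 z z2b _ ab b2 b(2)])
          have "z ^ 4 \<le> L powr 1" using zL L2 by simp
          also have "\<dots> \<le> L powr (1 + 3 * ln z)" using lz L2 by (intro powr_mono) auto
          finally show "max 2 (4 / c * a) * z ^ 4 \<le> b powr (8/9)" by (rule zr_aux)
          show "ln (4 / c) \<le> ln b / (9 * real 4)" using lM elim(6) by (simp add: B_def)
          have M0: "L / (40 * ln L) \<ge> 0" using L2 lL by simp
          have "4096 / c * ln x \<le> 4096 / c * L" using x c_pos by (intro mult_left_mono) auto
          also have "\<dots> \<le> \<kappa> ^ 4 * (L / (40 * ln L)) ^ 3" by (rule elim(5))
          also have "\<dots> \<le> \<kappa> ^ 4 * ln b ^ 3" using lM M0 by (intro mult_left_mono power_mono) auto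
          finally have "4096 / c * ln x * ln b \<le> \<kappa> ^ 4 * ln b ^ 3 * ln b" using lb by (intro mult_right_mono) auto
          also have "\<dots> = 256 * (\<kappa> * ln b / real 4) ^ 4" by (simp add: power_divide power_mult_distrib eval_nat_numeral)
          finally have "16 * ln b * ln x / c \<le> (\<kappa> * ln b / real 4) ^ 4" by (simp add: field_simps)
          thus "16 * ln b * ln x / c \<le> (c / (960 * z * ln (4 / c)) * ln b / real 4) ^ 4"
            unfolding \<kappa>_def B_def .
        qed
      qed
    qed
  qed
qed

lemma (in chebyshev) card_irregular_eventually:
  fixes K K' :: real
  assumes K: "K \<ge> 10" "K > 2 * K'"
  shows "\<forall>\<^sub>F L in at_top. \<forall>a b x. a \<le> L powr K' \<longrightarrow> L powr K \<le> b \<longrightarrow>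
     L / 2 \<le> ln x \<longrightarrow> ln x \<le> L \<longrightarrow> x > 0 \<longrightarrow>
     real (card {n \<in> smooth_upto x a b. \<not> regular a (L powr (K / 2)) x n}) \<le> Psi a b x / L\<^sup>2"
proof -
  have K0: "K > 0" using K by simp
  have e1: "\<forall>\<^sub>F L in at_top. 4 / c \<le> L powr (K / 2 - K')" using K by (intro eventually_const_le_powr) auto
  have e2: "\<forall>\<^sub>F L in at_top. 2 / c \<le> L powr (1 / 4)" by (intro eventually_const_le_powr) auto
  have e3: "\<forall>\<^sub>F L in at_top. 16 / c\<^sup>2 \<le> (L::real)" by (rule eventually_ge_at_top)
  have e4: "\<forall>\<^sub>F L in at_top. 2 * L powr K * exp (- (L / (80 * K))) * exp (4 * (L powr (3 / 4) * (1 + K / 2 * ln L))) \<le> 1 / (2 * L\<^sup>2)"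
    using K0 by real_asymp
  show ?thesis using e1 e2 e3 e4 eventually_ge_at_top[of "2::real"]
  proof eventually_elim
    case (elim L)
    show ?case
    proof (intro allI impI)
      fix a b x :: real
      assume a: "a \<le> L powr K'" and b: "L powr K \<le> b" and x: "L / 2 \<le> ln x" "ln x \<le> L" "x > 0"
      have L2: "L \<ge> 2" by (rule elim(5))
      \<comment> \<open>The choice of \<open>s\<close> gives
        \<open>t powr (-s) = L powr (5/4) / t\<close>, enough for the factor
        \<open>2 * L / (c * t)\<close> of one step. The choice of \<open>s'\<close> gives
        \<open>w powr (1 - s') = L powr (3/4)\<close>, so that the Euler product is beaten by
        \<open>x powr (- 1 / (40 * K)) \<le> exp (- L / (80 * K))\<close>.\<close>
      define t w s s' where "t = L powr K" and "w = L powr (K / 2)" and "s = 1 - 5 / (4 * K)" and "s' = 1 - 3 / (2 * K)"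
      have wa: "4 / c * a \<le> w"
      proof -
        have "4 / c * a \<le> 4 / c * L powr K'" using a c_pos by (intro mult_left_mono) auto
        also have "\<dots> \<le> L powr (K / 2 - K') * L powr K'" using elim(1) by (intro mult_right_mono) auto
        also have "\<dots> = w" by (simp add: powr_add[symmetric] w_def)
        finally show ?thesis .
      qed
      have w2: "w \<ge> L powr 5" unfolding w_def using L2 K by (intro powr_mono) auto
      have L5: "L powr 5 = L ^ 5" using L2 powr_realpow[of L 5] by simp
      have "L ^ 1 \<le> L ^ 5" using L2 by (intro power_increasing) auto
      hence w2': "w \<ge> 2" using w2 L5 L2 by simp
      have tw: "t \<ge> w" unfolding t_def w_def using L2 K by (intro powr_mono) auto
      have ss: "s \<le> 1" "1 / 2 \<le> s'" "s' \<le> s" "s - s' = 1 / (4 * K)" using K by (auto simp: s_def s'_def field_simps)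
      have st: "L / (c / 2 * t) \<le> t powr (-s)"
      proof -
        have "t powr (-s) = L powr (5 / 4 - K)" using K0 by (simp add: t_def s_def powr_powr algebra_simps)
        also have "\<dots> = L powr (1 + 1 / 4) / t" by (simp add: powr_diff t_def)
        also have "L powr (1 + 1 / 4) = L * L powr (1 / 4)" using L2 by (simp only: powr_add) simp
        also have "L * L powr (1 / 4) / t \<ge> L * (2 / c) / t" using elim(2) L2 by (intro divide_right_mono mult_left_mono) (auto simp: t_def)
        also have "L * (2 / c) / t = L / (c / 2 * t)" by simp
        finally show ?thesis .
      qed
      have x1: "x \<ge> 1"
      proof -
        have "ln x > 0" using x L2 by linarith
        thus ?thesis using x(3) by (simp add: ln_gt_zero_iff)
      qed
      have xL: "x \<le> exp L" using x by (metis exp_le_cancel_iff exp_ln)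
      have "real (card {n \<in> smooth_upto x a b. \<not> regular a w x n})
        \<le> (2 * t * x powr (- (s - s') / 10) * exp (4 * (w powr (1 - s') * (1 + ln w))) + 8 * L\<^sup>2 / (c\<^sup>2 * w)) * Psi a b x"
        using st ss xL x1 L2 wa w2' tw b by (intro card_irregular) (auto simp: t_def)
      also have "\<dots> \<le> (1 / (2 * L\<^sup>2) + 1 / (2 * L\<^sup>2)) * Psi a b x"
      proof (intro mult_right_mono add_mono)
        have "w powr (1 - s') * (1 + ln w) = L powr (3 / 4) * (1 + K / 2 * ln L)"
          using K0 L2 by (simp add: w_def s'_def powr_powr ln_powr)
        moreover have "x powr (- (s - s') / 10) \<le> exp (- (L / (80 * K)))"
        proof -
          have "L / 2 / (40 * K) \<le> ln x / (40 * K)" using x K0 by (intro divide_right_mono) auto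
          thus ?thesis using x(3) unfolding ss(4) by (simp add: powr_def)
        qed
        ultimately have "2 * t * x powr (- (s - s') / 10) * exp (4 * (w powr (1 - s') * (1 + ln w))) \<le>
            2 * L powr K * exp (- (L / (80 * K))) * exp (4 * (L powr (3 / 4) * (1 + K / 2 * ln L)))"
          unfolding t_def by (intro mult_mono) auto
        also have "\<dots> \<le> 1 / (2 * L\<^sup>2)" by (rule elim(4))
        finally show "2 * t * x powr (- (s - s') / 10) * exp (4 * (w powr (1 - s') * (1 + ln w))) \<le> 1 / (2 * L\<^sup>2)" .
        have "8 * L\<^sup>2 / (c\<^sup>2 * w) \<le> 8 * L\<^sup>2 / (c\<^sup>2 * L ^ 5)"
          using w2 w2' c_pos L2 unfolding L5 by (intro divide_left_mono mult_left_mono) (auto intro!: mult_pos_pos)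
        also have "\<dots> = (16 / c\<^sup>2) / (2 * L ^ 3)" using L2 c_pos by (simp add: field_simps eval_nat_numeral)
        also have "\<dots> \<le> L / (2 * L ^ 3)" using elim(3) L2 by (intro divide_right_mono) auto
        also have "\<dots> = 1 / (2 * L\<^sup>2)" using L2 by (simp add: field_simps eval_nat_numeral)
        finally show "8 * L\<^sup>2 / (c\<^sup>2 * w) \<le> 1 / (2 * L\<^sup>2)" .
      qed auto
      also have "\<dots> = Psi a b x / L\<^sup>2" by simp
      finally show "real (card {n \<in> smooth_upto x a b. \<not> regular a (L powr (K / 2)) x n}) \<le> Psi a b x / L\<^sup>2"
        unfolding w_def .
    qed
  qed
qed

text \<open>For a typical \<open>n\<close> the primes above \<open>w\<close> carry at least
  \<open>8 / 10 * ln x\<close>, and fewer than \<open>2 / 5 * ln x / ln b\<close> prime factors lie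
  between \<open>b / z\<close> and \<open>b\<close>, which take at most half of it. The other half
  sits on primes up to \<open>b / z\<close>, as \<open>Psi_growth\<close> requires.\<close>

lemma (in chebyshev) Psi_doubling_eventually:
  fixes K K' :: real
  defines "B \<equiv> 4 / c"
  defines "z \<equiv> 160 / c"
  defines "\<kappa> \<equiv> c / (960 * z * ln B)"
  assumes K: "K \<ge> 10 + 12 / \<kappa> + 36 * ln B + 9 * ln z" "K > 2 * K'"
  shows "\<forall>\<^sub>F L in at_top. \<forall>a b x. a \<le> L powr K' \<longrightarrow> L powr K \<le> b \<longrightarrow> ln b \<le> L / 40 \<longrightarrow>
     L / 2 \<le> ln x \<longrightarrow> ln x \<le> L \<longrightarrow> x > 0 \<longrightarrow> Psi a b x \<le> Psi a b (z * x) / 2"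
proof -
  have z80: "z \<ge> 80" using c_le c_pos by (simp add: z_def field_simps)
  have B: "B \<ge> 2" using c_le c_pos by (simp add: B_def field_simps)
  have lB: "ln B > 0" using B by simp
  have kap: "\<kappa> > 0" using c_pos z80 lB by (simp add: \<kappa>_def)
  have lz: "ln z \<ge> 0" using z80 by simp
  have "12 / \<kappa> > 0" using kap by simp
  hence K10: "K \<ge> 10" using K lB lz by linarith
  have e0: "\<forall>\<^sub>F L in at_top. \<forall>a b x k. a \<le> L powr K' \<longrightarrow> K * ln L \<le> ln b \<longrightarrow> b > 1 \<longrightarrow> ln b \<le> L / 40 \<longrightarrow>
     L / 2 \<le> ln x \<longrightarrow> ln x \<le> L \<longrightarrow> x > 0 \<longrightarrow> 2 / 5 * ln x / ln b \<le> real k \<longrightarrow> real k < 2 / 5 * ln x / ln b + 1 \<longrightarrow>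
     real (card {n \<in> smooth_upto x a b. card {p. prime p \<and> a \<le> real p \<and> b / z \<le> real p \<and> real p \<le> b \<and> p dvd n} \<ge> k}) \<le> Psi a b x / 4"
    by (rule few_top_primes_eventually) (use K z80 in \<open>auto simp: \<kappa>_def B_def\<close>)
  have e2: "\<forall>\<^sub>F L in at_top. 4 / c \<le> L powr (K / 2 - K')" using K by (intro eventually_const_le_powr) auto
  have e3: "\<forall>\<^sub>F L in at_top. ln z \<le> (L::real) / 2" by real_asymp
  show ?thesis using e0 card_irregular_eventually[OF K10 K(2)] e2 e3 eventually_ge_at_top[of "2::real"]
  proof eventually_elim
    case (elim L)
    show ?case
    proof (intro allI impI)
      fix a b x :: real
      assume a: "a \<le> L powr K'" and b: "L powr K \<le> b" "ln b \<le> L / 40" and x: "L / 2 \<le> ln x" "ln x \<le> L" "x > 0"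
      have L2: "L \<ge> 2" by (rule elim(5))
      define w where "w = L powr (K / 2)"
      have wa: "4 / c * a \<le> w"
      proof -
        have "4 / c * a \<le> 4 / c * L powr K'" using a c_pos by (intro mult_left_mono) auto
        also have "\<dots> \<le> L powr (K / 2 - K') * L powr K'" using elim(3) by (intro mult_right_mono) auto
        also have "\<dots> = w" by (simp add: powr_add[symmetric] w_def)
        finally show ?thesis .
      qed
      have "L powr 1 \<le> w" unfolding w_def using L2 K10 by (intro powr_mono) auto
      hence w2: "w \<ge> 2" using L2 by simp
      have "L powr 1 \<le> L powr K" using L2 K10 by (intro powr_mono) auto
      hence b1: "b > 1" using b L2 by simp
      have lb: "ln b > 0" using b1 by simp
      have "ln (L powr K) \<le> ln b" using b L2 b1 by (subst ln_le_cancel_iff) auto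
      hence Kb: "K * ln L \<le> ln b" using L2 by (simp add: ln_powr)
      have lx: "ln x > 0" using x L2 by linarith
      hence x1: "x \<ge> 1" using x(3) by (simp add: ln_gt_zero_iff)
      define k where "k = nat \<lceil>2 / 5 * ln x / ln b\<rceil>"
      have "2 / 5 * ln x / ln b > 0" using lx lb by simp
      hence k: "2 / 5 * ln x / ln b \<le> real k" "real k < 2 / 5 * ln x / ln b + 1" unfolding k_def by linarith+
      define T where "T = (\<lambda>n. {p. prime p \<and> a \<le> real p \<and> b / z \<le> real p \<and> real p \<le> b \<and> p dvd (n::nat)})"
      define X where "X = {n \<in> smooth_upto x a b. card (T n) \<ge> k}"
      define I where "I = {n \<in> smooth_upto x a b. \<not> regular a w x n}"
      define G where "G = smooth_upto x a b - (X \<union> I)"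
      have cX: "real (card X) \<le> Psi a b x / 4"
        unfolding X_def T_def using elim(1) a Kb b1 b(2) x k by blast
      have cI: "real (card I) \<le> Psi a b x / L\<^sup>2" 
        unfolding I_def w_def using elim(2) a b x by blast
      also have "\<dots> \<le> Psi a b x / 2\<^sup>2" using L2 by (intro divide_left_mono power_mono) auto
      finally have cI: "real (card I) \<le> Psi a b x / 4" by simp
      have fin: "finite X" "finite I" by (auto simp: X_def I_def)
      have "smooth_upto x a b \<subseteq> G \<union> (X \<union> I)" unfolding G_def by blast
      moreover have "finite (G \<union> (X \<union> I))" using fin by (simp add: G_def)
      ultimately have "card (smooth_upto x a b) \<le> card (G \<union> (X \<union> I))" by (rule card_mono[rotated])
      also have "\<dots> \<le> card G + card (X \<union> I)" by (rule card_Un_le)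
      also have "card (X \<union> I) \<le> card X + card I" by (rule card_Un_le)
      finally have "Psi a b x \<le> real (card G) + (real (card X) + real (card I))" unfolding Psi_def by linarith
      hence cG: "real (card G) \<ge> Psi a b x / 4" using cX cI Psi_nonneg[of a b x] by linarith
      have main: "(\<Sum>p | prime p \<and> a \<le> real p \<and> w < real p \<and> real p \<le> b / z \<and> p dvd n. ln (real p)) \<ge> 2 / 5 * ln x"
        if n: "n \<in> G" for n
      proof -
        have nS: "n \<in> smooth_set a b" and reg: "regular a w x n" and nk: "card (T n) < k"
          using n by (auto simp: G_def X_def I_def smooth_upto_iff)
        have n0: "n > 0" using nS by (rule smooth_set_pos)
        define P where "P = {p. prime p \<and> p dvd n \<and> real p > w}"
        define Q where "Q = {p. prime p \<and> a \<le> real p \<and> w < real p \<and> real p \<le> b / z \<and> p dvd n}"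
        note dec = regular_decomposition[OF nS reg, folded P_def]
        have fT: "finite (T n)" "finite Q" unfolding T_def Q_def using n0
          by (auto intro: finite_subset[OF _ finite_divisors_nat[of n]])
        have PQ: "P \<subseteq> Q \<union> T n" using nS by (auto simp: P_def Q_def T_def smooth_set_def)
        define d where "d = n div \<Prod>P"
        have nd: "n = d * \<Prod>P" using dec(1) by (simp add: d_def)
        have d0: "d > 0" "\<Prod>P > 0" using n0 nd by (auto intro!: Nat.gr0I)
        have "9 / 10 * ln x = ln (x powr (9/10))" using x by (simp add: ln_powr)
        also have "\<dots> \<le> ln (real n)" using reg x n0 by (subst ln_le_cancel_iff) (auto simp: regular_def)
        also have "real n = real d * real (\<Prod>P)" by (subst nd) simp
        also have "ln \<dots> = ln (real d) + ln (real (\<Prod>P))" using d0 by (intro ln_mult_pos) (simp_all only: of_nat_0_less_iff)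
        also have "ln (real d) \<le> ln (x powr (1/10))"
          using dec(2) d0 x by (subst ln_le_cancel_iff) (auto simp: d_def)
        also have "ln (x powr (1/10)) = 1 / 10 * ln x" using x by (simp add: ln_powr)
        also have "ln (real (\<Prod>P)) = (\<Sum>p\<in>P. ln (real p))"
          unfolding of_nat_prod using dec(3) by (subst ln_prod) (auto simp: P_def prime_gt_0_nat)
        finally have "8 / 10 * ln x \<le> (\<Sum>p\<in>P. ln (real p))" by simp
        also have "\<dots> \<le> (\<Sum>p\<in>Q \<union> T n. ln (real p))"
          using PQ fT by (intro sum_mono2) (auto simp: Q_def T_def prime_gt_0_nat Suc_leI)
        also have "\<dots> \<le> (\<Sum>p\<in>Q. ln (real p)) + (\<Sum>p\<in>T n. ln (real p))"
        proof -
          have "(\<Sum>p\<in>Q \<inter> T n. ln (real p)) \<ge> 0" by (intro sum_nonneg) (auto simp: Q_def prime_gt_0_nat Suc_leI)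
          thus ?thesis using sum.union_inter[OF fT(2,1), of "\<lambda>p. ln (real p)"] by linarith
        qed
        also have "(\<Sum>p\<in>T n. ln (real p)) \<le> (\<Sum>p\<in>T n. ln b)"
          using b1 by (intro sum_mono) (auto simp: T_def prime_gt_0_nat)
        also have "\<dots> = real (card (T n)) * ln b" by simp
        \<comment> \<open>The strict inequality \<open>card (T n) < k\<close> undoes the rounding in
          \<open>k\<close>, as \<open>k - 1\<close> is below
          \<open>2 / 5 * ln x / ln b\<close>.\<close>
        also have "\<dots> \<le> (2 / 5 * ln x / ln b) * ln b" using nk k lb by (intro mult_right_mono) auto
        also have "\<dots> = 2 / 5 * ln x" using lb by simp
        finally show ?thesis by (simp add: Q_def)
      qed
      have "ln (z * x) \<le> 2 * ln x"
      proof -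
        have "ln (z * x) = ln z + ln x" using z80 x by (intro ln_mult_pos) auto
        with elim(4) x show ?thesis by linarith
      qed
      thus "Psi a b x \<le> Psi a b (z * x) / 2" unfolding z_def
        using cG main x1 w2 wa b1 unfolding z_def by (intro Psi_growth[of x "ln x" w a b G]) (auto simp: G_def)
    qed
  qed
qed

text \<open>The doubling is iterated downwards about \<open>ln u / ln z\<close> times;
  \<open>u \<le> sqrt N\<close> keeps all arguments in the range of \<open>dbl\<close>. Rounding the
  number of steps costs the factor 2.\<close>

lemma Psi_decay:
  assumes z: "z > 1" and N: "N > 1" and u: "1 \<le> u" "u \<le> sqrt N"
    and dbl: "\<And>x. sqrt N \<le> x \<Longrightarrow> x \<le> N \<Longrightarrow> Psi a b x \<le> Psi a b (z * x) / 2"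
  shows "Psi a b (N / u) \<le> 2 * u powr (- (ln 2 / ln z)) * Psi a b N"
proof -
  define i where "i = nat \<lfloor>ln u / ln z\<rfloor>"
  have lz: "ln z > 0" using z by simp
  have "ln u / ln z \<ge> 0" using u lz by simp
  hence i: "real i \<le> ln u / ln z" "ln u / ln z \<le> real i + 1" unfolding i_def by linarith+
  have step: "Psi a b (N / z ^ j) \<le> (1 / 2) ^ j * Psi a b N" if "j \<le> i" for j
    using that
  proof (induction j)
    case (Suc j)
    have "z ^ Suc j = exp (real (Suc j) * ln z)" using z by (simp only: exp_of_nat_mult exp_ln_iff) simp
    also have "\<dots> \<le> exp (ln u)"
    proof (subst exp_le_cancel_iff)
      have "real (Suc j) * ln z \<le> real i * ln z" using Suc.prems lz by (intro mult_right_mono) auto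
      also have "\<dots> \<le> ln u" using i(1) lz by (simp add: field_simps)
      finally show "real (Suc j) * ln z \<le> ln u" .
    qed
    also have "\<dots> = u" using u by simp
    finally have zu: "z ^ Suc j \<le> sqrt N" using u by simp
    have "sqrt N * z ^ Suc j \<le> sqrt N * sqrt N" using zu N by (intro mult_left_mono) auto
    hence 1: "sqrt N \<le> N / z ^ Suc j" using N z by (simp add: field_simps)
    have "1 \<le> z ^ Suc j" using z by (intro one_le_power) auto
    hence 2: "N / z ^ Suc j \<le> N / 1" using N by (intro divide_left_mono) auto
    have "Psi a b (N / z ^ Suc j) \<le> Psi a b (z * (N / z ^ Suc j)) / 2" using 1 2 by (intro dbl) auto
    also have "z * (N / z ^ Suc j) = N / z ^ j" using z by simp
    also have "Psi a b (N / z ^ j) \<le> (1 / 2) ^ j * Psi a b N" using Suc by simp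
    finally show ?case by simp
  qed simp
  have "z ^ i = exp (real i * ln z)" using z by (simp add: exp_of_nat_mult)
  also have "\<dots> \<le> exp (ln u)" using i(1) lz by (subst exp_le_cancel_iff) (simp add: field_simps)
  finally have "z ^ i \<le> u" using u by simp
  hence "Psi a b (N / u) \<le> Psi a b (N / z ^ i)" using N z u by (intro Psi_mono divide_left_mono) auto
  also have "\<dots> \<le> (1 / 2) ^ i * Psi a b N" by (rule step) simp
  also have "(1 / 2) ^ i \<le> 2 * u powr (- (ln 2 / ln z))"
  proof -
    have "(ln u / ln z) * ln 2 \<le> (real i + 1) * ln 2" using i by (intro mult_right_mono) auto
    hence "exp (- (real i * ln 2)) \<le> exp (ln 2 + - (ln 2 / ln z) * ln u)" by (simp add: algebra_simps)
    also have "\<dots> = 2 * u powr (- (ln 2 / ln z))" unfolding exp_add using u by (simp add: powr_def)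
    finally show ?thesis by (simp add: exp_minus exp_of_nat_mult power_divide inverse_eq_divide)
  qed
  finally show ?thesis by (simp add: mult_right_mono)
qed

section \<open>Rational approximation from many smooth integers\<close>

lemma prod_primes_power_dvd:
  assumes "finite P" "\<And>p. p \<in> P \<Longrightarrow> prime (p::nat)" "\<And>p. p \<in> P \<Longrightarrow> int p ^ k dvd r"
  shows "int (\<Prod>P) ^ k dvd r"
  using assms
proof (induction P rule: finite_induct)
  case (insert p P)
  have "coprime p (\<Prod>P)"
    by (rule prod_coprime_right) (use insert in \<open>auto intro: primes_coprime\<close>)
  hence "coprime (int p ^ k) (int (\<Prod>P) ^ k)" by (simp del: of_nat_prod)
  moreover have "int p ^ k dvd r" "int (\<Prod>P) ^ k dvd r" using insert by auto
  ultimately have "int p ^ k * int (\<Prod>P) ^ k dvd r" by (intro divides_mult)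
  thus ?case using insert by (simp add: power_mult_distrib)
qed simp

text \<open>The multipliers that make \<open>t\<close> an integer are closed under integer
  combinations, and Bezout's identity applies to \<open>n ^ k\<close> and \<open>m ^ k\<close>,
  whose gcd is \<open>gcd n m ^ k\<close>. For the empty set \<open>Gcd {} = 0\<close>, and
  \<open>k \<ge> 1\<close> makes its power 0.\<close>

lemma gcd_power_mult_Ints:
  assumes "finite F" "k \<ge> 1" "\<And>n. n \<in> F \<Longrightarrow> real n ^ k * t \<in> \<int>"
  shows "real (Gcd F) ^ k * t \<in> \<int>"
  using assms(1,3)
proof (induction F rule: finite_induct)
  case empty
  thus ?case using assms(2) by (simp add: power_0_left)
next
  case (insert n F)
  define m where "m = Gcd F"
  obtain u v :: int where uv: "u * int (n ^ k) + v * int (m ^ k) = gcd (int (n ^ k)) (int (m ^ k))"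
    using bezout_int by blast
  have "gcd (int (n ^ k)) (int (m ^ k)) = int (gcd n m ^ k)" by (simp add: gcd_exp)
  with uv have "real_of_int (u * int (n ^ k) + v * int (m ^ k)) = real_of_int (int (gcd n m ^ k))" by simp
  hence g: "of_int u * real n ^ k + of_int v * real m ^ k = real (gcd n m) ^ k" by simp
  have "real (gcd n m) ^ k * t = of_int u * (real n ^ k * t) + of_int v * (real m ^ k * t)"
    unfolding g[symmetric] by (simp only: distrib_right mult.assoc)
  moreover have "real n ^ k * t \<in> \<int>" "real m ^ k * t \<in> \<int>" using insert by (auto simp: m_def)
  ultimately show ?case by (simp add: m_def)
qed

text \<open>The many \<open>p' \<le> p\<close> force \<open>m ^ k * \<theta>\<close> close to \<open>b / q\<close> with \<open>q < p\<close>, so the prime \<open>p\<close>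
  cancels completely from the fraction \<open>round ((m * p) ^ k * \<theta>) / (m * p) ^ k\<close>.\<close>

lemma prime_power_dvd_round:
  fixes C k m p :: nat and d e x :: real
  assumes rec: "\<forall>M d P e x f. npoly k M f \<longrightarrow> 0 < d \<longrightarrow> d \<le> 1 \<longrightarrow>
     real C * (M / d) ^ C \<le> real P \<longrightarrow> 0 \<le> e \<longrightarrow> e * (real C * (M / d) ^ C) \<le> 1 \<longrightarrow>
     real (card {p\<in>{1..P}. nint_dist (real (f p) * x) \<le> e}) \<ge> d * real P \<longrightarrow>
     (\<exists>q\<ge>1. real q \<le> real C * (M / d) ^ C \<and> nint_dist (real q * x) \<le> real C * (M / d) ^ C * e / real P ^ k)"
    and d: "0 < d" "d \<le> 1" and e: "0 \<le> e" and Y: "Y = real C * (1 / d) ^ C" "Y \<ge> 1" "Y < real p" "2 * e * Y < 1"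
    and p: "prime p" and near: "nint_dist (real p ^ k * x) \<le> e"
    and many: "real (card {p'\<in>{1..p}. nint_dist (real p' ^ k * x) \<le> e}) \<ge> d * real p"
  shows "int p ^ k dvd round (real p ^ k * x)"
proof -
  have "e * Y \<le> 1" "real C * (1 / d) ^ C \<le> real p" using e Y by auto
  moreover have "real (card {p'\<in>{1..p}. nint_dist (real (p' ^ k) * x) \<le> e}) \<ge> d * real p" using many by simp
  ultimately obtain q where q: "q \<ge> 1" "real q \<le> Y" "nint_dist (real q * x) \<le> Y * e / real p ^ k"
    using rec[rule_format, OF npoly_power[of k] d, of p e x] e Y(1) by auto
  define b r where "b = round (real q * x)" and "r = round (real p ^ k * x)"
  have p0: "real p ^ k > 0" using p by (simp add: prime_gt_0_nat)
  have 1: "real p ^ k * \<bar>real q * x - of_int b\<bar> \<le> Y * e"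
    using q(3) p0 by (simp add: nint_dist_def b_def field_simps)
  have 2: "real q * \<bar>real p ^ k * x - of_int r\<bar> \<le> Y * e"
    using q(2) near by (intro mult_mono) (auto simp: nint_dist_def r_def)
  have "\<bar>of_int (int p ^ k * b - int q * r)\<bar> = \<bar>real q * (real p ^ k * x - of_int r) - real p ^ k * (real q * x - of_int b)\<bar>"
    by (simp add: algebra_simps)
  also have "\<dots> \<le> \<bar>real q * (real p ^ k * x - of_int r)\<bar> + \<bar>real p ^ k * (real q * x - of_int b)\<bar>" by (rule abs_triangle_ineq4)
  also have "\<dots> \<le> 2 * e * Y" using 1 2 p0 by (simp add: abs_mult mult_ac)
  also have "\<dots> < 1" by (rule Y)
  finally have "\<bar>int p ^ k * b - int q * r\<bar> < 1" by linarith
  \<comment> \<open>An integer of absolute value below one vanishes. Since \<open>q < p\<close>, the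
    prime \<open>p\<close> does not divide \<open>q\<close>, and all of \<open>p ^ k\<close> must
    divide \<open>r\<close>.\<close>
  hence eq: "int p ^ k * b = int q * r" by linarith
  have "q < p" using q Y by linarith
  hence "\<not> p dvd q" using q(1) by (auto dest: dvd_imp_le)
  hence "coprime p q" using p prime_imp_coprime by blast
  hence "coprime (int p ^ k) (int q)" by simp
  moreover have "int p ^ k dvd int q * r" using eq by (metis dvd_triv_left)
  ultimately show ?thesis by (simp add: coprime_dvd_mult_right_iff r_def)
qed

text \<open>Distinct fractions with these denominators differ by at least
  \<open>N powr (- 2 * k / 5)\<close>, but both lie within \<open>e * N powr (- 9 * k / 10)\<close>
  of \<open>t\<close>.\<close>

lemma common_fraction:
  fixes n1 n2 h1 h2 k :: nat and r1 r2 :: int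
  assumes n: "n1 > 0" "n2 > 0" "h1 > 0" "h2 > 0" and N: "N \<ge> 1" and e: "0 \<le> e" "2 * e < 1"
    and h: "real h1 \<le> N powr (1/5)" "real h2 \<le> N powr (1/5)" and nN: "N powr (9/10) \<le> real n1" "N powr (9/10) \<le> real n2"
    and near: "\<bar>t - of_int r1 / real h1 ^ k\<bar> \<le> e / real n1 ^ k" "\<bar>t - of_int r2 / real h2 ^ k\<bar> \<le> e / real n2 ^ k"
  shows "of_int r1 / real h1 ^ k = (of_int r2 / real h2 ^ k :: real)"
proof (rule ccontr)
  assume neq: "of_int r1 / real h1 ^ k \<noteq> (of_int r2 / real h2 ^ k :: real)"
  define H where "H = real h1 ^ k * real h2 ^ k"
  have H: "H > 0" using n by (simp add: H_def)
  define v where "v = r1 * int h2 ^ k - r2 * int h1 ^ k"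
  have dv: "of_int r1 / real h1 ^ k - of_int r2 / real h2 ^ k = of_int v / H"
    using n by (simp add: v_def H_def field_simps)
  hence "v \<noteq> 0" using neq by auto
  hence "1 \<le> \<bar>of_int v :: real\<bar>" by linarith
  hence "1 / H \<le> \<bar>of_int r1 / real h1 ^ k - of_int r2 / real h2 ^ k\<bar>" unfolding dv using H by (simp add: divide_right_mono)
  also have "\<dots> \<le> e / real n1 ^ k + e / real n2 ^ k" using near by linarith
  also have "\<dots> \<le> e / (N powr (9/10)) ^ k + e / (N powr (9/10)) ^ k"
    using e nN N n by (intro add_mono divide_left_mono power_mono mult_pos_pos zero_less_power) auto
  also have "\<dots> = 2 * e / (N powr (9/10)) ^ k" by simp
  finally have 1: "1 / H \<le> 2 * e / (N powr (9/10)) ^ k" .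
  have "H \<le> (N powr (1/5)) ^ k * (N powr (1/5)) ^ k"
    unfolding H_def using h by (intro mult_mono power_mono) auto
  also have "\<dots> = (N powr (2/5)) ^ k" by (simp add: power_mult_distrib[symmetric] powr_add[symmetric])
  also have "\<dots> \<le> (N powr (9/10)) ^ k" using N by (intro power_mono powr_mono) auto
  finally have HN: "H \<le> (N powr (9/10)) ^ k" .
  have NN: "(N powr (9/10)) ^ k > 0" using N by simp
  have "2 * e / (N powr (9/10)) ^ k < 1 / (N powr (9/10)) ^ k" using e NN by (intro divide_strict_right_mono)
  also have "\<dots> \<le> 1 / H" using HN H NN by (intro divide_left_mono) auto
  finally show False using 1 by simp
qed

text \<open>Fix \<open>m\<close> and let \<open>ps\<close> be its largest bad prime. Every bad
  \<open>p\<close> satisfies \<open>p \<le> ps\<close> and \<open>m * p \<in> A\<close>, so badness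
  of \<open>ps\<close> alone bounds their number by \<open>d * ps\<close>. Compared with the weight
  of all primes that can be attached to \<open>m\<close>, at most the proportion
  \<open>2 * d * L / c\<close> is bad.\<close>

lemma (in chebyshev) sum_bad_mass_le:
  fixes A :: "nat set" and bad :: "nat \<Rightarrow> nat \<Rightarrow> bool" and N L d w a b :: real
  defines "bad \<equiv> (\<lambda>m p. m * p \<in> A \<and> real (card {p'\<in>{1..p}. m * p' \<in> A}) < d * real p)"
  assumes A: "A \<subseteq> smooth_upto N a b" and N: "N \<le> exp L" and L: "L \<ge> 0" and d: "d \<ge> 0" and w: "w \<ge> 2" "w \<ge> 4 / c * a"
  shows "(\<Sum>n\<in>A. \<Sum>p | prime p \<and> p dvd n \<and> w < real p \<and> bad (n div p) p. ln (real p)) \<le> 2 * d * L\<^sup>2 / c * Psi a b N"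
proof -
  let ?S = "smooth_upto N a b"
  define Q where "Q = {p. prime p \<and> a \<le> real p \<and> w < real p \<and> real p \<le> b}"
  define Q' where "Q' = {p. prime p \<and> a \<le> real p \<and> real p \<le> b}"
  have finQ: "finite Q" "finite Q'" unfolding Q_def Q'_def
    using finite_le_real[of prime b] by (auto intro: finite_subset[rotated])
  have finA: "finite A" using A by (rule finite_subset) simp
  have Qp': "p > 0" if "p \<in> Q'" for p using that by (auto simp: Q'_def prime_gt_0_nat)
  have lnp: "0 \<le> ln (real p)" if "p \<in> Q" for p using that by (auto simp: Q_def prime_gt_0_nat Suc_leI)
  have "(\<Sum>n\<in>A. \<Sum>p | prime p \<and> p dvd n \<and> w < real p \<and> bad (n div p) p. ln (real p)) =
        (\<Sum>n\<in>A. \<Sum>p | p \<in> Q \<and> (p dvd n \<and> bad (n div p) p). ln (real p))"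
  proof (intro sum.cong refl arg_cong[of _ _ "\<lambda>P. sum _ P"])
    fix n assume "n \<in> A"
    hence "n \<in> smooth_set a b" using A by (auto simp: smooth_upto_iff)
    thus "{p. prime p \<and> p dvd n \<and> w < real p \<and> bad (n div p) p} = {p. p \<in> Q \<and> (p dvd n \<and> bad (n div p) p)}"
      by (auto simp: Q_def dest: prime_dvd_smooth)
  qed
  also have "\<dots> = (\<Sum>p\<in>Q. \<Sum>n | n \<in> A \<and> (p dvd n \<and> bad (n div p) p). ln (real p))"
    by (rule sum.swap_restrict[OF finA finQ(1)])
  also have "\<dots> \<le> (\<Sum>p\<in>Q. \<Sum>m | m \<in> ?S \<and> bad m p. ln (real p))"
  proof (rule sum_mono)
    fix p assume p: "p \<in> Q"
    have "card {n. n \<in> A \<and> (p dvd n \<and> bad (n div p) p)} \<le> card {m. m \<in> ?S \<and> bad m p}"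
    proof (rule card_inj_on_le[where f = "\<lambda>n. n div p"])
      show "inj_on (\<lambda>n. n div p) {n. n \<in> A \<and> (p dvd n \<and> bad (n div p) p)}" by (rule inj_onI) (auto elim!: dvdE)
      show "(\<lambda>n. n div p) ` {n. n \<in> A \<and> (p dvd n \<and> bad (n div p) p)} \<subseteq> {m. m \<in> ?S \<and> bad m p}"
      proof safe
        fix n assume n: "n \<in> A" "p dvd n" "bad (n div p) p"
        have "n \<in> ?S" using n A by auto
        moreover have "n div p dvd n" using n(2) by (metis dvd_div_mult_self dvd_triv_left)
        moreover have "n div p \<le> n" by simp
        ultimately show "n div p \<in> ?S" using smooth_set_dvd by (auto simp: smooth_upto_iff intro: order_trans[of _ "real n"])
      qed
    qed simp
    thus "(\<Sum>n | n \<in> A \<and> (p dvd n \<and> bad (n div p) p). ln (real p)) \<le> (\<Sum>m | m \<in> ?S \<and> bad m p. ln (real p))"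
      using lnp[OF p] by (simp add: mult_right_mono)
  qed
  also have "\<dots> = (\<Sum>m\<in>?S. \<Sum>p | p \<in> Q \<and> bad m p. ln (real p))"
    by (rule sum.swap_restrict) (use finQ in auto)
  also have "\<dots> \<le> (\<Sum>m\<in>?S. (2 * d * L / c) * (\<Sum>p | p \<in> Q' \<and> real p \<le> N / real m. ln (real p)))"
  proof (rule sum_mono)
    fix m assume m: "m \<in> ?S"
    have m0: "m > 0" using m by (auto simp: smooth_upto_iff smooth_set_pos)
    define Bm where "Bm = {p. p \<in> Q \<and> bad m p}"
    have finB: "finite Bm" using finQ by (simp add: Bm_def)
    show "(\<Sum>p | p \<in> Q \<and> bad m p. ln (real p)) \<le> (2 * d * L / c) * (\<Sum>p | p \<in> Q' \<and> real p \<le> N / real m. ln (real p))"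
    proof (cases "Bm = {}")
      case True
      have "(\<Sum>p | p \<in> Q \<and> bad m p. ln (real p)) = 0" using True unfolding Bm_def by (simp only: sum.empty)
      also have "0 \<le> (2 * d * L / c) * (\<Sum>p | p \<in> Q' \<and> real p \<le> N / real m. ln (real p))"
        using d L c_pos Qp' by (intro mult_nonneg_nonneg sum_nonneg) (auto simp: Suc_leI)
      finally show ?thesis .
    next
      case False
      define ps where "ps = Max Bm"
      have ps: "ps \<in> Bm" "\<And>p. p \<in> Bm \<Longrightarrow> p \<le> ps" using finB False by (auto simp: ps_def)
      have inA: "m * p \<in> A" "p \<in> Q" if "p \<in> Bm" for p using that by (auto simp: Bm_def bad_def)
      have mpN: "real p \<le> N / real m" "real p \<le> N" if "p \<in> Bm" for p
      proof -
        have "m * p \<in> ?S" using inA[OF that] A by auto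
        hence mp: "real m * real p \<le> N" by (simp add: smooth_upto_iff)
        thus "real p \<le> N / real m" using m0 by (simp add: field_simps)
        have "1 * real p \<le> real m * real p" using m0 by (intro mult_right_mono) auto
        with mp show "real p \<le> N" by simp
      qed
      define Z where "Z = min b (N / real m)"
      have psZ: "real ps \<le> Z" "w < Z" using mpN(1)[OF ps(1)] inA(2)[OF ps(1)] by (auto simp: Z_def Q_def)
      have "card Bm \<le> card {p'\<in>{1..ps}. m * p' \<in> A}"
        using ps inA finQ by (intro card_mono) (auto simp: Q_def Suc_le_eq prime_gt_0_nat)
      also have "real \<dots> \<le> d * real ps" using ps(1) by (auto simp: Bm_def bad_def)
      also have "\<dots> \<le> d * Z" using psZ d by (intro mult_left_mono) auto
      finally have cB: "real (card Bm) \<le> d * Z" by simp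
      have "(\<Sum>p\<in>Bm. ln (real p)) \<le> (\<Sum>p\<in>Bm. L)"
      proof (rule sum_mono)
        fix p assume p: "p \<in> Bm"
        have "ln (real p) \<le> ln (exp L)" using mpN(2)[OF p] N inA(2)[OF p] 
          by (subst ln_le_cancel_iff) (auto simp: Q_def prime_gt_0_nat)
        thus "ln (real p) \<le> L" by simp
      qed
      also have "\<dots> = real (card Bm) * L" by simp
      also have "\<dots> \<le> d * Z * L" using cB L by (intro mult_right_mono)
      also have "\<dots> = (2 * d * L / c) * (c / 2 * Z)" using c_pos by simp
      also have "\<dots> \<le> (2 * d * L / c) * (\<Sum>p | prime p \<and> a \<le> real p \<and> real p \<le> Z. ln (real p))"
        using psZ w d L c_pos by (intro mult_left_mono rough_theta_ge) auto
      also have "{p. prime p \<and> a \<le> real p \<and> real p \<le> Z} = {p. p \<in> Q' \<and> real p \<le> N / real m}"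
        by (auto simp: Z_def Q'_def)
      finally show ?thesis by (simp add: Bm_def)
    qed
  qed
  also have "\<dots> = (2 * d * L / c) * (\<Sum>m\<in>?S. \<Sum>p | p \<in> Q' \<and> real p \<le> N / real m. ln (real p))" by (simp only: sum_distrib_left)
  also have "(\<Sum>m\<in>?S. \<Sum>p | p \<in> Q' \<and> real p \<le> N / real m. ln (real p)) = (\<Sum>p\<in>Q'. ln (real p) * Psi a b (N / real p))"
    by (rule sum_over_cofactors[OF finQ(2) Qp', symmetric])
  also have "(2 * d * L / c) * \<dots> \<le> (2 * d * L / c) * (Psi a b N * L)"
    using d L c_pos N finQ by (intro mult_left_mono sum_ln_primes_Psi_le) (auto simp: Q'_def)
  also have "\<dots> = 2 * d * L\<^sup>2 / c * Psi a b N" by (simp add: power2_eq_square)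
  finally show ?thesis .
qed

text \<open>\<open>U\<close> is the point where the decay
  \<open>2 * u powr (- (ln 2 / ln z))\<close> falls to \<open>\<delta> / 2\<close>. It bounds both
  the gcd \<open>g\<close> and the ratio of \<open>N\<close> to the largest good \<open>n\<close>:
  the denominator \<open>g ^ k\<close> costs \<open>U ^ k\<close>, and the error costs a second
  \<open>U ^ k\<close> for replacing \<open>n ^ k\<close> by \<open>N ^ k\<close>.\<close>

lemma (in chebyshev) rational_approximation_large:
  fixes k C :: nat and N \<theta> a b e \<delta> L w z U :: real
  defines "L \<equiv> ln N" and "z \<equiv> 160 / c" and "U \<equiv> (4 / \<delta>) powr (ln z / ln 2)"
  defines "A \<equiv> {n \<in> smooth_upto N a b. nint_dist (real n ^ k * \<theta>) \<le> e}"
  assumes k: "k \<ge> 1"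
    and rec: "\<forall>M d P e x f. npoly k M f \<longrightarrow> 0 < d \<longrightarrow> d \<le> 1 \<longrightarrow>
     real C * (M / d) ^ C \<le> real P \<longrightarrow> 0 \<le> e \<longrightarrow> e * (real C * (M / d) ^ C) \<le> 1 \<longrightarrow>
     real (card {p\<in>{1..P}. nint_dist (real (f p) * x) \<le> e}) \<ge> d * real P \<longrightarrow>
     (\<exists>q\<ge>1. real q \<le> real C * (M / d) ^ C \<and> nint_dist (real q * x) \<le> real C * (M / d) ^ C * e / real P ^ k)"
    and C: "C \<ge> 1" and N: "N > 1" "L \<ge> 2" and w: "w \<ge> 2" "w \<ge> 4 / c * a" "real C * L ^ (2 * C) < w"
    and e: "0 < e" "2 * e * (real C * L ^ (2 * C)) < 1"
    and irr: "real (card {n \<in> smooth_upto N a b. \<not> regular a w N n}) \<le> Psi a b N / L\<^sup>2"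
    and dbl: "\<And>x. sqrt N \<le> x \<Longrightarrow> x \<le> N \<Longrightarrow> Psi a b x \<le> Psi a b (z * x) / 2"
    and \<delta>: "0 < \<delta>" "\<delta> \<le> 1" "1 / ln L \<le> \<delta>" and lL: "ln L > 0" "20 / (c * L) + 1 / L\<^sup>2 \<le> 1 / (2 * ln L)"
    and size: "(4 * ln L) powr (ln z / ln 2) < sqrt N"
    and many: "real (card A) \<ge> \<delta> * Psi a b N"
  shows "\<exists>q::nat. q > 0 \<and> real q \<le> U ^ k \<and> nint_dist (real q * \<theta>) \<le> U ^ (2 * k) * (e / N ^ k)"
proof -
  let ?S = "smooth_upto N a b"
  have L0: "L > 0" using N by simp
  have NL: "N = exp L" using N by (simp add: L_def)
  have z80: "z \<ge> 80" using c_le c_pos by (simp add: z_def field_simps)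
  \<comment> \<open>With \<open>d = 1 / L\<^sup>2\<close> the total bad weight is at most
    \<open>2 / c\<close> per smooth integer, so only a proportion \<open>20 / (c * L)\<close> can
    have bad weight above \<open>L / 10\<close>. The price is that the recurrence bound
    \<open>Y\<close> is a power of \<open>L\<close>.\<close>
  define d Y where "d = 1 / L\<^sup>2" and "Y = real C * L ^ (2 * C)"
  have d: "0 < d" "d \<le> 1" using N by (auto simp: d_def power_le_one_iff self_le_power)
  have Y: "Y = real C * (1 / d) ^ C" by (simp add: Y_def d_def power_mult)
  have "1 \<le> L ^ (2 * C)" using N by (intro one_le_power) auto
  hence Y1: "Y \<ge> 1" unfolding Y_def using C mult_mono[of 1 "real C" 1 "L ^ (2 * C)"] by simp
  have e2: "2 * e < 1"
  proof -
    have "2 * e * 1 \<le> 2 * e * Y" using Y1 e by (intro mult_left_mono) auto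
    with e(2) show ?thesis by (simp add: Y_def)
  qed
  define bad where "bad = (\<lambda>m p. m * p \<in> A \<and> real (card {p'\<in>{1..p}. m * p' \<in> A}) < d * real p)"
  define bm where "bm = (\<lambda>n. \<Sum>p | prime p \<and> p dvd n \<and> w < real p \<and> bad (n div p) p. ln (real p))"
  define I where "I = {n \<in> ?S. \<not> regular a w N n}"
  define Bd where "Bd = {n \<in> A. bm n > L / 10}"
  define Gd where "Gd = {n \<in> A. regular a w N n \<and> bm n \<le> L / 10}"
  have AS: "A \<subseteq> ?S" by (auto simp: A_def)
  have finA: "finite A" using AS by (rule finite_subset) simp
  have fin: "finite I" "finite Bd" "finite Gd" using finA by (auto simp: I_def Bd_def Gd_def)
  have bm0: "bm n \<ge> 0" for n unfolding bm_def by (intro sum_nonneg) (auto simp: prime_gt_0_nat Suc_leI)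
  have "real (card Bd) * (L / 10) = (\<Sum>n\<in>Bd. L / 10)" by simp
  also have "\<dots> \<le> (\<Sum>n\<in>Bd. bm n)" by (intro sum_mono) (auto simp: Bd_def)
  also have "\<dots> \<le> (\<Sum>n\<in>A. bm n)" using finA bm0 by (intro sum_mono2) (auto simp: Bd_def)
  also have "\<dots> \<le> 2 * d * L\<^sup>2 / c * Psi a b N"
    unfolding bm_def bad_def using AS d L0 w by (intro sum_bad_mass_le) (auto simp: NL)
  also have "\<dots> = 2 / c * Psi a b N" using L0 by (simp add: d_def)
  finally have cB: "real (card Bd) \<le> 20 / (c * L) * Psi a b N" using L0 c_pos by (simp add: field_simps)
  have "A \<subseteq> Gd \<union> (I \<union> Bd)" using AS by (auto simp: Gd_def I_def Bd_def)
  hence "card A \<le> card (Gd \<union> (I \<union> Bd))" using fin by (intro card_mono) auto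
  also have "\<dots> \<le> card Gd + (card I + card Bd)"
    using card_Un_le[of Gd "I \<union> Bd"] card_Un_le[of I Bd] by linarith
  finally have "\<delta> * Psi a b N \<le> real (card Gd) + (real (card I) + real (card Bd))" using many by linarith
  also have "real (card I) + real (card Bd) \<le> (20 / (c * L) + 1 / L\<^sup>2) * Psi a b N"
    using cB irr unfolding I_def[symmetric] by (simp add: distrib_right)
  also have "\<dots> \<le> 1 / (2 * ln L) * Psi a b N" using lL(2) by (intro mult_right_mono) auto
  \<comment> \<open>Here \<open>1 / ln L \<le> \<delta>\<close> makes the exceptional sets at most
    half of the guaranteed size of \<open>A\<close>.\<close>
  also have "\<dots> \<le> \<delta> / 2 * Psi a b N" using \<delta>(3) by (intro mult_right_mono) auto
  finally have cG: "real (card Gd) \<ge> \<delta> / 2 * Psi a b N" by simp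
  have P1: "Psi a b N \<ge> 1" using N by (intro Psi_ge_1) auto
  have "\<delta> / 2 * Psi a b N > 0" using P1 \<delta> by (intro mult_pos_pos) auto
  hence Gne: "Gd \<noteq> {}" using cG by auto
  have frac: "\<exists>(r::int) h. h > 0 \<and> real h \<le> N powr (1/5) \<and> real n ^ k * (of_int r / real h ^ k) \<in> \<int> \<and>
      \<bar>\<theta> - of_int r / real h ^ k\<bar> \<le> e / real n ^ k" if n: "n \<in> Gd" for n
  proof -
    have nS: "n \<in> smooth_set a b" and reg: "regular a w N n" and bmn: "bm n \<le> L / 10" and nA: "n \<in> A"
      using n AS by (auto simp: Gd_def smooth_upto_iff)
    have n0: "n > 0" using nS by (rule smooth_set_pos)
    define P where "P = {p. prime p \<and> p dvd n \<and> real p > w}"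
    note dec = regular_decomposition[OF nS reg, folded P_def]
    define Gp where "Gp = {p \<in> P. \<not> bad (n div p) p}"
    \<comment> \<open>\<open>h\<close> is what remains of \<open>n\<close> after cancelling the
      primes to which \<open>prime_power_dvd_round\<close> applies: the cofactor of the large primes
      and the bad large primes, each at most \<open>N powr (1/10)\<close>.\<close>
    define G h where "G = \<Prod>Gp" and "h = n div G"
    have finGp: "finite Gp" using dec(3) by (simp add: Gp_def)
    have "G dvd \<Prod>P" unfolding G_def using dec(3) by (intro prod_dvd_prod_subset) (auto simp: Gp_def)
    hence Gn: "G dvd n" using dec(1) by (rule dvd_trans)
    hence nGh: "n = G * h" by (simp add: h_def)
    have pos: "G > 0" "h > 0" using n0 nGh by (auto intro!: Nat.gr0I)
    have "int p ^ k dvd round (real n ^ k * \<theta>)" if p: "p \<in> Gp" for p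
    proof -
      have pp: "prime p" "p dvd n" "real p > w" using p by (auto simp: Gp_def P_def)
      have npn: "n div p * p = n" using pp by simp
      have "n div p * p \<in> A" using npn nA by simp
      hence m: "real (card {p'\<in>{1..p}. n div p * p' \<in> A}) \<ge> d * real p" using p by (auto simp: Gp_def bad_def not_less)
      define x where "x = real (n div p) ^ k * \<theta>"
      have px: "real p ^ k * x = real n ^ k * \<theta>"
        unfolding x_def by (subst npn[symmetric]) (simp only: of_nat_mult power_mult_distrib mult_ac)
      have "int p ^ k dvd round (real p ^ k * x)"
      proof (rule prime_power_dvd_round[OF rec d _ Y Y1 _ _ pp(1)])
        show "Y < real p" using w(3) pp(3) by (simp add: Y_def)
        show "2 * e * Y < 1" using e(2) by (simp add: Y_def)
        show "nint_dist (real p ^ k * x) \<le> e" unfolding px using nA by (simp add: A_def)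
        have "card {p'\<in>{1..p}. n div p * p' \<in> A} \<le> card {p'\<in>{1..p}. nint_dist (real p' ^ k * x) \<le> e}"
          by (intro card_mono) (auto simp: A_def x_def power_mult_distrib mult_ac)
        with m show "real (card {p'\<in>{1..p}. nint_dist (real p' ^ k * x) \<le> e}) \<ge> d * real p" by linarith
      qed (use e in auto)
      thus ?thesis by (simp only: px)
    qed
    hence "int G ^ k dvd round (real n ^ k * \<theta>)"
      unfolding G_def using finGp by (intro prod_primes_power_dvd) (auto simp: Gp_def P_def)
    then obtain r where r: "round (real n ^ k * \<theta>) = int G ^ k * r" by (auto elim: dvdE)
    have nk: "real n ^ k = real G ^ k * real h ^ k" by (subst nGh) (simp add: power_mult_distrib)
    have int: "real n ^ k * (of_int r / real h ^ k) = of_int (int G ^ k * r)" unfolding nk using pos by simp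
    have "\<bar>real n ^ k * \<theta> - of_int (int G ^ k * r)\<bar> \<le> e" using nA r by (simp add: A_def nint_dist_def)
    hence "\<bar>real n ^ k * (\<theta> - of_int r / real h ^ k)\<bar> \<le> e" unfolding right_diff_distrib int .
    also have "\<bar>real n ^ k * (\<theta> - of_int r / real h ^ k)\<bar> = \<bar>\<theta> - of_int r / real h ^ k\<bar> * real n ^ k"
      by (simp add: abs_mult)
    finally have near: "\<bar>\<theta> - of_int r / real h ^ k\<bar> \<le> e / real n ^ k"
      using n0 by (subst pos_le_divide_eq) auto
    have "(\<Sum>p\<in>P. ln (real p)) = (\<Sum>p\<in>Gp. ln (real p)) + bm n"
    proof -
      have "bm n = (\<Sum>p\<in>P - Gp. ln (real p))" unfolding bm_def by (intro sum.cong) (auto simp: P_def Gp_def)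
      thus ?thesis using sum.subset_diff[of Gp P "\<lambda>p. ln (real p)"] dec(3) by (simp add: Gp_def)
    qed
    moreover have "(\<Sum>p\<in>P. ln (real p)) \<ge> ln (real n) - L / 10"
    proof -
      define d' where "d' = n div \<Prod>P"
      have nd: "n = d' * \<Prod>P" using dec(1) by (simp add: d'_def)
      have d0: "d' > 0" "\<Prod>P > 0" using n0 nd by (auto intro!: Nat.gr0I)
      have "real n = real d' * real (\<Prod>P)" by (subst nd) simp
      hence "ln (real n) = ln (real d' * real (\<Prod>P))" by simp
      also have "\<dots> = ln (real d') + ln (real (\<Prod>P))" using d0 by (intro ln_mult_pos) (simp_all only: of_nat_0_less_iff)
      also have "ln (real d') \<le> ln (N powr (1/10))"
        using dec(2) d0 N by (subst ln_le_cancel_iff) (auto simp: d'_def)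
      also have "ln (N powr (1/10)) = L / 10" using N by (simp add: ln_powr L_def)
      also have "ln (real (\<Prod>P)) = (\<Sum>p\<in>P. ln (real p))"
        unfolding of_nat_prod using dec(3) by (subst ln_prod) (auto simp: P_def prime_gt_0_nat)
      finally show ?thesis by simp
    qed
    moreover have "ln (real n) = (\<Sum>p\<in>Gp. ln (real p)) + ln (real h)"
    proof -
      have "real n = real G * real h" by (subst nGh) simp
      hence "ln (real n) = ln (real G * real h)" by simp
      also have "\<dots> = ln (real G) + ln (real h)" using pos by (intro ln_mult_pos) auto
      also have "ln (real G) = (\<Sum>p\<in>Gp. ln (real p))"
        unfolding G_def of_nat_prod using finGp by (subst ln_prod) (auto simp: Gp_def P_def prime_gt_0_nat)
      finally show ?thesis .
    qed
    ultimately have "ln (real h) \<le> L / 5" using bmn by linarith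
    hence "exp (ln (real h)) \<le> exp (L / 5)" by simp
    hence "real h \<le> N powr (1/5)" using pos N by (simp add: powr_def L_def)
    thus ?thesis using pos(2) near int by (intro exI[of _ r] exI[of _ h]) auto
  qed
  have npos: "n > 0" "N powr (9/10) \<le> real n" "real n \<le> N" if "n \<in> Gd" for n
  proof -
    have n: "n \<in> smooth_set a b" "real n \<le> N" "regular a w N n" using that AS by (auto simp: Gd_def smooth_upto_iff)
    show "n > 0" using n(1) by (rule smooth_set_pos)
    show "N powr (9/10) \<le> real n" "real n \<le> N" using n by (auto simp: regular_def)
  qed
  obtain n0 where n0: "n0 \<in> Gd" using Gne by blast
  obtain r0 :: int and h0 where rh0: "h0 > 0" "real h0 \<le> N powr (1/5)" "real n0 ^ k * (of_int r0 / real h0 ^ k) \<in> \<int>"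
      "\<bar>\<theta> - of_int r0 / real h0 ^ k\<bar> \<le> e / real n0 ^ k" using frac[OF n0] by blast
  define \<phi> :: real where "\<phi> = of_int r0 / real h0 ^ k"
  have \<phi>: "real n ^ k * \<phi> \<in> \<int>" "\<bar>\<theta> - \<phi>\<bar> \<le> e / real n ^ k" if n: "n \<in> Gd" for n
  proof -
    obtain r :: int and h where rh: "h > 0" "real h \<le> N powr (1/5)" "real n ^ k * (of_int r / real h ^ k) \<in> \<int>"
      "\<bar>\<theta> - of_int r / real h ^ k\<bar> \<le> e / real n ^ k" using frac[OF n] by blast
    have "of_int r / real h ^ k = \<phi>" unfolding \<phi>_def
      by (rule common_fraction[of n n0 h h0 N e]) (use rh rh0 npos[OF n] npos[OF n0] N e e2 in auto)
    with rh show "real n ^ k * \<phi> \<in> \<int>" "\<bar>\<theta> - \<phi>\<bar> \<le> e / real n ^ k" by auto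
  qed
  \<comment> \<open>Used for \<open>u = g\<close>, since \<open>Gd\<close> consists of multiples of
    \<open>g\<close>, and for \<open>u = N / n1\<close>, since \<open>Gd\<close> lies below its
    maximum \<open>n1\<close>.\<close>
  have bound: "u \<le> U" if u: "u \<ge> 1" "\<delta> / 2 * Psi a b N \<le> Psi a b (N / u)" for u
  proof -
    define c0 where "c0 = ln 2 / ln z"
    have lz: "ln z > 0" using z80 by simp
    have c0: "c0 > 0" unfolding c0_def using lz by simp
    have aux: "v \<le> U" if v: "1 \<le> v" "v \<le> sqrt N" "\<delta> / 2 * Psi a b N \<le> Psi a b (N / v)" for v
    proof -
      have "Psi a b (N / v) \<le> 2 * v powr (- c0) * Psi a b N"
        unfolding c0_def by (rule Psi_decay) (use z80 N v dbl in auto)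
      with v(3) have "\<delta> / 2 * Psi a b N \<le> 2 * v powr (- c0) * Psi a b N" by linarith
      hence "\<delta> / 2 \<le> 2 * v powr (- c0)" using P1 by (simp add: mult_le_cancel_right)
      hence "v powr c0 \<le> 4 / \<delta>" using \<delta> v by (simp add: powr_minus field_simps)
      hence "(v powr c0) powr (1 / c0) \<le> (4 / \<delta>) powr (1 / c0)" using c0 by (intro powr_mono2) auto
      moreover have "(v powr c0) powr (1 / c0) = v" using c0 v by (simp add: powr_powr)
      moreover have "1 / c0 = ln z / ln 2" by (simp add: c0_def)
      ultimately show ?thesis by (simp add: U_def)
    qed
    show ?thesis
    proof (cases "u \<le> sqrt N")
      case True
      thus ?thesis using aux u by blast
    next
      case False
      have sN: "sqrt N \<ge> 1" using N by simp
      \<comment> \<open>The decay is available only up to \<open>sqrt N\<close>. A larger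
        \<open>u\<close> may be replaced by \<open>sqrt N\<close>, which forces
        \<open>sqrt N \<le> U\<close>; but \<open>U\<close> is at most a power of
        \<open>4 * ln L\<close>, and \<open>size\<close> excludes this.\<close>
      have "Psi a b (N / u) \<le> Psi a b (N / sqrt N)"
        using False sN N u by (intro Psi_mono divide_left_mono mult_pos_pos) auto
      hence "sqrt N \<le> U" using aux[of "sqrt N"] sN u by simp
      also have "U \<le> (4 * ln L) powr (ln z / ln 2)"
      proof -
        have "4 / \<delta> \<le> 4 * ln L" using \<delta> lL by (simp add: field_simps)
        thus ?thesis unfolding U_def using \<delta> lz by (intro powr_mono2) auto
      qed
      finally show ?thesis using size by simp
    qed
  qed
  define g where "g = Gcd Gd"
  have g0: "g > 0"
  proof -
    have "g dvd n0" unfolding g_def using n0 by (rule Gcd_dvd)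
    thus ?thesis using npos(1)[OF n0] by (auto intro!: Nat.gr0I)
  qed
  have gU: "real g \<le> U"
  proof (rule bound)
    have "Gd \<subseteq> {n \<in> ?S. g dvd n}" using AS by (auto simp: Gd_def g_def intro!: Gcd_dvd)
    hence "card Gd \<le> card {n \<in> ?S. g dvd n}" by (intro card_mono) auto
    hence "real (card Gd) \<le> Psi a b (N / g)" using card_smooth_multiples[OF g0, of N a b] by linarith
    with cG show "\<delta> / 2 * Psi a b N \<le> Psi a b (N / g)" by linarith
  qed (use g0 in auto)
  define n1 where "n1 = Max Gd"
  have n1: "n1 \<in> Gd" "\<And>n. n \<in> Gd \<Longrightarrow> n \<le> n1" using fin Gne by (auto simp: n1_def)
  have n1U: "N / real n1 \<le> U"
  proof (rule bound)
    have "Gd \<subseteq> smooth_upto (real n1) a b" using AS n1(2) by (auto simp: Gd_def smooth_upto_iff)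
    hence "real (card Gd) \<le> Psi a b (real n1)" unfolding Psi_def by (auto intro!: card_mono)
    moreover have "N / (N / real n1) = real n1" using N npos(1)[OF n1(1)] by simp
    ultimately show "\<delta> / 2 * Psi a b N \<le> Psi a b (N / (N / real n1))" using cG by simp
    show "1 \<le> N / real n1" using npos[OF n1(1)] by simp
  qed
  have gphi: "real g ^ k * \<phi> \<in> \<int>" unfolding g_def by (rule gcd_power_mult_Ints[OF fin(3) k \<phi>(1)])
  then obtain m :: int where m: "real g ^ k * \<phi> = of_int m" by (auto elim: Ints_cases)
  have U1: "U \<ge> 0" by (simp add: U_def)
  show ?thesis
  proof (intro exI[of _ "g ^ k"] conjI)
    show "g ^ k > 0" using g0 by simp
    show "real (g ^ k) \<le> U ^ k" using gU by (simp add: power_mono)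
    have "nint_dist (real (g ^ k) * \<theta>) \<le> \<bar>real (g ^ k) * \<theta> - of_int m\<bar>" by (rule nint_dist_le)
    also have "real (g ^ k) * \<theta> - of_int m = real g ^ k * (\<theta> - \<phi>)" by (simp add: m[symmetric] right_diff_distrib)
    also have "\<bar>\<dots>\<bar> = real g ^ k * \<bar>\<theta> - \<phi>\<bar>" by (simp add: abs_mult)
    also have "\<dots> \<le> real g ^ k * (e / real n1 ^ k)" using \<phi>(2)[OF n1(1)] by (intro mult_left_mono) auto
    also have "\<dots> = real g ^ k * (N / real n1) ^ k * (e / N ^ k)" using N by (simp add: power_divide)
    also have "\<dots> \<le> U ^ k * U ^ k * (e / N ^ k)"
      using gU n1U N e U1 by (intro mult_right_mono mult_mono power_mono) auto
    also have "U ^ k * U ^ k = U ^ (2 * k)" by (simp add: mult_2 power_add)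
    finally show "nint_dist (real (g ^ k) * \<theta>) \<le> U ^ (2 * k) * (e / N ^ k)" .
  qed
qed

text \<open>The order of quantifiers resolves the asymptotic notation: \<open>\<eta>\<close>,
  \<open>K\<^sub>0\<close>, \<open>C\<^sub>0\<close> depend on \<open>k\<close> only;
  \<open>B\<close>, \<open>c\<close>, \<open>N\<^sub>0\<close> are the constants implicit in the
  hypotheses on \<open>\<epsilon>\<close> and \<open>\<delta>\<close>; \<open>A\<^sub>1\<close>,
  \<open>D\<^sub>1\<close>, \<open>D\<^sub>2\<close> are fixed before \<open>C\<^sub>1\<close>,
  while \<open>A\<^sub>2\<close> comes after it, as the subscript in the last exponent
  allows.\<close>

theorem theorem7p1:
  fixes k :: nat
  assumes "k \<ge> 1"
  shows "\<exists>(\<eta>::real) (K\<^sub>0::real) (C\<^sub>0::real). 0 < \<eta> \<and> \<eta> < 1 \<and>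
    (\<forall>(K'::real) (K::real) (B::real) (c::real) (N\<^sub>0::real).
      K' > 0 \<and> K > max 2 (2 * K') \<and> K \<ge> K\<^sub>0 \<and> c > 0 \<longrightarrow>
      (\<exists>(A\<^sub>1::real) (D\<^sub>1::real) (D\<^sub>2::real). \<forall>(C\<^sub>1::real). C\<^sub>1 \<ge> 1 \<and> C\<^sub>1 \<ge> C\<^sub>0 \<longrightarrow>
        (\<exists>(A\<^sub>2::real). 
          \<forall>(\<delta> :: real \<Rightarrow> real) (N::real) (\<theta>::real) (y'::real) (y::real) (\<epsilon>::real).
            (\<forall>M>2. \<delta> M > 0) \<longrightarrow>
            (\<forall>M\<ge>N\<^sub>0. c * iter_ln 5 M \<le> 1 / \<delta> M \<and> 1 / \<delta> M < iter_ln 2 M) \<longrightarrow>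
            N > 2 \<longrightarrow>
            1 \<le> y' \<longrightarrow> y' \<le> ln N powr K' \<longrightarrow>
            ln N powr K \<le> y \<longrightarrow> y \<le> N powr \<eta> \<longrightarrow>
            0 < \<epsilon> \<longrightarrow> \<epsilon> \<le> \<delta> N / 2 \<longrightarrow>
            \<epsilon> < \<delta> N powr (- B) * ln N powr (- C\<^sub>1) \<longrightarrow>
            real (card {n \<in> smooth_upto N y' y. nint_dist (real n ^ k * \<theta>) \<le> \<epsilon>})
              \<ge> \<delta> N * real (smooth_count N y' y) \<longrightarrow>
            (\<exists>q::nat. q > 0 \<and>
              real q \<le> D\<^sub>1 * \<delta> N powr (- A\<^sub>1) \<and>
              nint_dist (real q * \<theta>) \<le> D\<^sub>2 * (\<epsilon> * \<delta> N powr (- A\<^sub>2) / N ^ k)))))"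
proof -
  obtain cc where cc: "cc > 0" "\<And>x. x \<ge> 2 \<Longrightarrow> theta x \<ge> cc * x" using theta_ge by blast
  interpret chebyshev cc by unfold_locales (use cc in auto)
  obtain C where C: "C \<ge> 1" and rec: "\<forall>M d P e x f. npoly k M f \<longrightarrow> 0 < d \<longrightarrow> d \<le> 1 \<longrightarrow>
     real C * (M / d) ^ C \<le> real P \<longrightarrow> 0 \<le> e \<longrightarrow> e * (real C * (M / d) ^ C) \<le> 1 \<longrightarrow>
     real (card {p\<in>{1..P}. nint_dist (real (f p) * x) \<le> e}) \<ge> d * real P \<longrightarrow>
     (\<exists>q\<ge>1. real q \<le> real C * (M / d) ^ C \<and> nint_dist (real q * x) \<le> real C * (M / d) ^ C * e / real P ^ k)"
    using polynomial_recurrence[of k] by blast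
  define z where "z = 160 / cc"
  define KK where "KK = 10 + 12 / (cc / (960 * z * ln (4 / cc))) + 36 * ln (4 / cc) + 9 * ln z"
  \<comment> \<open>The entry \<open>4 * C + 2\<close> makes \<open>L powr (K / 2)\<close> at least
    \<open>L powr (2 * C + 1)\<close>, hence larger than the denominators
    \<open>C * L ^ (2 * C)\<close> of the recurrence.\<close>
  define K0 where "K0 = max (max KK 10) (4 * real C + 2)"
  define E where "E = ln z / ln 2"
  have z80: "z \<ge> 80" using c_le c_pos by (simp add: z_def field_simps)
  have E0: "E > 0" using z80 by (simp add: E_def)
  show ?thesis
  \<comment> \<open>\<open>1 / 40\<close> is the bound on \<open>ln b / L\<close> that leaves room
    for four exchanges. The exponent \<open>2 * C + 3\<close> covers the loss
    \<open>L ^ (2 * C)\<close>, one factor \<open>L\<close> for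
    \<open>\<delta> N powr (- B)\<close>, and a square \<open>L\<^sup>2 \<ge> 2 * C\<close> for the
    constants.\<close>
  proof (rule exI[of _ "1/40"], rule exI[of _ K0], rule exI[of _ "2 * real C + 3"], intro conjI allI impI, goal_cases)
    case (3 K' K B c N0)
    have K: "K > 2 * K'" "K \<ge> KK" "K \<ge> 10" "K \<ge> 4 * real C + 2" using 3 by (auto simp: K0_def)
    have eL: "\<forall>\<^sub>F L in at_top.
      (\<forall>a b x. a \<le> L powr K' \<longrightarrow> L powr K \<le> b \<longrightarrow> L / 2 \<le> ln x \<longrightarrow> ln x \<le> L \<longrightarrow> x > 0 \<longrightarrow>
        real (card {n \<in> smooth_upto x a b. \<not> regular a (L powr (K / 2)) x n}) \<le> Psi a b x / L\<^sup>2) \<and>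
      (\<forall>a b x. a \<le> L powr K' \<longrightarrow> L powr K \<le> b \<longrightarrow> ln b \<le> L / 40 \<longrightarrow> L / 2 \<le> ln x \<longrightarrow> ln x \<le> L \<longrightarrow> x > 0 \<longrightarrow>
        Psi a b x \<le> Psi a b (z * x) / 2) \<and>
      4 / cc \<le> L powr (K / 2 - K') \<and> 2 * real C + 3 \<le> L \<and> 20 / (cc * L) + 1 / L\<^sup>2 \<le> 1 / (2 * ln L) \<and>
      (4 * ln L) powr E < exp (L / 2) \<and> ln L powr (\<bar>B\<bar> + 1) \<le> L \<and> 1 \<le> ln L"
    proof (intro eventually_conj)
      show "\<forall>\<^sub>F L in at_top. \<forall>a b x. a \<le> L powr K' \<longrightarrow> L powr K \<le> b \<longrightarrow> ln b \<le> L / 40 \<longrightarrow> L / 2 \<le> ln x \<longrightarrow> ln x \<le> L \<longrightarrow> x > 0 \<longrightarrow>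
        Psi a b x \<le> Psi a b (z * x) / 2"
        unfolding z_def by (rule Psi_doubling_eventually) (use K in \<open>auto simp: KK_def z_def\<close>)
      show "\<forall>\<^sub>F L in at_top. 20 / (cc * L) + 1 / L\<^sup>2 \<le> 1 / (2 * ln L)" using c_pos by real_asymp
      show "\<forall>\<^sub>F L in at_top. (4 * ln L) powr E < exp (L / 2)" using E0 by real_asymp
      \<comment> \<open>This exponent replaces \<open>B\<close> in order to be positive whatever the
        sign of \<open>B\<close>.\<close>
      have "\<bar>B\<bar> + 1 > 0" by simp
      thus "\<forall>\<^sub>F L in at_top. ln L powr (\<bar>B\<bar> + 1) \<le> L" by real_asymp
      show "\<forall>\<^sub>F L in at_top. 1 \<le> ln (L::real)" by real_asymp
      show "\<forall>\<^sub>F L in at_top. 4 / cc \<le> L powr (K / 2 - K')" using K by (intro eventually_const_le_powr) auto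
    qed (use card_irregular_eventually[OF K(3,1)] eventually_ge_at_top in auto)
    from eventually_compose_filterlim[OF eL ln_at_top]
    obtain N1' where N1': "\<And>N. N \<ge> N1' \<Longrightarrow>
      (\<forall>a b x. a \<le> ln N powr K' \<longrightarrow> ln N powr K \<le> b \<longrightarrow> ln N / 2 \<le> ln x \<longrightarrow> ln x \<le> ln N \<longrightarrow> x > 0 \<longrightarrow>
        real (card {n \<in> smooth_upto x a b. \<not> regular a (ln N powr (K / 2)) x n}) \<le> Psi a b x / (ln N)\<^sup>2) \<and>
      (\<forall>a b x. a \<le> ln N powr K' \<longrightarrow> ln N powr K \<le> b \<longrightarrow> ln b \<le> ln N / 40 \<longrightarrow> ln N / 2 \<le> ln x \<longrightarrow> ln x \<le> ln N \<longrightarrow> x > 0 \<longrightarrow>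
        Psi a b x \<le> Psi a b (z * x) / 2) \<and>
      4 / cc \<le> ln N powr (K / 2 - K') \<and> 2 * real C + 3 \<le> ln N \<and> 20 / (cc * ln N) + 1 / (ln N)\<^sup>2 \<le> 1 / (2 * ln (ln N)) \<and>
      (4 * ln (ln N)) powr E < exp (ln N / 2) \<and> ln (ln N) powr (\<bar>B\<bar> + 1) \<le> ln N \<and> 1 \<le> ln (ln N)"
      unfolding eventually_at_top_linorder by blast
    define N1 where "N1 = max (max N1' N0) 3"
    define A1 A2 where "A1 = real k * E" and "A2 = real (2 * k) * E"
    have A0: "A1 \<ge> 0" "A2 \<ge> 0" using E0 by (auto simp: A1_def A2_def)
    show ?case
    \<comment> \<open>In each maximum the first entry comes from the powers of \<open>U\<close>; the
      second settles \<open>N < N1\<close>, where \<open>q = n ^ k\<close> works for an arbitrary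
      \<open>n \<in> A\<close>.\<close>
    proof (rule exI[of _ A1], rule exI[of _ "max (4 powr A1) (N1 ^ k)"], rule exI[of _ "max (4 powr A2) (N1 ^ k)"],
        intro allI impI, rule exI[of _ A2], intro allI impI, goal_cases)
      case (1 C1 \<delta> N \<theta> y' y e)
      note h = 1
      define dl where "dl = \<delta> N"
      have dl: "dl > 0" using h(2,4) by (simp add: dl_def)
      define A where "A = {n \<in> smooth_upto N y' y. nint_dist (real n ^ k * \<theta>) \<le> e}"
      have many: "real (card A) \<ge> dl * Psi y' y N" using h(12) by (simp add: A_def dl_def Psi_def smooth_count_def)
      have P1: "Psi y' y N \<ge> 1" using h(4) by (intro Psi_ge_1) auto
      \<comment> \<open>The density assumption itself forces \<open>\<delta> N \<le> 1\<close>, so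
        that its negative powers are at least 1.\<close>
      have "real (card A) \<le> Psi y' y N" unfolding Psi_def A_def by (auto intro!: card_mono)
      with many have "dl * Psi y' y N \<le> 1 * Psi y' y N" by linarith
      hence dl1: "dl \<le> 1" using P1 by (simp add: mult_le_cancel_right)
      have dlp: "dl powr (-q) \<ge> 1" if "q \<ge> 0" for q
        using powr_mono2'[of "-q" dl 1] dl dl1 that by simp
      have Nk: "N ^ k > 0" using h(4) by simp
      show ?case
      proof (cases "N < N1")
        case True
        have "dl * Psi y' y N > 0" using dl P1 by (intro mult_pos_pos) auto
        hence "A \<noteq> {}" using many by auto
        then obtain n where n: "n \<in> A" by blast
        have n0: "n > 0" "real n \<le> N" "nint_dist (real n ^ k * \<theta>) \<le> e"
          using n by (auto simp: A_def smooth_upto_iff smooth_set_pos)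
        have nN1: "real n ^ k \<le> N1 ^ k" using n0 True by (intro power_mono) auto
        have NN1: "N ^ k \<le> N1 ^ k" using h(4) True by (intro power_mono) auto
        have N1k: "N1 ^ k \<ge> 0" by (simp add: N1_def)
        show ?thesis
        proof (intro exI[of _ "n ^ k"] conjI)
          show "n ^ k > 0" using n0 by simp
          have "real n ^ k * 1 \<le> max (4 powr A1) (N1 ^ k) * dl powr (- A1)"
            using nN1 dlp[OF A0(1)] by (intro mult_mono) (auto simp: le_max_iff_disj)
          thus "real (n ^ k) \<le> max (4 powr A1) (N1 ^ k) * \<delta> N powr (- A1)" by (simp add: dl_def)
          have "1 * (e * 1) \<le> (N1 ^ k / N ^ k) * (e * dl powr (- A2))"
            using NN1 Nk h(9) dlp[OF A0(2)] by (intro mult_mono) auto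
          also have "\<dots> \<le> (max (4 powr A2) (N1 ^ k) / N ^ k) * (e * dl powr (- A2))"
            using Nk h(9) by (intro mult_right_mono divide_right_mono) auto
          finally have "e \<le> max (4 powr A2) (N1 ^ k) * (e * dl powr (- A2) / N ^ k)" by simp
          with n0(3) show "nint_dist (real (n ^ k) * \<theta>) \<le> max (4 powr A2) (N1 ^ k) * (e * \<delta> N powr (- A2) / N ^ k)"
            by (simp add: dl_def)
        qed
      next
        case False
        hence N: "N \<ge> N1'" "N \<ge> N0" "N \<ge> 3" by (auto simp: N1_def)
        define L where "L = ln N"
        note F = N1'[OF N(1), folded L_def]
        have F1: "real (card {n \<in> smooth_upto x a b. \<not> regular a (L powr (K / 2)) x n}) \<le> Psi a b x / L\<^sup>2"
          if "a \<le> L powr K'" "L powr K \<le> b" "L / 2 \<le> ln x" "ln x \<le> L" "x > 0" for a b x using F that by blast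
        have F2: "Psi a b x \<le> Psi a b (z * x) / 2"
          if "a \<le> L powr K'" "L powr K \<le> b" "ln b \<le> L / 40" "L / 2 \<le> ln x" "ln x \<le> L" "x > 0" for a b x using F that by blast
        have F3: "4 / cc \<le> L powr (K / 2 - K')" "2 * real C + 3 \<le> L" "20 / (cc * L) + 1 / L\<^sup>2 \<le> 1 / (2 * ln L)"
          "(4 * ln L) powr E < exp (L / 2)" "ln L powr (\<bar>B\<bar> + 1) \<le> L" "1 \<le> ln L" using F by auto
        have L3: "L \<ge> 3" using F3(2) by linarith
        have yb: "y' \<le> L powr K'" "L powr K \<le> y" using h by (auto simp: L_def)
        have "L powr K > 0" using L3 by simp
        hence y0: "y > 0" using yb by linarith
        have "ln y \<le> ln (N powr (1/40))" using h(8) y0 h(4) by (subst ln_le_cancel_iff) auto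
        hence lny: "ln y \<le> L / 40" using h(4) by (simp add: ln_powr L_def)
        have "iter_ln 2 N = ln L" by (simp add: iter_ln_def L_def eval_nat_numeral)
        hence "1 / dl < ln L" using h(3) N(2) by (auto simp: dl_def)
        hence dlL: "1 / ln L \<le> dl" using dl F3(6) by (simp add: field_simps)
        define w where "w = L powr (K / 2)"
        have wC: "real C * L ^ (2 * C) < w"
        proof -
          have "real C * L ^ (2 * C) < L * L ^ (2 * C)" using F3(2) L3 by (intro mult_strict_right_mono) auto
          also have "\<dots> = L powr (2 * real C + 1)" using L3 by (simp add: powr_add powr_realpow[symmetric])
          also have "\<dots> \<le> w" unfolding w_def using K L3 by (intro powr_mono) auto
          finally show ?thesis .
        qed
        have "L powr 1 \<le> w" unfolding w_def using L3 K by (intro powr_mono) auto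
        hence w2: "w \<ge> 2" using L3 by simp
        have wa: "4 / cc * y' \<le> w"
        proof -
          have "4 / cc * y' \<le> 4 / cc * L powr K'" using yb c_pos by (intro mult_left_mono) auto
          also have "\<dots> \<le> L powr (K / 2 - K') * L powr K'" using F3(1) by (intro mult_right_mono) auto
          also have "\<dots> = w" by (simp add: powr_add[symmetric] w_def)
          finally show ?thesis .
        qed
        have dlB: "dl powr (-B) \<le> L"
        proof -
          have inv: "(1 / v) powr (- s) = v powr s" if "v > 0" for v s :: real
            using that by (simp add: powr_minus powr_divide)
          have "dl powr (-B) \<le> dl powr (- (\<bar>B\<bar> + 1))" using dl dl1 by (intro powr_mono') auto
          also have "\<dots> \<le> (1 / ln L) powr (- (\<bar>B\<bar> + 1))" using dlL F3(6) by (intro powr_mono2') auto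
          also have "\<dots> = ln L powr (\<bar>B\<bar> + 1)" by (rule inv) (use F3(6) in simp)
          finally show ?thesis using F3(5) by simp
        qed
        have eC: "2 * e * (real C * L ^ (2 * C)) < 1"
        proof -
          have "L powr (- C1) \<le> L powr (- (2 * real C + 3))" using h(1) L3 by (intro powr_mono) auto
          hence "dl powr (-B) * L powr (- C1) \<le> L * L powr (- (2 * real C + 3))"
            using dlB L3 by (intro mult_mono) auto
          moreover have "e < dl powr (-B) * L powr (- C1)" using h(11) by (simp add: dl_def L_def)
          ultimately have eL: "e < L * L powr (- (2 * real C + 3))" by linarith
          also have "\<dots> = L powr (1 + - (2 * real C + 3))" using L3 by (simp only: powr_add) simp
          also have "1 + - (2 * real C + 3) = - (2 * real C + 2)" by simp
          also have "L powr (- (2 * real C + 2)) = 1 / L powr (2 * real C + 2)" by (rule powr_minus_divide)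
          also have "2 * real C + 2 = real (2 * C + 2)" by simp
          also have "L powr real (2 * C + 2) = L ^ (2 * C + 2)" using L3 by (intro powr_realpow) auto
          also have "L ^ (2 * C + 2) = L ^ (2 * C) * L ^ 2" by (rule power_add)
          finally have "e < 1 / (L ^ (2 * C) * L ^ 2)" .
          moreover have "L ^ (2 * C) * L ^ 2 > 0" using L3 by simp
          ultimately have "e * (L ^ (2 * C) * L ^ 2) < 1" by (simp only: pos_less_divide_eq)
          moreover have "2 * real C \<le> L ^ 2"
          proof -
            have "2 * real C \<le> L" using F3(2) by linarith
            also have "\<dots> \<le> L ^ 2" using L3 by (simp add: power2_eq_square)
            finally show ?thesis .
          qed
          hence "e * L ^ (2 * C) * (2 * real C) \<le> e * L ^ (2 * C) * L ^ 2" using h(9) L3 by (intro mult_left_mono) auto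
          ultimately show ?thesis by (simp add: mult_ac)
        qed
        have sq: "sqrt N = exp (L / 2)" using h(4) by (simp add: L_def powr_half_sqrt[symmetric] powr_def)
        have dbl: "Psi y' y x \<le> Psi y' y (z * x) / 2" if x: "sqrt N \<le> x" "x \<le> N" for x
        proof (rule F2[OF yb lny])
          have x0: "x > 0" using x(1) unfolding sq by (rule less_le_trans[rotated]) simp
          thus "x > 0" .
          show "L / 2 \<le> ln x" using x(1) x0 unfolding sq by (subst ln_ge_iff) auto
          show "ln x \<le> L" using x x0 unfolding L_def by (subst ln_le_cancel_iff) auto
        qed
        have irr: "real (card {n \<in> smooth_upto N y' y. \<not> regular y' w N n}) \<le> Psi y' y N / L\<^sup>2"
          unfolding w_def using yb L3 h(4) by (intro F1) (auto simp: L_def)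
        define U where "U = (4 / dl) powr E"
        have "\<exists>q::nat. q > 0 \<and> real q \<le> U ^ k \<and> nint_dist (real q * \<theta>) \<le> U ^ (2 * k) * (e / N ^ k)"
          unfolding U_def E_def z_def
        proof (rule rational_approximation_large[OF assms rec C, where w = w and a = y' and b = y])
          show "Psi y' y x \<le> Psi y' y (160 / cc * x) / 2" if "sqrt N \<le> x" "x \<le> N" for x
            using dbl[OF that] by (simp add: z_def)
          show "(4 * ln (ln N)) powr (ln (160 / cc) / ln 2) < sqrt N"
            using F3(4) unfolding sq by (simp add: E_def z_def L_def)
        qed (use h(4,9) L3 w2 wa wC eC irr dl dl1 dlL F3 many in \<open>auto simp: L_def A_def\<close>)
        then obtain q :: nat where q: "q > 0" "real q \<le> U ^ k" "nint_dist (real q * \<theta>) \<le> U ^ (2 * k) * (e / N ^ k)" by blast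
        have Up: "U ^ j = 4 powr (real j * E) * dl powr (- (real j * E))" for j
        proof -
          have U0: "U > 0" using dl by (simp add: U_def)
          have "U ^ j = U powr real j" using U0 by (simp add: powr_realpow)
          also have "\<dots> = (4 / dl) powr (real j * E)" by (simp add: U_def powr_powr mult.commute)
          also have "\<dots> = 4 powr (real j * E) / dl powr (real j * E)" using dl by (simp add: powr_divide)
          also have "\<dots> = 4 powr (real j * E) * dl powr (- (real j * E))" by (simp add: powr_minus_divide)
          finally show ?thesis .
        qed
        show ?thesis
        proof (intro exI[of _ q] conjI q(1))
          have "U ^ k = 4 powr A1 * dl powr (- A1)" unfolding A1_def by (rule Up)
          also have "\<dots> \<le> max (4 powr A1) (N1 ^ k) * dl powr (- A1)" by (intro mult_right_mono) auto
          finally show "real q \<le> max (4 powr A1) (N1 ^ k) * \<delta> N powr (- A1)" using q(2) by (simp add: dl_def)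
          have "U ^ (2 * k) * (e / N ^ k) = 4 powr A2 * (e * dl powr (- A2) / N ^ k)"
            unfolding A2_def Up by simp
          also have "\<dots> \<le> max (4 powr A2) (N1 ^ k) * (e * dl powr (- A2) / N ^ k)"
            using h(9) Nk by (intro mult_right_mono) auto
          finally show "nint_dist (real q * \<theta>) \<le> max (4 powr A2) (N1 ^ k) * (e * \<delta> N powr (- A2) / N ^ k)"
            using q(3) by (simp add: dl_def)
        qed
      qed
    qed
  qed auto
qed

end
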